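(* The theory $\mathsf{T}^1_2(\triangleleft)+\mathsf{PHP}(\Delta^b_1(\triangleleft))$ does not prove the sentence $\forall n\,\mathsf{MIN}(\triangleleft)_n$.
   Context: Bounded arithmetic language: constants $0,1$; unary operations $\lfloor x/2\rfloor$ and $|x|$ (bit length: $|0|=0$ and $|x|=\lfloor\log_2x\rfloor+1$ for $x>0$); binary operations $+,\cdot,\#$ with $x\#y=2^{|x|\cdot|y|}$; the relation $\le$; and an additional binary relation symbol $\triangleleft$. $\mathsf{BASIC}$ is Buss's standard finite base theory describing these symbols. A formula is sharply bounded ($\Delta^b_0(\triangleleft)$) if all its quantifiers are bounded by terms of the form $|t|$. $\Sigma^b_1(\triangleleft)$ is the smallest class of bounded formulas containing $\Delta^b_0(\triangleleft)$ and closed under $\land,\lor$, sharply bounded quantifiers $\forall x\le|t|,\exists x\le|t|$, and bounded existential quantifiers $\exists x\le t$ ($t$ not containing $x$). For a formula $\varphi(x,\bar y)$, $\mathsf{PIND}(\varphi)$ is $\forall\bar y[(\varphi(0,\bar y)\land\forall x(\varphi(\lfloor x/2\rfloor,\bar y)\to\varphi(x,\bar y)))\to\forall x\varphi(x,\bar y)]$. $\mathsf{S}^1_2(\triangleleft)$ is $\mathsf{BASIC}$ plus $\mathsf{PIND}$ for all $\Sigma^b_1(\triangleleft)$ formulas; $\mathsf{T}^1_2(\triangleleft)$ is $\mathsf{S}^1_2(\triangleleft)$ plus the usual induction scheme (step from $x$ to $x+1$) for all $\Sigma^b_1(\triangleleft)$ formulas. A formula $\varphi$ is $\Delta^b_1(\triangleleft)$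 if $\varphi\in\Sigma^b_1(\triangleleft)$ and there is $\psi\in\Sigma^b_1(\triangleleft)$ with $\mathsf{S}^1_2(\triangleleft)\vdash\varphi\leftrightarrow\neg\psi$. For a formula $\varphi(x,y,\bar z)$, $\mathsf{PHP}(\varphi)$ is the sentence $\forall\bar z\,\forall u,v\,(u>v\to\psi(u,v,\bar z))$, where $\psi$ is the disjunction of: $\exists x<u\,\forall y<v\,\neg\varphi(x,y,\bar z)$; $\exists x,x'<u\,\exists y<v\,(x\ne x'\land\varphi(x,y,\bar z)\land\varphi(x',y,\bar z))$; $\exists x<u\,\exists y,y'<v\,(y\ne y'\land\varphi(x,y,\bar z)\land\varphi(x,y',\bar z))$. $\mathsf{PHP}(\Delta^b_1(\triangleleft))$ is the set of all $\mathsf{PHP}(\varphi)$ with $\varphi\in\Delta^b_1(\triangleleft)$. $\mathsf{MIN}(\triangleleft)_n$ is the disjunction of: $\exists x<n\,(x\triangleleft x)$; $\exists x,y<n\,(x\ne y\land x\triangleleft y\land y\triangleleft x)$; $\exists x,y<n\,(x\ne y\land\neg(x\triangleleft y)\land\neg(y\triangleleft x))$; $\exists x,y,z<n\,(x\triangleleft y\land y\triangleleft z\land\neg(x\triangleleft z))$; $\exists x<n\,\forall y<n\,(x=y\lor x\triangleleft y)$. (I.e., if $\triangleleft$ is a strict linear order of $\{0,\dots,n-1\}$ then it has a least element.) *)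

theory Defs
  imports Main
begin

text \<open>
  First-order logic with equality over the language of bounded arithmetic with an additional
  binary relation symbol (constructor Prec). Variables are de Bruijn indices: under a quantifier
  index 0 is the bound variable, and index Suc i is the variable called i outside.
\<close>

datatype tm =
    Var nat
  | Zero  ("\<^bold>0")
  | One  ("\<^bold>1")
  | Half tm
  | Len tm
  | Add tm tm  (infixl "\<^bold>+" 65)
  | Mult tm tm  (infixl "\<^bold>*" 70)
  | Smash tm tm  (infixl "\<^bold>#" 70)

datatype fm =
    Eq tm tm  (infix "\<^bold>=" 50)
  | LessEq tm tm  (infix "\<^bold>\<le>" 50)
  | Prec tm tm  (infix "\<^bold>\<lhd>" 50)
  | Neg fm  ("\<^bold>\<not> _" [40] 40)
  | Conj fm fm  (infixr "\<^bold>\<and>" 35)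
  | Disj fm fm  (infixr "\<^bold>\<or>" 30)
  | Impl fm fm  (infixr "\<^bold>\<longrightarrow>" 25)
  | Forall fm
  | Exists fm

abbreviation Iff :: "fm \<Rightarrow> fm \<Rightarrow> fm"  (infix "\<^bold>\<longleftrightarrow>" 25)
  where "\<phi> \<^bold>\<longleftrightarrow> \<psi> \<equiv> (\<phi> \<^bold>\<longrightarrow> \<psi>) \<^bold>\<and> (\<psi> \<^bold>\<longrightarrow> \<phi>)"

abbreviation Less :: "tm \<Rightarrow> tm \<Rightarrow> fm"  (infix "\<^bold><" 50)
  where "s \<^bold>< t \<equiv> s \<^bold>\<le> t \<^bold>\<and> \<^bold>\<not> (s \<^bold>= t)"

primrec subst_tm :: "(nat \<Rightarrow> tm) \<Rightarrow> tm \<Rightarrow> tm" where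
  "subst_tm \<sigma> (Var i) = \<sigma> i"
| "subst_tm \<sigma> \<^bold>0 = \<^bold>0"
| "subst_tm \<sigma> \<^bold>1 = \<^bold>1"
| "subst_tm \<sigma> (Half t) = Half (subst_tm \<sigma> t)"
| "subst_tm \<sigma> (Len t) = Len (subst_tm \<sigma> t)"
| "subst_tm \<sigma> (s \<^bold>+ t) = subst_tm \<sigma> s \<^bold>+ subst_tm \<sigma> t"
| "subst_tm \<sigma> (s \<^bold>* t) = subst_tm \<sigma> s \<^bold>* subst_tm \<sigma> t"
| "subst_tm \<sigma> (s \<^bold># t) = subst_tm \<sigma> s \<^bold># subst_tm \<sigma> t"

definition lift_tm :: "tm \<Rightarrow> tm"
  where "lift_tm = subst_tm (\<lambda>i. Var (Suc i))"

definition under_binder :: "(nat \<Rightarrow> tm) \<Rightarrow> nat \<Rightarrow> tm"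
  where "under_binder \<sigma> i = (case i of 0 \<Rightarrow> Var 0 | Suc j \<Rightarrow> lift_tm (\<sigma> j))"

primrec subst :: "(nat \<Rightarrow> tm) \<Rightarrow> fm \<Rightarrow> fm" where
  "subst \<sigma> (s \<^bold>= t) = (subst_tm \<sigma> s \<^bold>= subst_tm \<sigma> t)"
| "subst \<sigma> (s \<^bold>\<le> t) = (subst_tm \<sigma> s \<^bold>\<le> subst_tm \<sigma> t)"
| "subst \<sigma> (s \<^bold>\<lhd> t) = (subst_tm \<sigma> s \<^bold>\<lhd> subst_tm \<sigma> t)"
| "subst \<sigma> (\<^bold>\<not> \<phi>) = (\<^bold>\<not> subst \<sigma> \<phi>)"
| "subst \<sigma> (\<phi> \<^bold>\<and> \<psi>) = (subst \<sigma> \<phi> \<^bold>\<and> subst \<sigma> \<psi>)"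
| "subst \<sigma> (\<phi> \<^bold>\<or> \<psi>) = (subst \<sigma> \<phi> \<^bold>\<or> subst \<sigma> \<psi>)"
| "subst \<sigma> (\<phi> \<^bold>\<longrightarrow> \<psi>) = (subst \<sigma> \<phi> \<^bold>\<longrightarrow> subst \<sigma> \<psi>)"
| "subst \<sigma> (Forall \<phi>) = Forall (subst (under_binder \<sigma>) \<phi>)"
| "subst \<sigma> (Exists \<phi>) = Exists (subst (under_binder \<sigma>) \<phi>)"

definition lift :: "fm \<Rightarrow> fm"
  where "lift = subst (\<lambda>i. Var (Suc i))"

text \<open>Eliminates variable 0 in favour of t and renumbers the remaining variables.\<close>

definition inst :: "tm \<Rightarrow> fm \<Rightarrow> fm"
  where "inst t = subst (\<lambda>i. case i of 0 \<Rightarrow> t | Suc j \<Rightarrow> Var j)"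

primrec fv_tm :: "tm \<Rightarrow> nat set" where
  "fv_tm (Var i) = {i}"
| "fv_tm \<^bold>0 = {}"
| "fv_tm \<^bold>1 = {}"
| "fv_tm (Half t) = fv_tm t"
| "fv_tm (Len t) = fv_tm t"
| "fv_tm (s \<^bold>+ t) = fv_tm s \<union> fv_tm t"
| "fv_tm (s \<^bold>* t) = fv_tm s \<union> fv_tm t"
| "fv_tm (s \<^bold># t) = fv_tm s \<union> fv_tm t"

primrec fv :: "fm \<Rightarrow> nat set" where
  "fv (s \<^bold>= t) = fv_tm s \<union> fv_tm t"
| "fv (s \<^bold>\<le> t) = fv_tm s \<union> fv_tm t"
| "fv (s \<^bold>\<lhd> t) = fv_tm s \<union> fv_tm t"
| "fv (\<^bold>\<not> \<phi>) = fv \<phi>"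
| "fv (\<phi> \<^bold>\<and> \<psi>) = fv \<phi> \<union> fv \<psi>"
| "fv (\<phi> \<^bold>\<or> \<psi>) = fv \<phi> \<union> fv \<psi>"
| "fv (\<phi> \<^bold>\<longrightarrow> \<psi>) = fv \<phi> \<union> fv \<psi>"
| "fv (Forall \<phi>) = {i. Suc i \<in> fv \<phi>}"
| "fv (Exists \<phi>) = {i. Suc i \<in> fv \<phi>}"

definition closure :: "fm \<Rightarrow> fm"
  where "closure \<phi> = (Forall ^^ (LEAST n. fv \<phi> \<subseteq> {..<n})) \<phi>"

text \<open>
  Classical natural deduction. Lifting the context in the rules AllI and ExE expresses that the
  eigenvariable, index 0, is fresh. Contexts may be infinite; derivations are finite.
\<close>

inductive proves :: "fm set \<Rightarrow> fm \<Rightarrow> bool"  (infix "\<turnstile>" 20) where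
  Assm: "\<phi> \<in> \<Gamma> \<Longrightarrow> \<Gamma> \<turnstile> \<phi>"
| NegI: "insert \<phi> \<Gamma> \<turnstile> \<psi> \<Longrightarrow> insert \<phi> \<Gamma> \<turnstile> \<^bold>\<not> \<psi> \<Longrightarrow> \<Gamma> \<turnstile> \<^bold>\<not> \<phi>"
| RAA: "insert (\<^bold>\<not> \<phi>) \<Gamma> \<turnstile> \<psi> \<Longrightarrow> insert (\<^bold>\<not> \<phi>) \<Gamma> \<turnstile> \<^bold>\<not> \<psi> \<Longrightarrow> \<Gamma> \<turnstile> \<phi>"
| ConjI: "\<Gamma> \<turnstile> \<phi> \<Longrightarrow> \<Gamma> \<turnstile> \<psi> \<Longrightarrow> \<Gamma> \<turnstile> \<phi> \<^bold>\<and> \<psi>"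
| ConjE1: "\<Gamma> \<turnstile> \<phi> \<^bold>\<and> \<psi> \<Longrightarrow> \<Gamma> \<turnstile> \<phi>"
| ConjE2: "\<Gamma> \<turnstile> \<phi> \<^bold>\<and> \<psi> \<Longrightarrow> \<Gamma> \<turnstile> \<psi>"
| DisjI1: "\<Gamma> \<turnstile> \<phi> \<Longrightarrow> \<Gamma> \<turnstile> \<phi> \<^bold>\<or> \<psi>"
| DisjI2: "\<Gamma> \<turnstile> \<psi> \<Longrightarrow> \<Gamma> \<turnstile> \<phi> \<^bold>\<or> \<psi>"
| DisjE: "\<Gamma> \<turnstile> \<phi> \<^bold>\<or> \<psi> \<Longrightarrow> insert \<phi> \<Gamma> \<turnstile> \<chi> \<Longrightarrow> insert \<psi> \<Gamma> \<turnstile> \<chi> \<Longrightarrow> \<Gamma> \<turnstile> \<chi>"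
| ImplI: "insert \<phi> \<Gamma> \<turnstile> \<psi> \<Longrightarrow> \<Gamma> \<turnstile> \<phi> \<^bold>\<longrightarrow> \<psi>"
| ImplE: "\<Gamma> \<turnstile> \<phi> \<^bold>\<longrightarrow> \<psi> \<Longrightarrow> \<Gamma> \<turnstile> \<phi> \<Longrightarrow> \<Gamma> \<turnstile> \<psi>"
| AllI: "lift ` \<Gamma> \<turnstile> \<phi> \<Longrightarrow> \<Gamma> \<turnstile> Forall \<phi>"
| AllE: "\<Gamma> \<turnstile> Forall \<phi> \<Longrightarrow> \<Gamma> \<turnstile> inst t \<phi>"
| ExI: "\<Gamma> \<turnstile> inst t \<phi> \<Longrightarrow> \<Gamma> \<turnstile> Exists \<phi>"
| ExE: "\<Gamma> \<turnstile> Exists \<phi> \<Longrightarrow> insert \<phi> (lift ` \<Gamma>) \<turnstile> lift \<chi> \<Longrightarrow> \<Gamma> \<turnstile> \<chi>"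
| EqI: "\<Gamma> \<turnstile> t \<^bold>= t"
| EqE: "\<Gamma> \<turnstile> s \<^bold>= t \<Longrightarrow> \<Gamma> \<turnstile> inst s \<phi> \<Longrightarrow> \<Gamma> \<turnstile> inst t \<phi>"

text \<open>
  The bound of a bounded quantifier is a term of the outer context; lifting it ensures that it
  does not contain the quantified variable.
\<close>

definition AllLe :: "tm \<Rightarrow> fm \<Rightarrow> fm"
  where "AllLe t \<phi> = Forall (Var 0 \<^bold>\<le> lift_tm t \<^bold>\<longrightarrow> \<phi>)"

definition ExLe :: "tm \<Rightarrow> fm \<Rightarrow> fm"
  where "ExLe t \<phi> = Exists (Var 0 \<^bold>\<le> lift_tm t \<^bold>\<and> \<phi>)"

definition AllLess :: "tm \<Rightarrow> fm \<Rightarrow> fm"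
  where "AllLess t \<phi> = Forall (Var 0 \<^bold>< lift_tm t \<^bold>\<longrightarrow> \<phi>)"

definition ExLess :: "tm \<Rightarrow> fm \<Rightarrow> fm"
  where "ExLess t \<phi> = Exists (Var 0 \<^bold>< lift_tm t \<^bold>\<and> \<phi>)"

inductive_set Delta_b_0 :: "fm set" where
  "(s \<^bold>= t) \<in> Delta_b_0"
| "(s \<^bold>\<le> t) \<in> Delta_b_0"
| "(s \<^bold>\<lhd> t) \<in> Delta_b_0"
| "\<phi> \<in> Delta_b_0 \<Longrightarrow> (\<^bold>\<not> \<phi>) \<in> Delta_b_0"
| "\<phi> \<in> Delta_b_0 \<Longrightarrow> \<psi> \<in> Delta_b_0 \<Longrightarrow> (\<phi> \<^bold>\<and> \<psi>) \<in> Delta_b_0"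
| "\<phi> \<in> Delta_b_0 \<Longrightarrow> \<psi> \<in> Delta_b_0 \<Longrightarrow> (\<phi> \<^bold>\<or> \<psi>) \<in> Delta_b_0"
| "\<phi> \<in> Delta_b_0 \<Longrightarrow> \<psi> \<in> Delta_b_0 \<Longrightarrow> (\<phi> \<^bold>\<longrightarrow> \<psi>) \<in> Delta_b_0"
| "\<phi> \<in> Delta_b_0 \<Longrightarrow> AllLe (Len t) \<phi> \<in> Delta_b_0"
| "\<phi> \<in> Delta_b_0 \<Longrightarrow> ExLe (Len t) \<phi> \<in> Delta_b_0"

inductive_set Sigma_b_1 :: "fm set" where
  "\<phi> \<in> Delta_b_0 \<Longrightarrow> \<phi> \<in> Sigma_b_1"
| "\<phi> \<in> Sigma_b_1 \<Longrightarrow> \<psi> \<in> Sigma_b_1 \<Longrightarrow> (\<phi> \<^bold>\<and> \<psi>) \<in> Sigma_b_1"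
| "\<phi> \<in> Sigma_b_1 \<Longrightarrow> \<psi> \<in> Sigma_b_1 \<Longrightarrow> (\<phi> \<^bold>\<or> \<psi>) \<in> Sigma_b_1"
| "\<phi> \<in> Sigma_b_1 \<Longrightarrow> AllLe (Len t) \<phi> \<in> Sigma_b_1"
| "\<phi> \<in> Sigma_b_1 \<Longrightarrow> ExLe (Len t) \<phi> \<in> Sigma_b_1"
| "\<phi> \<in> Sigma_b_1 \<Longrightarrow> ExLe t \<phi> \<in> Sigma_b_1"

text \<open>
  Buss's 32 axioms ("Bounded Arithmetic", 1986), in his order, with the successor of t written
  t + 1 and the numeral S0 written 1.
\<close>

definition BASIC :: "fm set" where
  "BASIC = closure `
    (let x = Var 0; y = Var 1; z = Var 2; u = Var 3; v = Var 4; two = \<^bold>1 \<^bold>+ \<^bold>1 in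
     {y \<^bold>\<le> x \<^bold>\<longrightarrow> y \<^bold>\<le> x \<^bold>+ \<^bold>1,
      \<^bold>\<not> (x \<^bold>= x \<^bold>+ \<^bold>1),
      \<^bold>0 \<^bold>\<le> x,
      (x \<^bold>\<le> y \<^bold>\<and> \<^bold>\<not> (x \<^bold>= y)) \<^bold>\<longleftrightarrow> x \<^bold>+ \<^bold>1 \<^bold>\<le> y,
      \<^bold>\<not> (x \<^bold>= \<^bold>0) \<^bold>\<longrightarrow> \<^bold>\<not> (two \<^bold>* x \<^bold>= \<^bold>0),
      y \<^bold>\<le> x \<^bold>\<or> x \<^bold>\<le> y,
      x \<^bold>\<le> y \<^bold>\<and> y \<^bold>\<le> x \<^bold>\<longrightarrow> x \<^bold>= y,
      x \<^bold>\<le> y \<^bold>\<and> y \<^bold>\<le> z \<^bold>\<longrightarrow> x \<^bold>\<le> z,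
      Len \<^bold>0 \<^bold>= \<^bold>0,
      \<^bold>\<not> (x \<^bold>= \<^bold>0) \<^bold>\<longrightarrow>
        Len (two \<^bold>* x) \<^bold>= Len x \<^bold>+ \<^bold>1 \<^bold>\<and> Len (two \<^bold>* x \<^bold>+ \<^bold>1) \<^bold>= Len x \<^bold>+ \<^bold>1,
      Len \<^bold>1 \<^bold>= \<^bold>1,
      x \<^bold>\<le> y \<^bold>\<longrightarrow> Len x \<^bold>\<le> Len y,
      Len (x \<^bold># y) \<^bold>= Len x \<^bold>* Len y \<^bold>+ \<^bold>1,
      \<^bold>0 \<^bold># y \<^bold>= \<^bold>1,
      \<^bold>\<not> (x \<^bold>= \<^bold>0) \<^bold>\<longrightarrow>
        \<^bold>1 \<^bold># (two \<^bold>* x) \<^bold>= two \<^bold>* (\<^bold>1 \<^bold># x) \<^bold>\<and> \<^bold>1 \<^bold># (two \<^bold>* x \<^bold>+ \<^bold>1) \<^bold>= two \<^bold>* (\<^bold>1 \<^bold># x),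
      x \<^bold># y \<^bold>= y \<^bold># x,
      Len x \<^bold>= Len y \<^bold>\<longrightarrow> x \<^bold># z \<^bold>= y \<^bold># z,
      Len x \<^bold>= Len u \<^bold>+ Len v \<^bold>\<longrightarrow> x \<^bold># y \<^bold>= (u \<^bold># y) \<^bold>* (v \<^bold># y),
      x \<^bold>\<le> x \<^bold>+ y,
      x \<^bold>\<le> y \<^bold>\<and> \<^bold>\<not> (x \<^bold>= y) \<^bold>\<longrightarrow>
        two \<^bold>* x \<^bold>+ \<^bold>1 \<^bold>\<le> two \<^bold>* y \<^bold>\<and> \<^bold>\<not> (two \<^bold>* x \<^bold>+ \<^bold>1 \<^bold>= two \<^bold>* y),
      x \<^bold>+ y \<^bold>= y \<^bold>+ x,
      x \<^bold>+ \<^bold>0 \<^bold>= x,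
      x \<^bold>+ (y \<^bold>+ \<^bold>1) \<^bold>= (x \<^bold>+ y) \<^bold>+ \<^bold>1,
      (x \<^bold>+ y) \<^bold>+ z \<^bold>= x \<^bold>+ (y \<^bold>+ z),
      x \<^bold>+ y \<^bold>\<le> x \<^bold>+ z \<^bold>\<longleftrightarrow> y \<^bold>\<le> z,
      x \<^bold>* \<^bold>0 \<^bold>= \<^bold>0,
      x \<^bold>* (y \<^bold>+ \<^bold>1) \<^bold>= x \<^bold>* y \<^bold>+ x,
      x \<^bold>* y \<^bold>= y \<^bold>* x,
      x \<^bold>* (y \<^bold>+ z) \<^bold>= x \<^bold>* y \<^bold>+ x \<^bold>* z,
      \<^bold>1 \<^bold>\<le> x \<^bold>\<longrightarrow> (x \<^bold>* y \<^bold>\<le> x \<^bold>* z \<^bold>\<longleftrightarrow> y \<^bold>\<le> z),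
      \<^bold>\<not> (x \<^bold>= \<^bold>0) \<^bold>\<longrightarrow> Len x \<^bold>= Len (Half x) \<^bold>+ \<^bold>1,
      x \<^bold>= Half y \<^bold>\<longleftrightarrow> (two \<^bold>* x \<^bold>= y \<^bold>\<or> two \<^bold>* x \<^bold>+ \<^bold>1 \<^bold>= y)})"

text \<open>The induction variable is variable 0; all other variables are parameters.\<close>

definition PIND :: "fm \<Rightarrow> fm" where
  "PIND \<phi> = closure
    (inst \<^bold>0 \<phi> \<^bold>\<and> Forall (subst (Var(0 := Half (Var 0))) \<phi> \<^bold>\<longrightarrow> \<phi>) \<^bold>\<longrightarrow> Forall \<phi>)"

definition IND :: "fm \<Rightarrow> fm" where
  "IND \<phi> = closure
    (inst \<^bold>0 \<phi> \<^bold>\<and> Forall (\<phi> \<^bold>\<longrightarrow> subst (Var(0 := Var 0 \<^bold>+ \<^bold>1)) \<phi>) \<^bold>\<longrightarrow> Forall \<phi>)"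

definition S12 :: "fm set"
  where "S12 = BASIC \<union> PIND ` Sigma_b_1"

definition T12 :: "fm set"
  where "T12 = S12 \<union> IND ` Sigma_b_1"

definition Delta_b_1 :: "fm set"
  where "Delta_b_1 = {\<phi> \<in> Sigma_b_1. \<exists>\<psi> \<in> Sigma_b_1. S12 \<turnstile> \<phi> \<^bold>\<longleftrightarrow> \<^bold>\<not> \<psi>}"

text \<open>
  For a formula with distinguished variables 0 and 1 and parameters 2, 3, ...: substitutes s and t
  for the distinguished variables in a context where the parameters are numbered from k on.
\<close>

definition inst2 :: "nat \<Rightarrow> fm \<Rightarrow> tm \<Rightarrow> tm \<Rightarrow> fm"
  where "inst2 k \<phi> s t = subst (\<lambda>i. if i = 0 then s else if i = 1 then t else Var (i - 2 + k)) \<phi>"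

text \<open>
  Names of the indices: in the premise v = 0, u = 1; in the three disjuncts, respectively,
  y = 0, x = 1; y = 0, x' = 1, x = 2; and y' = 0, y = 1, x = 2.
\<close>

definition PHP :: "fm \<Rightarrow> fm" where
  "PHP \<phi> = closure (Forall (Forall (Var 0 \<^bold>< Var 1 \<^bold>\<longrightarrow>
      ExLess (Var 1) (AllLess (Var 1) (\<^bold>\<not> inst2 4 \<phi> (Var 1) (Var 0)))
    \<^bold>\<or> ExLess (Var 1) (ExLess (Var 2) (ExLess (Var 2)
        (\<^bold>\<not> (Var 2 \<^bold>= Var 1) \<^bold>\<and> inst2 5 \<phi> (Var 2) (Var 0) \<^bold>\<and> inst2 5 \<phi> (Var 1) (Var 0))))
    \<^bold>\<or> ExLess (Var 1) (ExLess (Var 1) (ExLess (Var 2)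
        (\<^bold>\<not> (Var 1 \<^bold>= Var 0) \<^bold>\<and> inst2 5 \<phi> (Var 2) (Var 1) \<^bold>\<and> inst2 5 \<phi> (Var 2) (Var 0)))))))"

text \<open>The free variable n is variable 0. (The name MIN is reserved syntax in Main.)
  For n = 0 every disjunct is false, so Forall MIN_Prec fails in the standard model; the least
  element principle proper is the relativization to n > 0.\<close>

definition MIN_Prec :: fm where
  "MIN_Prec =
     (ExLess (Var 0) (Var 0 \<^bold>\<lhd> Var 0)
    \<^bold>\<or> ExLess (Var 0) (ExLess (Var 1)
        (\<^bold>\<not> (Var 1 \<^bold>= Var 0) \<^bold>\<and> Var 1 \<^bold>\<lhd> Var 0 \<^bold>\<and> Var 0 \<^bold>\<lhd> Var 1))
    \<^bold>\<or> ExLess (Var 0) (ExLess (Var 1)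
        (\<^bold>\<not> (Var 1 \<^bold>= Var 0) \<^bold>\<and> \<^bold>\<not> (Var 1 \<^bold>\<lhd> Var 0) \<^bold>\<and> \<^bold>\<not> (Var 0 \<^bold>\<lhd> Var 1)))
    \<^bold>\<or> ExLess (Var 0) (ExLess (Var 1) (ExLess (Var 2)
        (Var 2 \<^bold>\<lhd> Var 1 \<^bold>\<and> Var 1 \<^bold>\<lhd> Var 0 \<^bold>\<and> \<^bold>\<not> (Var 2 \<^bold>\<lhd> Var 0))))
    \<^bold>\<or> ExLess (Var 0) (AllLess (Var 1) (Var 1 \<^bold>= Var 0 \<^bold>\<or> Var 1 \<^bold>\<lhd> Var 0)))"

end

theory Submission
  imports Defs
begin

text \<open>
  Forcing over sequences of finite structures. Elements are sequences a of numbers such that the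
  length of a m is polynomial in m. A condition restricts, for infinitely many m, the strict
  linear order on {0, ..., 2^m - 1} that interprets the relation symbol, by fixing it on
  polynomially many points. The weak forcing relation is sound for classical natural deduction, so
  it suffices that the axioms are forced and the least element principle for the sequence 2^m is
  not.

  A Sigma-b-1 formula that is true in a total order is already true in all total orders that agree
  with it on polynomially many points. Hence forcing such a formula amounts to its truth in all
  admitted total orders, densely often, and induction reduces to picking, at each m, the largest
  number that satisfies the formula in some admitted total order. A forced Sigma-b-1 violation of
  the pigeonhole principle yields, by decision trees of polynomial size and amalgamation of linear
  orders, an injection of a finite set into a smaller one at a single m. On the other hand, a
  condition leaves points below 2^m undetermined, and such a point can be put below any given one.
\<close>

section \<open>The standard interpretation\<close>

text \<open>A finite linear order has a least element, so the principle can only fail for an order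
  that is never completed; the forced theory, on the other hand, has to be checked in the finite
  total orders that a condition admits. Polynomial size reconciles the two. Terms take polynomially
  long values because # multiplies lengths, so witnesses of bounded existential quantifiers are
  again elements, and a sharply bounded universal quantifier collects only polynomially many
  certificates; yet 2 ^ m eventually exceeds every polynomial.

  The obstacle is that a false Sigma-b-1 formula need not have a small certificate of its falsity,
  so such formulas cannot simply be decided by strengthening a condition. This is why induction goes
  through a maximal possible value and the pigeonhole principle through values that remain possible.

  Conditions live on infinitely many indices at once, with permission to discard some: a case
  distinction that comes out differently at different m is made uniform by passing to an infinite
  set of indices, which does the work of a nonprincipal ultrafilter.\<close>

fun blen :: "nat \<Rightarrow> nat" where
  "blen x = (if x = 0 then 0 else Suc (blen (x div 2)))"

declare blen.simps [simp del]

lemma blen_0 [simp]: "blen 0 = 0"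
  by (simp add: blen.simps)

lemma blen_half: "x \<noteq> 0 \<Longrightarrow> blen x = Suc (blen (x div 2))"
  by (simp add: blen.simps)

lemma blen_1 [simp]: "blen (Suc 0) = 1"
  by (simp add: blen_half)

text \<open>Reduces the bounds on lengths below to inequalities between numbers and powers of
  2.\<close>

lemma blen_le_iff: "blen x \<le> k \<longleftrightarrow> x < 2 ^ k"
proof (induction x arbitrary: k rule: less_induct)
  case (less x)
  show ?case
  proof (cases "x = 0")
    case False
    show ?thesis
    proof (cases k)
      case (Suc j)
      have "blen x \<le> k \<longleftrightarrow> blen (x div 2) \<le> j"
        using False Suc by (simp add: blen_half)
      also have "\<dots> \<longleftrightarrow> x div 2 < 2 ^ j"
        using less False by simp
      also have "\<dots> \<longleftrightarrow> x < 2 ^ k"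
        using Suc by (simp add: less_mult_imp_div_less div_less_iff_less_mult mult.commute)
      finally show ?thesis .
    qed (simp add: False blen_half)
  qed simp
qed

lemma less_exp_blen: "x < 2 ^ blen x"
  using blen_le_iff by blast

lemma blen_mono: "x \<le> y \<Longrightarrow> blen x \<le> blen y"
  using blen_le_iff less_exp_blen order_le_less_trans by blast

lemma blen_exp [simp]: "blen (2 ^ k) = Suc k"
proof (rule antisym)
  show "blen (2 ^ k) \<le> Suc k" by (simp add: blen_le_iff)
  show "Suc k \<le> blen (2 ^ k)"
    using less_exp_blen[of "2 ^ k"] by (simp add: Suc_le_eq)
qed

lemma blen_le: "blen x \<le> x"
  by (simp add: blen_le_iff)

lemma blen_mult: "blen (x * y) \<le> blen x + blen y"
  unfolding blen_le_iff power_add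
  by (rule mult_strict_mono') (simp_all add: less_exp_blen)

lemma blen_add: "blen (x + y) \<le> blen x + blen y + 1"
proof -
  have "x + y < 2 ^ (blen x + blen y) + 2 ^ (blen x + blen y)"
    by (rule add_strict_mono; rule order_less_le_trans[OF less_exp_blen]) simp_all
  then show ?thesis
    unfolding blen_le_iff by simp
qed

section \<open>Standard truth and the polynomial growth of terms\<close>

primrec tval :: "(nat \<Rightarrow> nat) \<Rightarrow> tm \<Rightarrow> nat" where
  "tval e (Var i) = e i"
| "tval e \<^bold>0 = 0"
| "tval e \<^bold>1 = 1"
| "tval e (Half t) = tval e t div 2"
| "tval e (Len t) = blen (tval e t)"
| "tval e (s \<^bold>+ t) = tval e s + tval e t"
| "tval e (s \<^bold>* t) = tval e s * tval e t"
| "tval e (s \<^bold># t) = 2 ^ (blen (tval e s) * blen (tval e t))"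

primrec sat :: "nat rel \<Rightarrow> (nat \<Rightarrow> nat) \<Rightarrow> fm \<Rightarrow> bool" where
  "sat R e (s \<^bold>= t) \<longleftrightarrow> tval e s = tval e t"
| "sat R e (s \<^bold>\<le> t) \<longleftrightarrow> tval e s \<le> tval e t"
| "sat R e (s \<^bold>\<lhd> t) \<longleftrightarrow> (tval e s, tval e t) \<in> R"
| "sat R e (\<^bold>\<not> \<phi>) \<longleftrightarrow> \<not> sat R e \<phi>"
| "sat R e (\<phi> \<^bold>\<and> \<psi>) \<longleftrightarrow> sat R e \<phi> \<and> sat R e \<psi>"
| "sat R e (\<phi> \<^bold>\<or> \<psi>) \<longleftrightarrow> sat R e \<phi> \<or> sat R e \<psi>"
| "sat R e (\<phi> \<^bold>\<longrightarrow> \<psi>) \<longleftrightarrow> (sat R e \<phi> \<longrightarrow> sat R e \<psi>)"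
| "sat R e (Forall \<phi>) \<longleftrightarrow> (\<forall>x. sat R (case_nat x e) \<phi>)"
| "sat R e (Exists \<phi>) \<longleftrightarrow> (\<exists>x. sat R (case_nat x e) \<phi>)"

lemma tval_subst: "tval e (subst_tm \<sigma> t) = tval (\<lambda>i. tval e (\<sigma> i)) t"
  by (induction t) auto

lemma tval_lift [simp]: "tval (case_nat x e) (lift_tm t) = tval e t"
  by (simp add: lift_tm_def tval_subst)

lemma fv_lift_tm [simp]: "fv_tm (lift_tm t) = Suc ` fv_tm t"
  unfolding lift_tm_def by (induction t) auto

lemma finite_fv_tm [simp]: "finite (fv_tm t)"
  by (induction t) auto

lemma finite_fv [simp]: "finite (fv \<phi>)"
proof -
  have "finite {i. Suc i \<in> A}" if "finite A" for A
    using finite_vimageI[OF that, of Suc] by (simp add: vimage_def)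
  then show ?thesis by (induction \<phi>) auto
qed

lemma sat_AllLe: "sat R e (AllLe t \<phi>) \<longleftrightarrow> (\<forall>x\<le>tval e t. sat R (case_nat x e) \<phi>)"
  by (simp add: AllLe_def)

lemma sat_ExLe: "sat R e (ExLe t \<phi>) \<longleftrightarrow> (\<exists>x\<le>tval e t. sat R (case_nat x e) \<phi>)"
  by (simp add: ExLe_def)

text \<open>Lengths add under + and multiplication and multiply under #, so they stay polynomial.
  With l \<ge> 2 a bound of the pure form l ^ c suffices: constant factors are absorbed by raising
  the exponent, and bounds compose by multiplying exponents.\<close>

lemma tval_polybounded:
  "\<exists>c. \<forall>e l. 2 \<le> l \<longrightarrow> (\<forall>i\<in>fv_tm t. blen (e i) \<le> l) \<longrightarrow> blen (tval e t) \<le> l ^ c"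
proof (induction t)
  case (Var i)
  show ?case by (rule exI[of _ 1]) simp
next
  case (Half t)
  then obtain c where c: "\<And>e l. 2 \<le> l \<Longrightarrow> \<forall>i\<in>fv_tm t. blen (e i) \<le> l \<Longrightarrow> blen (tval e t) \<le> l ^ c"
    by blast
  show ?case
    by (rule exI[of _ c]) (auto intro: order_trans[OF blen_mono[OF div_le_dividend] c])
next
  case (Len t)
  then obtain c where c: "\<And>e l. 2 \<le> l \<Longrightarrow> \<forall>i\<in>fv_tm t. blen (e i) \<le> l \<Longrightarrow> blen (tval e t) \<le> l ^ c"
    by blast
  show ?case
    by (rule exI[of _ c]) (auto intro: order_trans[OF blen_le c])
next
  case (Add s t)
  then obtain c d where
    c: "\<And>e l. 2 \<le> l \<Longrightarrow> \<forall>i\<in>fv_tm s. blen (e i) \<le> l \<Longrightarrow> blen (tval e s) \<le> l ^ c" and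
    d: "\<And>e l. 2 \<le> l \<Longrightarrow> \<forall>i\<in>fv_tm t. blen (e i) \<le> l \<Longrightarrow> blen (tval e t) \<le> l ^ d"
    by blast
  show ?case
  proof (intro exI allI impI)
    fix e and l :: nat assume l: "2 \<le> l" "\<forall>i\<in>fv_tm (s \<^bold>+ t). blen (e i) \<le> l"
    have "blen (tval e (s \<^bold>+ t)) \<le> l ^ c + l ^ d + 1"
      using c[of l e] d[of l e] l blen_add[of "tval e s" "tval e t"] by auto
    also have "\<dots> \<le> l ^ (c + d) + l ^ (c + d) + l ^ (c + d)"
      using l by (intro add_mono power_increasing) auto
    \<comment> \<open>Three summands cost a factor 3, which 2 ^ 2 \<le> l ^ 2 covers.\<close>
    also have "\<dots> \<le> 2 ^ 2 * l ^ (c + d)" by simp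
    also have "\<dots> \<le> l ^ 2 * l ^ (c + d)"
      using l by (intro mult_right_mono power_mono) auto
    finally show "blen (tval e (s \<^bold>+ t)) \<le> l ^ (2 + (c + d))"
      by (simp only: power_add)
  qed
next
  case (Mult s t)
  then obtain c d where
    c: "\<And>e l. 2 \<le> l \<Longrightarrow> \<forall>i\<in>fv_tm s. blen (e i) \<le> l \<Longrightarrow> blen (tval e s) \<le> l ^ c" and
    d: "\<And>e l. 2 \<le> l \<Longrightarrow> \<forall>i\<in>fv_tm t. blen (e i) \<le> l \<Longrightarrow> blen (tval e t) \<le> l ^ d"
    by blast
  show ?case
  proof (intro exI allI impI)
    fix e and l :: nat assume l: "2 \<le> l" "\<forall>i\<in>fv_tm (s \<^bold>* t). blen (e i) \<le> l"
    have "blen (tval e (s \<^bold>* t)) \<le> l ^ c + l ^ d"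
      using c[of l e] d[of l e] l blen_mult[of "tval e s" "tval e t"] by auto
    also have "\<dots> \<le> l ^ (c + d) + l ^ (c + d)"
      using l by (intro add_mono power_increasing) auto
    also have "\<dots> \<le> l * l ^ (c + d)"
      using mult_le_mono1[OF l(1), of "l ^ (c + d)"] by (simp only: mult_2)
    finally show "blen (tval e (s \<^bold>* t)) \<le> l ^ Suc (c + d)"
      by simp
  qed
next
  case (Smash s t)
  then obtain c d where
    c: "\<And>e l. 2 \<le> l \<Longrightarrow> \<forall>i\<in>fv_tm s. blen (e i) \<le> l \<Longrightarrow> blen (tval e s) \<le> l ^ c" and
    d: "\<And>e l. 2 \<le> l \<Longrightarrow> \<forall>i\<in>fv_tm t. blen (e i) \<le> l \<Longrightarrow> blen (tval e t) \<le> l ^ d"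
    by blast
  show ?case
  proof (intro exI allI impI)
    fix e and l :: nat assume l: "2 \<le> l" "\<forall>i\<in>fv_tm (s \<^bold># t). blen (e i) \<le> l"
    have "blen (tval e (s \<^bold># t)) \<le> l ^ c * l ^ d + 1"
      using c[of l e] d[of l e] l by (auto intro: mult_mono)
    also have "\<dots> \<le> l ^ (c + d) + l ^ (c + d)"
      using l by (simp add: power_add Suc_le_eq)
    also have "\<dots> \<le> l * l ^ (c + d)"
      using mult_le_mono1[OF l(1), of "l ^ (c + d)"] by (simp only: mult_2)
    finally show "blen (tval e (s \<^bold># t)) \<le> l ^ Suc (c + d)"
      by simp
  qed
qed (rule exI[of _ 1], simp)+

section \<open>Polynomial certificates\<close>

text \<open>Positions are fixed only among the points of D; a point outside D may still move
  anywhere relative to them. Amalgamation and the failure of the minimum principle live on this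
  freedom.\<close>

definition agree :: "nat set \<Rightarrow> nat rel \<Rightarrow> nat rel \<Rightarrow> bool" where
  "agree D R R' \<longleftrightarrow> (\<forall>x\<in>D. \<forall>y\<in>D. (x, y) \<in> R \<longleftrightarrow> (x, y) \<in> R')"

lemma agree_refl [simp]: "agree D R R"
  by (simp add: agree_def)

lemma agree_sym: "agree D R R' \<Longrightarrow> agree D R' R"
  by (simp add: agree_def)

lemma agree_trans: "agree D R R' \<Longrightarrow> agree D R' R'' \<Longrightarrow> agree D R R''"
  by (simp add: agree_def)

lemma agree_subset: "agree D R R' \<Longrightarrow> E \<subseteq> D \<Longrightarrow> agree E R R'"
  unfolding agree_def by blast

text \<open>The familiar picture is an NP computation with the relation as oracle: an accepting run
  queries only polynomially many pairs, and D collects their end points. The exponent k depends on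
  the formula alone, and l measures the lengths of its parameters.\<close>

definition certifiable :: "fm \<Rightarrow> bool" where
  "certifiable \<phi> \<longleftrightarrow> (\<exists>k. \<forall>l\<ge>2. \<forall>e R. (\<forall>i\<in>fv \<phi>. blen (e i) \<le> l) \<longrightarrow> sat R e \<phi> \<longrightarrow>
     (\<exists>D. finite D \<and> card D \<le> l ^ k \<and> (\<forall>R'. agree D R R' \<longrightarrow> sat R' e \<phi>)))"

lemma certifiable_cong:
  assumes "certifiable \<phi>" "fv \<phi> = fv \<psi>" "\<And>R e. sat R e \<phi> \<longleftrightarrow> sat R e \<psi>"
  shows "certifiable \<psi>"
  using assms by (simp add: certifiable_def)

lemma certifiable_pointwise:
  assumes "\<And>e R. sat R e \<phi> \<Longrightarrow>
    \<exists>D. finite D \<and> card D \<le> 2 \<and> (\<forall>R'. agree D R R' \<longrightarrow> sat R' e \<phi>)"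
  shows "certifiable \<phi>"
  unfolding certifiable_def
  by (rule exI[of _ 1]) (metis assms order_trans power_one_right)

text \<open>For formulas without the order symbol the empty certificate does.\<close>

lemma certifiable_absolute:
  "(\<And>e R R'. sat R e \<phi> \<Longrightarrow> sat R' e \<phi>) \<Longrightarrow> certifiable \<phi>"
  by (rule certifiable_pointwise, rule exI[of _ "{}"]) auto

lemma certifiable_Prec: "certifiable (s \<^bold>\<lhd> t)" "certifiable (\<^bold>\<not> (s \<^bold>\<lhd> t))"
proof -
  have *: "card {a, b :: nat} \<le> 2" for a b
    by (simp add: card_insert_if)
  show "certifiable (s \<^bold>\<lhd> t)"
    by (rule certifiable_pointwise) (use * in \<open>auto simp: agree_def intro!: exI[of _ "{_, _}"]\<close>)
  show "certifiable (\<^bold>\<not> (s \<^bold>\<lhd> t))"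
    by (rule certifiable_pointwise) (use * in \<open>auto simp: agree_def intro!: exI[of _ "{_, _}"]\<close>)
qed

lemma certifiable_Conj:
  assumes "certifiable \<phi>" "certifiable \<psi>"
  shows "certifiable (\<phi> \<^bold>\<and> \<psi>)"
proof -
  obtain c where c: "\<And>l e R. 2 \<le> l \<Longrightarrow> \<forall>i\<in>fv \<phi>. blen (e i) \<le> l \<Longrightarrow> sat R e \<phi> \<Longrightarrow>
     (\<exists>D. finite D \<and> card D \<le> l ^ c \<and> (\<forall>R'. agree D R R' \<longrightarrow> sat R' e \<phi>))"
    using assms(1) unfolding certifiable_def by blast
  obtain d where d: "\<And>l e R. 2 \<le> l \<Longrightarrow> \<forall>i\<in>fv \<psi>. blen (e i) \<le> l \<Longrightarrow> sat R e \<psi> \<Longrightarrow>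
     (\<exists>D. finite D \<and> card D \<le> l ^ d \<and> (\<forall>R'. agree D R R' \<longrightarrow> sat R' e \<psi>))"
    using assms(2) unfolding certifiable_def by blast
  show ?thesis
    unfolding certifiable_def
  proof (rule exI, intro allI impI)
    fix l :: nat and e R
    assume l: "2 \<le> l" "\<forall>i\<in>fv (\<phi> \<^bold>\<and> \<psi>). blen (e i) \<le> l" "sat R e (\<phi> \<^bold>\<and> \<psi>)"
    obtain D where D: "finite D" "card D \<le> l ^ c" "\<And>R'. agree D R R' \<Longrightarrow> sat R' e \<phi>"
      using c[of l e R] l by auto
    obtain E where E: "finite E" "card E \<le> l ^ d" "\<And>R'. agree E R R' \<Longrightarrow> sat R' e \<psi>"
      using d[of l e R] l by auto
    have "card (D \<union> E) \<le> l ^ c + l ^ d"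
      using card_Un_le[of D E] D E by linarith
    also have "\<dots> \<le> l ^ (c + d) + l ^ (c + d)"
      using l by (intro add_mono power_increasing) auto
    also have "\<dots> \<le> l * l ^ (c + d)"
      using mult_le_mono1[OF l(1), of "l ^ (c + d)"] by (simp only: mult_2)
    finally have "card (D \<union> E) \<le> l ^ Suc (c + d)" by simp
    moreover have "sat R' e (\<phi> \<^bold>\<and> \<psi>)" if "agree (D \<union> E) R R'" for R'
      using D(3) E(3) agree_subset[OF that] by simp
    ultimately show "\<exists>D. finite D \<and> card D \<le> l ^ Suc (c + d) \<and>
      (\<forall>R'. agree D R R' \<longrightarrow> sat R' e (\<phi> \<^bold>\<and> \<psi>))"
      using D(1) E(1) by (intro exI[of _ "D \<union> E"]) simp
  qed
qed

lemma certifiable_Disj: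
  assumes "certifiable \<phi>" "certifiable \<psi>"
  shows "certifiable (\<phi> \<^bold>\<or> \<psi>)"
proof -
  obtain c where c: "\<And>l e R. 2 \<le> l \<Longrightarrow> \<forall>i\<in>fv \<phi>. blen (e i) \<le> l \<Longrightarrow> sat R e \<phi> \<Longrightarrow>
     (\<exists>D. finite D \<and> card D \<le> l ^ c \<and> (\<forall>R'. agree D R R' \<longrightarrow> sat R' e \<phi>))"
    using assms(1) unfolding certifiable_def by blast
  obtain d where d: "\<And>l e R. 2 \<le> l \<Longrightarrow> \<forall>i\<in>fv \<psi>. blen (e i) \<le> l \<Longrightarrow> sat R e \<psi> \<Longrightarrow>
     (\<exists>D. finite D \<and> card D \<le> l ^ d \<and> (\<forall>R'. agree D R R' \<longrightarrow> sat R' e \<psi>))"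
    using assms(2) unfolding certifiable_def by blast
  have "\<exists>D. finite D \<and> card D \<le> l ^ (c + d) \<and> (\<forall>R'. agree D R R' \<longrightarrow> sat R' e (\<phi> \<^bold>\<or> \<psi>))"
    if l: "2 \<le> l" "\<forall>i\<in>fv (\<phi> \<^bold>\<or> \<psi>). blen (e i) \<le> l" "sat R e (\<phi> \<^bold>\<or> \<psi>)" for l :: nat and e R
  proof -
    have le: "l ^ c \<le> l ^ (c + d)" "l ^ d \<le> l ^ (c + d)"
      using l(1) by (auto intro: power_increasing)
    from l(3) consider "sat R e \<phi>" | "sat R e \<psi>" by auto
    then show ?thesis
    proof cases
      case 1
      then obtain D where "finite D" "card D \<le> l ^ c" "\<And>R'. agree D R R' \<Longrightarrow> sat R' e \<phi>"
        using c[of l e R] l by auto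
      with le(1) show ?thesis by (intro exI[of _ D]) simp
    next
      case 2
      then obtain D where "finite D" "card D \<le> l ^ d" "\<And>R'. agree D R R' \<Longrightarrow> sat R' e \<psi>"
        using d[of l e R] l by auto
      with le(2) show ?thesis by (intro exI[of _ D]) simp
    qed
  qed
  then show ?thesis
    unfolding certifiable_def by blast
qed

lemma fv_AllLe: "fv (AllLe t \<phi>) = fv_tm t \<union> {i. Suc i \<in> fv \<phi>}"
  by (auto simp: AllLe_def)

lemma fv_ExLe: "fv (ExLe t \<phi>) = fv_tm t \<union> {i. Suc i \<in> fv \<phi>}"
  by (auto simp: ExLe_def)

lemma blen_case_nat_le:
  assumes "\<And>i. Suc i \<in> A \<Longrightarrow> blen (e i) \<le> l" "l \<le> l'" "blen x \<le> l'"
  shows "\<forall>i\<in>A. blen (case_nat x e i) \<le> l'"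
  using assms by (auto split: nat.split intro: order_trans)

text \<open>One witness is fixed and the certificate of that instance is kept. The witness is
  polynomially long, so the bound l grows to \<open>l ^ Suc c\<close> and the exponents
  multiply.\<close>

lemma certifiable_ExLe:
  assumes "certifiable \<phi>"
  shows "certifiable (ExLe t \<phi>)"
proof -
  obtain k where k: "\<And>l e R. 2 \<le> l \<Longrightarrow> \<forall>i\<in>fv \<phi>. blen (e i) \<le> l \<Longrightarrow> sat R e \<phi> \<Longrightarrow>
     (\<exists>D. finite D \<and> card D \<le> l ^ k \<and> (\<forall>R'. agree D R R' \<longrightarrow> sat R' e \<phi>))"
    using assms unfolding certifiable_def by blast
  obtain c where
    c: "\<And>e l. 2 \<le> l \<Longrightarrow> \<forall>i\<in>fv_tm t. blen (e i) \<le> l \<Longrightarrow> blen (tval e t) \<le> l ^ c"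
    using tval_polybounded[of t] by blast
  show ?thesis
    unfolding certifiable_def
  proof (rule exI, intro allI impI)
    fix l :: nat and e R
    assume l: "2 \<le> l" "\<forall>i\<in>fv (ExLe t \<phi>). blen (e i) \<le> l" "sat R e (ExLe t \<phi>)"
    then obtain x where x: "x \<le> tval e t" "sat R (case_nat x e) \<phi>"
      by (auto simp: sat_ExLe)
    have b: "blen x \<le> l ^ Suc c"
    proof -
      have "blen x \<le> l ^ c"
        using order_trans[OF blen_mono[OF x(1)] c[OF l(1)]] l(2) by (simp add: fv_ExLe)
      also have "\<dots> \<le> l ^ Suc c"
        using l(1) by (intro power_increasing) auto
      finally show ?thesis .
    qed
    \<comment> \<open>The exponent is \<open>Suc c\<close> so that the new bound dominates l even
      for c = 0 and the old parameters still fit under it.\<close>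
    have l': "2 \<le> l ^ Suc c" "l \<le> l ^ Suc c"
      using l(1) self_le_power[of l "Suc c"] by linarith+
    have "\<forall>i\<in>fv \<phi>. blen (case_nat x e i) \<le> l ^ Suc c"
      using l(2) by (intro blen_case_nat_le[OF _ l'(2) b]) (simp add: fv_ExLe)
    then obtain D where D: "finite D" "card D \<le> (l ^ Suc c) ^ k"
      "\<And>R'. agree D R R' \<Longrightarrow> sat R' (case_nat x e) \<phi>"
      using k[OF l'(1) _ x(2)] by blast
    then show "\<exists>D. finite D \<and> card D \<le> l ^ (Suc c * k) \<and>
        (\<forall>R'. agree D R R' \<longrightarrow> sat R' e (ExLe t \<phi>))"
      using x(1) by (intro exI[of _ D]) (auto simp only: power_mult sat_ExLe)
  qed
qed

lemma certificates_union:
  assumes "\<And>x. x < b \<Longrightarrow>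
    \<exists>D. finite D \<and> card D \<le> c \<and> (\<forall>R'. agree D R R' \<longrightarrow> Q x R')"
  shows "\<exists>D. finite D \<and> card D \<le> b * c \<and> (\<forall>R'. agree D R R' \<longrightarrow> (\<forall>x<b. Q x R'))"
proof -
  obtain D where D: "\<And>x. x < b \<Longrightarrow> finite (D x)" "\<And>x. x < b \<Longrightarrow> card (D x) \<le> c"
    "\<And>x R'. x < b \<Longrightarrow> agree (D x) R R' \<Longrightarrow> Q x R'"
    using assms by metis
  have "card (\<Union>x\<in>{..<b}. D x) \<le> (\<Sum>x\<in>{..<b}. card (D x))"
    by (rule card_UN_le) simp
  also have "\<dots> \<le> b * c"
    using sum_bounded_above[of "{..<b}" "\<lambda>x. card (D x)" c] D(2) by simp
  finally have "card (\<Union>x\<in>{..<b}. D x) \<le> b * c" .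
  moreover have "Q x R'" if "agree (\<Union>x\<in>{..<b}. D x) R R'" "x < b" for R' x
    using D(3)[OF that(2)] agree_subset[OF that(1), of "D x"] that(2) by blast
  ultimately show ?thesis
    using D(1) by (intro exI[of _ "\<Union>x\<in>{..<b}. D x"]) auto
qed

text \<open>The bound is a length, so there are only polynomially many instances and the union of
  their certificates stays polynomial.\<close>

lemma certifiable_AllLe_Len:
  assumes "certifiable \<phi>"
  shows "certifiable (AllLe (Len t) \<phi>)"
proof -
  obtain k where k: "\<And>l e R. 2 \<le> l \<Longrightarrow> \<forall>i\<in>fv \<phi>. blen (e i) \<le> l \<Longrightarrow> sat R e \<phi> \<Longrightarrow>
     (\<exists>D. finite D \<and> card D \<le> l ^ k \<and> (\<forall>R'. agree D R R' \<longrightarrow> sat R' e \<phi>))"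
    using assms unfolding certifiable_def by blast
  obtain c where
    c: "\<And>e l. 2 \<le> l \<Longrightarrow> \<forall>i\<in>fv_tm t. blen (e i) \<le> l \<Longrightarrow> blen (tval e t) \<le> l ^ c"
    using tval_polybounded[of t] by blast
  show ?thesis
    unfolding certifiable_def
  proof (rule exI, intro allI impI)
    fix l :: nat and e R
    assume l: "2 \<le> l" "\<forall>i\<in>fv (AllLe (Len t) \<phi>). blen (e i) \<le> l" "sat R e (AllLe (Len t) \<phi>)"
    define b where "b = blen (tval e t)"
    have b: "b \<le> l ^ c"
      using c[OF l(1)] l(2) by (simp add: b_def fv_AllLe)
    have l': "2 \<le> l ^ Suc c" "l \<le> l ^ Suc c" "l ^ c \<le> l ^ Suc c"
      using l(1) self_le_power[of l "Suc c"] by (linarith, linarith, simp)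
    have "\<exists>D. finite D \<and> card D \<le> (l ^ Suc c) ^ k \<and>
        (\<forall>R'. agree D R R' \<longrightarrow> sat R' (case_nat x e) \<phi>)" if "x \<le> b" for x
    proof (rule k[OF l'(1)])
      have "blen x \<le> l ^ Suc c"
        using that blen_le[of x] b l'(3) by linarith
      then show "\<forall>i\<in>fv \<phi>. blen (case_nat x e i) \<le> l ^ Suc c"
        using l(2) by (intro blen_case_nat_le[OF _ l'(2)]) (simp_all add: fv_AllLe)
      show "sat R (case_nat x e) \<phi>"
        using l(3) that by (simp add: sat_AllLe b_def)
    qed
    then have "\<exists>D. finite D \<and> card D \<le> Suc b * (l ^ Suc c) ^ k \<and>
        (\<forall>R'. agree D R R' \<longrightarrow> (\<forall>x<Suc b. sat R' (case_nat x e) \<phi>))"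
      by (intro certificates_union) simp
    \<comment> \<open>The number of instances is at most \<open>l ^ Suc c\<close>, one more factor
      of the same size; hence \<open>Suc k\<close>.\<close>
    moreover have "Suc b * (l ^ Suc c) ^ k \<le> l ^ (Suc c * Suc k)"
    proof -
      have "1 \<le> l ^ c" using l(1) by simp
      then have "Suc b \<le> l ^ Suc c"
        using b mult_le_mono1[OF l(1), of "l ^ c"] unfolding power_Suc by linarith
      then show ?thesis
        unfolding power_mult power_Suc[of "l ^ Suc c"] by (rule mult_le_mono1)
    qed
    ultimately show "\<exists>D. finite D \<and> card D \<le> l ^ (Suc c * Suc k) \<and>
        (\<forall>R'. agree D R R' \<longrightarrow> sat R' e (AllLe (Len t) \<phi>))"
      unfolding sat_AllLe tval.simps b_def[symmetric] less_Suc_eq_le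
      by (meson order_trans)
  qed
qed

text \<open>Formula and negation are carried through the induction together;
  \<open>certifiable_cong\<close> moves certificates along the De Morgan equivalences.\<close>

lemma Delta_b_0_certifiable:
  "\<phi> \<in> Delta_b_0 \<Longrightarrow> certifiable \<phi> \<and> certifiable (\<^bold>\<not> \<phi>)"
proof (induction rule: Delta_b_0.induct)
  case (1 s t)
  show ?case by (auto intro: certifiable_absolute)
next
  case (2 s t)
  show ?case by (auto intro: certifiable_absolute)
next
  case (3 s t)
  show ?case by (simp add: certifiable_Prec)
next
  case (4 \<phi>)
  then show ?case using certifiable_cong[of \<phi> "\<^bold>\<not> \<^bold>\<not> \<phi>"] by simp
next
  case (5 \<phi> \<psi>)
  then show ?case
    using certifiable_Conj certifiable_cong[OF certifiable_Disj, of "\<^bold>\<not> \<phi>" "\<^bold>\<not> \<psi>" "\<^bold>\<not> (\<phi> \<^bold>\<and> \<psi>)"]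
    by simp
next
  case (6 \<phi> \<psi>)
  then show ?case
    using certifiable_Disj certifiable_cong[OF certifiable_Conj, of "\<^bold>\<not> \<phi>" "\<^bold>\<not> \<psi>" "\<^bold>\<not> (\<phi> \<^bold>\<or> \<psi>)"]
    by simp
next
  case (7 \<phi> \<psi>)
  then show ?case
    using certifiable_cong[OF certifiable_Disj, of "\<^bold>\<not> \<phi>" \<psi> "\<phi> \<^bold>\<longrightarrow> \<psi>"]
      certifiable_cong[OF certifiable_Conj, of \<phi> "\<^bold>\<not> \<psi>" "\<^bold>\<not> (\<phi> \<^bold>\<longrightarrow> \<psi>)"]
    by auto
next
  case (8 \<phi> t)
  then show ?case
    using certifiable_AllLe_Len
      certifiable_cong[OF certifiable_ExLe, of "\<^bold>\<not> \<phi>" "Len t" "\<^bold>\<not> (AllLe (Len t) \<phi>)"]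
    by (simp add: fv_AllLe fv_ExLe sat_AllLe sat_ExLe)
next
  case (9 \<phi> t)
  then show ?case
    using certifiable_ExLe
      certifiable_cong[OF certifiable_AllLe_Len, of "\<^bold>\<not> \<phi>" t "\<^bold>\<not> (ExLe (Len t) \<phi>)"]
    by (simp add: fv_AllLe fv_ExLe sat_AllLe sat_ExLe)
qed

lemma Sigma_b_1_certifiable: "\<phi> \<in> Sigma_b_1 \<Longrightarrow> certifiable \<phi>"
  by (induction rule: Sigma_b_1.induct)
    (auto simp: Delta_b_0_certifiable certifiable_Conj certifiable_Disj certifiable_AllLe_Len
      certifiable_ExLe)

section \<open>Amalgamation of linear orders\<close>

definition linear_orders :: "nat \<Rightarrow> nat rel set" where
  "linear_orders m =
    {R. R \<subseteq> {..<2 ^ m} \<times> {..<2 ^ m} \<and> trans R \<and> irrefl R \<and> total_on {..<2 ^ m} R}"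

text \<open>Topological sorting: a point of V without S-successors in V is put on top of an
  extension for the remaining points. It exists since a finite acyclic relation has a well-founded
  converse.\<close>

lemma linear_extension:
  assumes "finite V" "trans S" "irrefl S"
  shows "\<exists>L. L \<subseteq> V \<times> V \<and> trans L \<and> irrefl L \<and> total_on V L \<and> S \<inter> V \<times> V \<subseteq> L"
  using assms(1)
proof (induction V rule: finite_psubset_induct)
  case (psubset V)
  show ?case
  proof (cases "V = {}")
    case True
    then show ?thesis by (auto simp: irrefl_def trans_def)
  next
    case False
    have "finite (S \<inter> V \<times> V)" using psubset.hyps by simp
    moreover have "acyclic (S \<inter> V \<times> V)"
      by (rule acyclic_subset[of S]) (use assms(2,3) in \<open>simp_all add: acyclic_irrefl\<close>)
    ultimately have "wf ((S \<inter> V \<times> V)\<inverse>)"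
      by (simp add: finite_acyclic_wf_converse)
    from wfE_min'[OF this False] obtain v where "v \<in> V"
      "\<And>w. (w, v) \<in> (S \<inter> V \<times> V)\<inverse> \<Longrightarrow> w \<notin> V"
      by blast
    then have v: "v \<in> V" "\<And>w. w \<in> V \<Longrightarrow> (v, w) \<notin> S"
      by blast+
    obtain L where L: "L \<subseteq> (V - {v}) \<times> (V - {v})" "trans L" "irrefl L" "total_on (V - {v}) L"
      "S \<inter> (V - {v}) \<times> (V - {v}) \<subseteq> L"
      using psubset.IH[of "V - {v}"] v(1) by blast
    show ?thesis
    proof (intro exI[of _ "L \<union> (V - {v}) \<times> {v}"] conjI)
      show "trans (L \<union> (V - {v}) \<times> {v})"
        using L(1,2) unfolding trans_def by blast
      show "irrefl (L \<union> (V - {v}) \<times> {v})"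
        using L(3) unfolding irrefl_def by blast
      show "total_on V (L \<union> (V - {v}) \<times> {v})"
        using L(4) unfolding total_on_def by blast
      show "S \<inter> V \<times> V \<subseteq> L \<union> (V - {v}) \<times> {v}"
        using L(5) v(2) assms(3) unfolding irrefl_def by blast
    qed (use L(1) v(1) in blast)
  qed
qed

text \<open>Gluing the order on A and the order on B along A \<inter> B yields a strict partial
  order, because longer alternations of the two collapse to at most one step of each; any linear
  extension of it then works.\<close>

lemma linear_orders_amalgamate:
  assumes "R \<in> linear_orders m" "R' \<in> linear_orders m" "agree (A \<inter> B) R R'"
  obtains L where "L \<in> linear_orders m" "agree A R L" "agree B R' L"
proof -
  let ?V = "{..<2 ^ m :: nat}"
  define P where "P = R \<inter> A \<times> A"
  define Q where "Q = R' \<inter> B \<times> B"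
  have R: "R \<subseteq> ?V \<times> ?V" "trans R" "irrefl R" "total_on ?V R"
    and R': "R' \<subseteq> ?V \<times> ?V" "trans R'" "irrefl R'" "total_on ?V R'"
    using assms(1,2) by (auto simp: linear_orders_def)
  have P: "(x, z) \<in> P" if "(x, y) \<in> P" "(y, z) \<in> P" for x y z
    using that R(2) unfolding P_def trans_def by blast
  have Q: "(x, z) \<in> Q" if "(x, y) \<in> Q" "(y, z) \<in> Q" for x y z
    using that R'(2) unfolding Q_def trans_def by blast
  have irr: "(x, x) \<notin> P" "(x, x) \<notin> Q" for x
    using R(3) R'(3) unfolding P_def Q_def irrefl_def by auto
  have mix: "(x, y) \<in> P \<longleftrightarrow> (x, y) \<in> Q" if "x \<in> A \<inter> B" "y \<in> A \<inter> B" for x y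
    using assms(3) that unfolding agree_def P_def Q_def by auto
  have PA: "x \<in> A \<and> y \<in> A" if "(x, y) \<in> P" for x y using that by (auto simp: P_def)
  have QB: "x \<in> B \<and> y \<in> B" if "(x, y) \<in> Q" for x y using that by (auto simp: Q_def)
  \<comment> \<open>Both ends of the middle step lie in A as well as in B, so \<open>mix\<close>
    turns it into a step of the outer relation. The same holds for \<open>QPQ\<close>.\<close>
  have PQP: "(x, w) \<in> P" if "(x, y) \<in> P" "(y, z) \<in> Q" "(z, w) \<in> P" for x y z w
    using that mix[of y z] P PA QB by blast
  have QPQ: "(x, w) \<in> Q" if "(x, y) \<in> Q" "(y, z) \<in> P" "(z, w) \<in> Q" for x y z w
    using that mix[of y z] Q PA QB by blast
  \<comment> \<open>This excludes loops made of one step of each relation, and thereby gives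
    irreflexivity of S.\<close>
  have PQ: "(y, x) \<notin> Q" if "(x, y) \<in> P" for x y
    using that mix[of y x] P[of x y x] irr(1) PA QB by blast
  define S where "S = P \<union> Q \<union> P O Q \<union> Q O P"
  have "trans S"
  proof (rule transI)
    fix x y z assume "(x, y) \<in> S" "(y, z) \<in> S"
    then consider
        "(x, y) \<in> P \<union> Q" "(y, z) \<in> P \<union> Q"
      | w where "(x, w) \<in> P" "(w, y) \<in> Q" "(y, z) \<in> P \<union> Q"
      | w where "(x, w) \<in> Q" "(w, y) \<in> P" "(y, z) \<in> P \<union> Q"
      | w where "(x, y) \<in> P \<union> Q" "(y, w) \<in> P" "(w, z) \<in> Q"
      | w where "(x, y) \<in> P \<union> Q" "(y, w) \<in> Q" "(w, z) \<in> P"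
      | v w where "(x, v) \<in> P" "(v, y) \<in> Q" "(y, w) \<in> P" "(w, z) \<in> Q"
      | v w where "(x, v) \<in> P" "(v, y) \<in> Q" "(y, w) \<in> Q" "(w, z) \<in> P"
      | v w where "(x, v) \<in> Q" "(v, y) \<in> P" "(y, w) \<in> P" "(w, z) \<in> Q"
      | v w where "(x, v) \<in> Q" "(v, y) \<in> P" "(y, w) \<in> Q" "(w, z) \<in> P"
      unfolding S_def by blast
    then show "(x, z) \<in> S"
      by cases (use P Q PQP QPQ in \<open>unfold S_def, blast+\<close>)
  qed
  moreover have "irrefl S"
    unfolding S_def irrefl_def using irr PQ by blast
  ultimately obtain L where L: "L \<subseteq> ?V \<times> ?V" "trans L" "irrefl L" "total_on ?V L"
    "S \<inter> ?V \<times> ?V \<subseteq> L"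
    using linear_extension[of ?V S] by auto
  \<comment> \<open>T is total: a pair of L missing from T would occur in T with its ends swapped,
    hence would be swapped in L as well.\<close>
  have agree: "agree D T L"
    if T: "T \<subseteq> ?V \<times> ?V" "total_on ?V T" "T \<inter> D \<times> D \<subseteq> S" for D T
    unfolding agree_def
  proof (intro ballI)
    fix x y assume xy: "x \<in> D" "y \<in> D"
    have TL: "(a, b) \<in> L" if "a \<in> D" "b \<in> D" "(a, b) \<in> T" for a b
      using that T L(5) by blast
    show "(x, y) \<in> T \<longleftrightarrow> (x, y) \<in> L"
    proof
      assume "(x, y) \<in> L"
      then have "x \<in> ?V" "y \<in> ?V" "x \<noteq> y" "(y, x) \<notin> L"
        using L(1-3) unfolding irrefl_def trans_def by blast+
      then show "(x, y) \<in> T"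
        using T(2) TL[OF xy(2,1)] unfolding total_on_def by blast
    qed (use TL xy in blast)
  qed
  show ?thesis
  proof
    show "L \<in> linear_orders m" using L by (simp add: linear_orders_def)
    show "agree A R L" by (rule agree) (use R in \<open>auto simp: S_def P_def\<close>)
    show "agree B R' L" by (rule agree) (use R' in \<open>auto simp: S_def Q_def\<close>)
  qed
qed

section \<open>Conditions\<close>

definition cylinder :: "nat \<Rightarrow> nat set \<Rightarrow> nat rel \<Rightarrow> nat rel set" where
  "cylinder m D R = {R' \<in> linear_orders m. agree D R R'}"

text \<open>X m = {} means that the index m has been discarded.\<close>

definition condition :: "(nat \<Rightarrow> nat rel set) \<Rightarrow> bool" where
  "condition X \<longleftrightarrow> infinite {m. X m \<noteq> {}} \<and>
    (\<exists>k. \<forall>m. X m \<noteq> {} \<longrightarrow> (\<exists>D R. finite D \<and> card D \<le> (m + 2) ^ k \<and>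
      R \<in> linear_orders m \<and> X m = cylinder m D R))"

definition below :: "(nat \<Rightarrow> nat rel set) \<Rightarrow> (nat \<Rightarrow> nat rel set) set" where
  "below X = {Y. condition Y \<and> Y \<le> X}"

text \<open>Density below X is the weak forcing clause for atoms, disjunction and existence.\<close>

definition dense :: "(nat \<Rightarrow> nat rel set) \<Rightarrow> ((nat \<Rightarrow> nat rel set) \<Rightarrow> bool) \<Rightarrow> bool" where
  "dense X Q \<longleftrightarrow> (\<forall>Y\<in>below X. \<exists>Z\<in>below Y. Q Z)"

definition always :: "(nat \<Rightarrow> nat rel set) \<Rightarrow> (nat \<Rightarrow> nat rel \<Rightarrow> bool) \<Rightarrow> bool" where
  "always X P \<longleftrightarrow> (\<forall>m. \<forall>R\<in>X m. P m R)"

text \<open>The exponent is uniform in m. This matches \<open>condition\<close>, where one exponent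
  must serve all surviving indices, so that adding certificates to a condition gives a condition
  again.\<close>

definition certified :: "(nat \<Rightarrow> nat rel \<Rightarrow> bool) \<Rightarrow> bool" where
  "certified P \<longleftrightarrow> (\<exists>k. \<forall>m. \<forall>R\<in>linear_orders m. P m R \<longrightarrow>
    (\<exists>D. finite D \<and> card D \<le> (m + 2) ^ k \<and> (\<forall>R'\<in>linear_orders m. agree D R R' \<longrightarrow> P m R')))"

lemma below_refl: "condition X \<Longrightarrow> X \<in> below X"
  by (simp add: below_def)

lemma below_trans: "Z \<in> below Y \<Longrightarrow> Y \<in> below X \<Longrightarrow> Z \<in> below X"
  by (auto simp: below_def)

lemma below_condition: "Y \<in> below X \<Longrightarrow> condition Y"
  by (simp add: below_def)

lemma below_subset: "Y \<in> below X \<Longrightarrow> Y m \<subseteq> X m"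
  by (auto simp: below_def le_fun_def)

lemma below_nonempty: "Y \<in> below X \<Longrightarrow> Y m \<noteq> {} \<Longrightarrow> X m \<noteq> {}"
  using below_subset by blast

lemma denseD: "dense X Q \<Longrightarrow> Y \<in> below X \<Longrightarrow> \<exists>Z\<in>below Y. Q Z"
  by (simp add: dense_def)

lemma dense_below: "dense X Q \<Longrightarrow> Y \<in> below X \<Longrightarrow> dense Y Q"
  unfolding dense_def using below_trans by blast

lemma dense_dense: "dense X (\<lambda>Z. dense Z Q) \<Longrightarrow> dense X Q"
  unfolding dense_def using below_trans below_refl below_condition by meson

lemma dense_witness: "condition X \<Longrightarrow> dense X Q \<Longrightarrow> \<exists>Z\<in>below X. Q Z"
  unfolding dense_def using below_refl by blast

lemma dense_mono: "dense X Q \<Longrightarrow> (\<And>Z. Z \<in> below X \<Longrightarrow> Q Z \<Longrightarrow> Q' Z) \<Longrightarrow> dense X Q'"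
  unfolding dense_def using below_trans by meson

lemma always_below: "always X P \<Longrightarrow> Y \<in> below X \<Longrightarrow> always Y P"
  unfolding always_def using below_subset by blast

lemma dense_always_conj:
  assumes "dense X (\<lambda>Z. always Z P)" "dense X (\<lambda>Z. always Z Q)"
  shows "dense X (\<lambda>Z. always Z (\<lambda>m R. P m R \<and> Q m R))"
  unfolding dense_def
proof
  fix Y assume "Y \<in> below X"
  then obtain Z where Z: "Z \<in> below Y" "always Z P"
    using assms(1) unfolding dense_def by blast
  then obtain W where W: "W \<in> below Z" "always W Q"
    using assms(2) \<open>Y \<in> below X\<close> below_trans unfolding dense_def by blast
  then have "always W (\<lambda>m R. P m R \<and> Q m R)"
    using always_below[OF Z(2) W(1)] by (simp add: always_def)
  then show "\<exists>Z\<in>below Y. always Z (\<lambda>m R. P m R \<and> Q m R)"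
    using below_trans W Z by blast
qed

lemma condition_infinite: "condition X \<Longrightarrow> infinite {m. X m \<noteq> {}}"
  by (simp add: condition_def)

lemma condition_linear_orders: "condition X \<Longrightarrow> R \<in> X m \<Longrightarrow> R \<in> linear_orders m"
  unfolding condition_def cylinder_def by fastforce

lemma condition_nonempty: "condition X \<Longrightarrow> \<exists>m R. R \<in> X m"
  using infinite_imp_nonempty[OF condition_infinite] by blast

section \<open>Construction and refinement of conditions\<close>

lemma conditionI:
  assumes "infinite M"
    and "\<And>m. m \<in> M \<Longrightarrow> finite (D m) \<and> card (D m) \<le> (m + 2) ^ k \<and> R m \<in> linear_orders m"
  shows "condition (\<lambda>m. if m \<in> M then cylinder m (D m) (R m) else {})"
proof -
  have "cylinder m (D m) (R m) \<noteq> {}" if "m \<in> M" for m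
    using assms(2)[OF that] agree_refl unfolding cylinder_def by blast
  then have "{m. (if m \<in> M then cylinder m (D m) (R m) else {}) \<noteq> {}} = M"
    by auto
  then show ?thesis
    unfolding condition_def using assms by (intro conjI exI[of _ k]) auto
qed

text \<open>The base m + 2 is at least 2 at every index, so doubling costs one exponent.\<close>

lemma poly_add:
  fixes m :: nat
  assumes "a \<le> (m + 2) ^ j" "b \<le> (m + 2) ^ k"
  shows "a + b \<le> (m + 2) ^ Suc (j + k)"
proof -
  have "a + b \<le> (m + 2) ^ (j + k) + (m + 2) ^ (j + k)"
    using assms by (intro add_mono; elim order_trans) (auto intro: power_increasing)
  also have "\<dots> \<le> (m + 2) ^ Suc (j + k)" by simp
  finally show ?thesis .
qed

lemma card_Un_poly:
  fixes m :: nat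
  assumes "card A \<le> (m + 2) ^ j" "card B \<le> (m + 2) ^ k"
  shows "card (A \<union> B) \<le> (m + 2) ^ Suc (j + k)"
  using poly_add[OF assms] card_Un_le[of A B] by (rule order_trans[rotated])

lemma refine:
  assumes X: "condition X" and P: "certified P" and inf: "infinite {m. \<exists>R\<in>X m. P m R}"
  shows "\<exists>Y\<in>below X. always Y P"
proof -
  define M where "M = {m. \<exists>R\<in>X m. P m R}"
  obtain j where j: "\<And>m. X m \<noteq> {} \<Longrightarrow> \<exists>D R. finite D \<and> card D \<le> (m + 2) ^ j \<and>
      R \<in> linear_orders m \<and> X m = cylinder m D R"
    using X unfolding condition_def by blast
  obtain k where k: "\<And>m R. R \<in> linear_orders m \<Longrightarrow> P m R \<Longrightarrow>
      \<exists>D. finite D \<and> card D \<le> (m + 2) ^ k \<and> (\<forall>R'\<in>linear_orders m. agree D R R' \<longrightarrow> P m R')"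
    using P unfolding certified_def by blast
  define F where "F m D R \<longleftrightarrow> (finite D \<and> card D \<le> (m + 2) ^ Suc (j + k) \<and> R \<in> linear_orders m) \<and>
      cylinder m D R \<subseteq> X m \<and> (\<forall>R'\<in>cylinder m D R. P m R')" for m D R
  have "\<forall>m\<in>M. \<exists>D R. F m D R"
  proof
    fix m assume m: "m \<in> M"
    obtain R where R: "R \<in> X m" "P m R" using m unfolding M_def by blast
    obtain D S where D: "finite D" "card D \<le> (m + 2) ^ j" "X m = cylinder m D S"
      using j[of m] R(1) by blast
    have RL: "R \<in> linear_orders m" "agree D S R" using R(1) D(3) by (auto simp: cylinder_def)
    obtain E where E: "finite E" "card E \<le> (m + 2) ^ k"
      "\<And>R'. R' \<in> linear_orders m \<Longrightarrow> agree E R R' \<Longrightarrow> P m R'"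
      using k[OF RL(1) R(2)] by blast
    have "cylinder m (D \<union> E) R \<subseteq> X m"
      unfolding D(3) cylinder_def using RL(2) agree_trans agree_subset by blast
    moreover have "\<forall>R'\<in>cylinder m (D \<union> E) R. P m R'"
      using E(3) agree_subset unfolding cylinder_def by blast
    ultimately have "F m (D \<union> E) R"
      using D E RL(1) card_Un_poly[OF D(2) E(2)] by (simp add: F_def)
    then show "\<exists>D R. F m D R" by blast
  qed
  then obtain D R where "\<forall>m\<in>M. F m (D m) (R m)"
    unfolding bchoice_iff by blast
  then have DR: "\<And>m. m \<in> M \<Longrightarrow> finite (D m) \<and> card (D m) \<le> (m + 2) ^ Suc (j + k) \<and>
      R m \<in> linear_orders m" "\<And>m. m \<in> M \<Longrightarrow> cylinder m (D m) (R m) \<subseteq> X m"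
    "\<And>m R'. m \<in> M \<Longrightarrow> R' \<in> cylinder m (D m) (R m) \<Longrightarrow> P m R'"
    by (simp_all add: F_def)
  define Y where "Y m = (if m \<in> M then cylinder m (D m) (R m) else {})" for m
  have "condition Y"
    unfolding Y_def by (rule conditionI[OF inf[folded M_def] DR(1)])
  moreover have "Y \<le> X"
    unfolding le_fun_def Y_def using DR(2) by simp
  moreover have "always Y P"
    unfolding always_def Y_def using DR(3) by simp
  ultimately show ?thesis
    unfolding below_def by blast
qed

lemma certified_absolute: "(\<And>m R R'. P m R \<Longrightarrow> P m R') \<Longrightarrow> certified P"
  unfolding certified_def by (intro exI[of _ 0]) (auto intro!: exI[of _ "{}"])

lemma refine_indices:
  assumes "condition X" "infinite {m. X m \<noteq> {} \<and> Q m}"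
  shows "\<exists>Y\<in>below X. \<forall>m. Y m \<noteq> {} \<longrightarrow> Q m"
proof -
  have "\<exists>Y\<in>below X. always Y (\<lambda>m R. Q m)"
    by (rule refine[OF assms(1)]) (auto intro: certified_absolute simp: assms(2) ex_in_conv)
  then show ?thesis unfolding always_def by blast
qed

text \<open>An infinite set of indices covered by two sets meets one of them in an infinite set, so
  one disjunct can be chosen for all remaining indices and orders.\<close>

lemma refine_disj:
  assumes X: "condition X" and P: "certified P" "certified Q"
    and or: "\<And>m. X m \<noteq> {} \<Longrightarrow> \<exists>R\<in>X m. P m R \<or> Q m R"
  shows "\<exists>Y\<in>below X. always Y P \<or> always Y Q"
proof -
  have "{m. X m \<noteq> {}} \<subseteq> {m. \<exists>R\<in>X m. P m R} \<union> {m. \<exists>R\<in>X m. Q m R}"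
    using or by blast
  then have "infinite {m. \<exists>R\<in>X m. P m R} \<or> infinite {m. \<exists>R\<in>X m. Q m R}"
    using condition_infinite[OF X] finite_subset by blast
  then show ?thesis
    using refine[OF X P(1)] refine[OF X P(2)] by blast
qed

section \<open>Forcing\<close>

definition elements :: "(nat \<Rightarrow> nat) set" where
  "elements = {a. \<exists>k. \<forall>m. blen (a m) \<le> (m + 2) ^ k}"

definition slice :: "(nat \<Rightarrow> nat \<Rightarrow> nat) \<Rightarrow> nat \<Rightarrow> nat \<Rightarrow> nat" where
  "slice e m = (\<lambda>i. e i m)"

definition holds :: "fm \<Rightarrow> (nat \<Rightarrow> nat \<Rightarrow> nat) \<Rightarrow> (nat \<Rightarrow> nat rel set) \<Rightarrow> bool" where
  "holds \<phi> e X \<longleftrightarrow> always X (\<lambda>m R. sat R (slice e m) \<phi>)"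

text \<open>Density in the clauses for atoms, \<or> and \<exists> makes this weak forcing, which
  validates classical logic (see \<open>forces_dense\<close>). Quantifiers range over fixed
  sequences, not over names that depend on the order to be built.\<close>

primrec forces :: "fm \<Rightarrow> (nat \<Rightarrow> nat \<Rightarrow> nat) \<Rightarrow> (nat \<Rightarrow> nat rel set) \<Rightarrow> bool" where
  "forces (s \<^bold>= t) e X \<longleftrightarrow> dense X (holds (s \<^bold>= t) e)"
| "forces (s \<^bold>\<le> t) e X \<longleftrightarrow> dense X (holds (s \<^bold>\<le> t) e)"
| "forces (s \<^bold>\<lhd> t) e X \<longleftrightarrow> dense X (holds (s \<^bold>\<lhd> t) e)"
| "forces (\<^bold>\<not> \<phi>) e X \<longleftrightarrow> (\<forall>Y\<in>below X. \<not> forces \<phi> e Y)"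
| "forces (\<phi> \<^bold>\<and> \<psi>) e X \<longleftrightarrow> forces \<phi> e X \<and> forces \<psi> e X"
| "forces (\<phi> \<^bold>\<or> \<psi>) e X \<longleftrightarrow> dense X (\<lambda>Z. forces \<phi> e Z \<or> forces \<psi> e Z)"
| "forces (\<phi> \<^bold>\<longrightarrow> \<psi>) e X \<longleftrightarrow> (\<forall>Y\<in>below X. forces \<phi> e Y \<longrightarrow> forces \<psi> e Y)"
| "forces (Forall \<phi>) e X \<longleftrightarrow> (\<forall>a\<in>elements. forces \<phi> (case_nat a e) X)"
| "forces (Exists \<phi>) e X \<longleftrightarrow> dense X (\<lambda>Z. \<exists>a\<in>elements. forces \<phi> (case_nat a e) Z)"

lemma slice_case_nat [simp]: "slice (case_nat a e) m = case_nat (a m) (slice e m)"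
  by (auto simp: slice_def split: nat.split)

lemma slice_apply: "slice e m i = e i m"
  by (simp add: slice_def)

lemma forces_below: "forces \<phi> e X \<Longrightarrow> Y \<in> below X \<Longrightarrow> forces \<phi> e Y"
  by (induction \<phi> arbitrary: e) (auto intro: dense_below below_trans)

text \<open>Whatever is forced densely is forced. The classical rule RAA rests on this, and so do
  DisjE and ExE, whose case or witness becomes known only below stronger conditions.\<close>

lemma forces_dense: "dense X (forces \<phi> e) \<Longrightarrow> forces \<phi> e X"
proof (induction \<phi> arbitrary: e X)
  case (Neg \<phi>)
  have False if Y: "Y \<in> below X" "forces \<phi> e Y" for Y
  proof -
    obtain Z where "Z \<in> below Y" "forces (\<^bold>\<not> \<phi>) e Z"
      using Neg.prems Y(1) unfolding dense_def by blast
    then show False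
      using forces_below[OF Y(2)] below_refl below_condition by (metis forces.simps(4))
  qed
  then show ?case by auto
next
  case (Conj \<phi> \<psi>)
  have "dense X (forces \<phi> e)" "dense X (forces \<psi> e)"
    by (rule dense_mono[OF Conj.prems], simp)+
  then show ?case using Conj.IH by simp
next
  case (Impl \<phi> \<psi>)
  have "forces \<psi> e Y" if Y: "Y \<in> below X" "forces \<phi> e Y" for Y
  proof (rule Impl.IH(2), unfold dense_def, rule ballI)
    fix Z assume Z: "Z \<in> below Y"
    then obtain W where W: "W \<in> below Z" "forces (\<phi> \<^bold>\<longrightarrow> \<psi>) e W"
      using Impl.prems Y(1) below_trans unfolding dense_def by blast
    then have "forces \<psi> e W"
      using forces_below[OF Y(2)] below_trans[OF W(1) Z] below_refl below_condition
      by (metis forces.simps(7))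
    then show "\<exists>W\<in>below Z. forces \<psi> e W" using W(1) by blast
  qed
  then show ?case by auto
next
  case (Forall \<phi>)
  have "dense X (forces \<phi> (case_nat a e))" if "a \<in> elements" for a
    by (rule dense_mono[OF Forall.prems]) (use that in simp)
  then show ?case using Forall.IH by simp
qed (unfold forces.simps, (rule dense_dense, erule dense_mono, simp)+)

lemma dense_cong: "(\<And>Z. Z \<in> below X \<Longrightarrow> Q Z \<longleftrightarrow> Q' Z) \<Longrightarrow> dense X Q \<longleftrightarrow> dense X Q'"
  unfolding dense_def using below_trans by meson

lemma holds_env_cong:
  "(\<And>m. X m \<noteq> {} \<Longrightarrow> slice e m = slice e' m) \<Longrightarrow> holds \<phi> e X \<longleftrightarrow> holds \<phi> e' X"
  unfolding holds_def always_def by (metis emptyE)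

text \<open>Discarded indices are invisible to forcing. Sequences may therefore be given convenient
  values there, or be replaced by others that coincide with them at the surviving indices.\<close>

lemma forces_env_cong:
  "(\<And>m. X m \<noteq> {} \<Longrightarrow> slice e m = slice e' m) \<Longrightarrow> forces \<phi> e X \<longleftrightarrow> forces \<phi> e' X"
proof (induction \<phi> arbitrary: e e' X)
  case (Eq s t)
  then show ?case
    unfolding forces.simps by (intro dense_cong holds_env_cong) (use below_nonempty in blast)
next
  case (LessEq s t)
  then show ?case
    unfolding forces.simps by (intro dense_cong holds_env_cong) (use below_nonempty in blast)
next
  case (Prec s t)
  then show ?case
    unfolding forces.simps by (intro dense_cong holds_env_cong) (use below_nonempty in blast)
next
  case (Neg \<phi>)
  have "forces \<phi> e Y \<longleftrightarrow> forces \<phi> e' Y" if "Y \<in> below X" for Y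
    by (rule Neg.IH) (use Neg.prems below_nonempty[OF that] in blast)
  then show ?case by simp
next
  case (Conj \<phi> \<psi>)
  then show ?case by (metis forces.simps(5))
next
  case (Disj \<phi> \<psi>)
  have "forces \<phi> e Y \<longleftrightarrow> forces \<phi> e' Y" "forces \<psi> e Y \<longleftrightarrow> forces \<psi> e' Y" if "Y \<in> below X" for Y
    by (rule Disj.IH; use Disj.prems below_nonempty[OF that] in blast)+
  then show ?case by (auto intro!: dense_cong)
next
  case (Impl \<phi> \<psi>)
  have "forces \<phi> e Y \<longleftrightarrow> forces \<phi> e' Y" "forces \<psi> e Y \<longleftrightarrow> forces \<psi> e' Y" if "Y \<in> below X" for Y
    by (rule Impl.IH; use Impl.prems below_nonempty[OF that] in blast)+
  then show ?case by simp
next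
  case (Forall \<phi>)
  have "forces \<phi> (case_nat a e) X \<longleftrightarrow> forces \<phi> (case_nat a e') X" for a
    by (rule Forall.IH) (simp add: Forall.prems)
  then show ?case by simp
next
  case (Exists \<phi>)
  have "forces \<phi> (case_nat a e) Y \<longleftrightarrow> forces \<phi> (case_nat a e') Y" if "Y \<in> below X" for Y a
    by (rule Exists.IH) (simp add: Exists.prems below_nonempty[OF that])
  then show ?case by (auto intro!: dense_cong)
qed

section \<open>Substitution, closure of the elements under terms, and soundness\<close>

definition subst_env :: "(nat \<Rightarrow> tm) \<Rightarrow> (nat \<Rightarrow> nat \<Rightarrow> nat) \<Rightarrow> nat \<Rightarrow> nat \<Rightarrow> nat" where
  "subst_env \<sigma> e i m = tval (slice e m) (\<sigma> i)"

lemma slice_subst_env: "slice (subst_env \<sigma> e) m = (\<lambda>i. tval (slice e m) (\<sigma> i))"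
  by (auto simp: slice_def subst_env_def)

lemma subst_env_under_binder:
  "subst_env (under_binder \<sigma>) (case_nat a e) = case_nat a (subst_env \<sigma> e)"
  by (intro ext) (auto simp: subst_env_def under_binder_def split: nat.split)

lemma holds_subst_atom:
  "holds (subst_tm \<sigma> s \<^bold>= subst_tm \<sigma> t) e = holds (s \<^bold>= t) (subst_env \<sigma> e)"
  "holds (subst_tm \<sigma> s \<^bold>\<le> subst_tm \<sigma> t) e = holds (s \<^bold>\<le> t) (subst_env \<sigma> e)"
  "holds (subst_tm \<sigma> s \<^bold>\<lhd> subst_tm \<sigma> t) e = holds (s \<^bold>\<lhd> t) (subst_env \<sigma> e)"
  by (auto simp: holds_def tval_subst slice_subst_env fun_eq_iff)

lemma forces_subst: "forces (subst \<sigma> \<phi>) e X \<longleftrightarrow> forces \<phi> (subst_env \<sigma> e) X"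
  by (induction \<phi> arbitrary: \<sigma> e X) (simp_all add: holds_subst_atom subst_env_under_binder)

lemma forces_lift: "forces (lift \<phi>) (case_nat a e) X \<longleftrightarrow> forces \<phi> e X"
proof -
  have "subst_env (\<lambda>i. Var (Suc i)) (case_nat a e) = e"
    by (simp add: subst_env_def fun_eq_iff slice_apply)
  then show ?thesis by (simp add: lift_def forces_subst)
qed

lemma forces_inst: "forces (inst t \<phi>) e X \<longleftrightarrow> forces \<phi> (case_nat (\<lambda>m. tval (slice e m) t) e) X"
proof -
  have "subst_env (case_nat t Var) e = case_nat (\<lambda>m. tval (slice e m) t) e"
    by (intro ext) (auto simp: subst_env_def slice_apply split: nat.split)
  then show ?thesis by (simp add: inst_def forces_subst)
qed

definition envs :: "(nat \<Rightarrow> nat \<Rightarrow> nat) set" where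
  "envs = {e. \<forall>i. e i \<in> elements}"

lemma elements_bounded:
  assumes "finite A" "\<And>i. i \<in> A \<Longrightarrow> e i \<in> elements"
  shows "\<exists>k. \<forall>m. \<forall>i\<in>A. blen (e i m) \<le> (m + 2) ^ k"
  using assms
proof (induction A)
  case (insert i A)
  obtain k where "\<forall>m. \<forall>i\<in>A. blen (e i m) \<le> (m + 2) ^ k"
    using insert.IH insert.prems by blast
  moreover obtain j where "\<forall>m. blen (e i m) \<le> (m + 2) ^ j"
    using insert.prems[of i] unfolding elements_def by auto
  moreover have "(m + 2) ^ k \<le> (m + 2) ^ (k + j)" "(m + 2) ^ j \<le> (m + 2) ^ (k + j)" for m :: nat
    by (auto intro: power_increasing)
  ultimately show ?case by (intro exI[of _ "k + j"]) (metis insertE order_trans)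
qed simp

lemma tval_elements:
  assumes "e \<in> envs"
  shows "(\<lambda>m. tval (slice e m) t) \<in> elements"
proof -
  obtain k where k: "\<And>m i. i \<in> fv_tm t \<Longrightarrow> blen (e i m) \<le> (m + 2) ^ k"
    using elements_bounded[OF finite_fv_tm, of t e] assms unfolding envs_def by blast
  obtain c where
    c: "\<And>e l. 2 \<le> l \<Longrightarrow> \<forall>i\<in>fv_tm t. blen (e i) \<le> l \<Longrightarrow> blen (tval e t) \<le> l ^ c"
    using tval_polybounded[of t] by blast
  have "blen (tval (slice e m) t) \<le> (m + 2) ^ (Suc k * c)" for m
  proof -
    \<comment> \<open>\<open>Suc k\<close> because the bound for terms needs a base of at least 2,
      and (m + 2) ^ 0 is 1.\<close>
    have *: "2 \<le> (m + 2) ^ Suc k" "(m + 2) ^ k \<le> (m + 2) ^ Suc k"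
      using self_le_power[of "m + 2" "Suc k"] by (linarith, intro power_increasing) auto
    show ?thesis
      unfolding power_mult by (rule c[OF *(1)]) (use order_trans[OF k *(2)] in \<open>simp only: slice_apply, blast\<close>)
  qed
  then show ?thesis unfolding elements_def by blast
qed

lemma elements_le: "b \<in> elements \<Longrightarrow> (\<And>m. a m \<le> b m) \<Longrightarrow> a \<in> elements"
  unfolding elements_def using blen_mono order_trans by blast

lemma case_nat_elements:
  "a \<in> elements \<Longrightarrow> e \<in> envs \<Longrightarrow> case_nat a e \<in> envs"
  by (simp add: envs_def split: nat.split)

lemma holds_below: "holds \<phi> e X \<Longrightarrow> Y \<in> below X \<Longrightarrow> holds \<phi> e Y"
  unfolding holds_def by (rule always_below)

lemma holds_dense: "holds \<phi> e X \<Longrightarrow> dense X (holds \<phi> e)"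
  unfolding dense_def using holds_below below_refl below_condition by blast

theorem soundness:
  assumes "\<Gamma> \<turnstile> \<phi>" "condition X" "e \<in> envs" "\<And>\<gamma>. \<gamma> \<in> \<Gamma> \<Longrightarrow> forces \<gamma> e X"
  shows "forces \<phi> e X"
  using assms
proof (induction arbitrary: e X rule: proves.induct)
  case (Assm \<phi> \<Gamma>)
  then show ?case by blast
next
  case (NegI \<phi> \<Gamma> \<psi>)
  have False if Y: "Y \<in> below X" "forces \<phi> e Y" for Y
  proof -
    have "forces \<gamma> e Y" if "\<gamma> \<in> insert \<phi> \<Gamma>" for \<gamma>
      using that NegI.prems(3) Y forces_below by blast
    then have "forces \<psi> e Y" "forces (\<^bold>\<not> \<psi>) e Y"
      using NegI.IH NegI.prems(2) below_condition[OF Y(1)] by blast+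
    then show False using below_refl[OF below_condition[OF Y(1)]] by auto
  qed
  then show ?case by auto
next
  case (RAA \<phi> \<Gamma> \<psi>)
  show ?case
  \<comment> \<open>A condition none of whose extensions forces \<phi> forces its negation, and then
    the two premises clash.\<close>
  proof (rule forces_dense, unfold dense_def, rule ballI, rule ccontr)
    fix Y assume Y: "Y \<in> below X" "\<not> (\<exists>Z\<in>below Y. forces \<phi> e Z)"
    have "forces \<gamma> e Y" if "\<gamma> \<in> insert (\<^bold>\<not> \<phi>) \<Gamma>" for \<gamma>
      using that RAA.prems(3) Y by (auto intro: forces_below)
    then have "forces \<psi> e Y" "forces (\<^bold>\<not> \<psi>) e Y"
      using RAA.IH RAA.prems(2) below_condition[OF Y(1)] by blast+
    then show False using below_refl[OF below_condition[OF Y(1)]] by auto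
  qed
next
  case (ConjI \<Gamma> \<phi> \<psi>)
  then show ?case by simp
next
  case (ConjE1 \<Gamma> \<phi> \<psi>)
  then show ?case by (metis forces.simps(5))
next
  case (ConjE2 \<Gamma> \<phi> \<psi>)
  then show ?case by (metis forces.simps(5))
next
  case (DisjI1 \<Gamma> \<phi> \<psi>)
  then have "forces \<phi> e X" by blast
  then show ?case
    using forces_below below_refl below_condition by (simp add: dense_def) blast
next
  case (DisjI2 \<Gamma> \<psi> \<phi>)
  then have "forces \<psi> e X" by blast
  then show ?case
    using forces_below below_refl below_condition by (simp add: dense_def) blast
next
  case (DisjE \<Gamma> \<phi> \<psi> \<chi>)
  have "dense X (\<lambda>Z. forces \<phi> e Z \<or> forces \<psi> e Z)"
    using DisjE.IH(1)[OF DisjE.prems] by simp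
  then show ?case
  proof (rule forces_dense[OF dense_mono])
    fix Z assume Z: "Z \<in> below X" "forces \<phi> e Z \<or> forces \<psi> e Z"
    have "forces \<gamma> e Z" if "\<gamma> \<in> \<Gamma>" for \<gamma>
      using that DisjE.prems(3) Z forces_below by blast
    then show "forces \<chi> e Z"
      using Z(2) DisjE.IH(2,3)[OF below_condition[OF Z(1)] DisjE.prems(2)] by blast
  qed
next
  case (ImplI \<phi> \<Gamma> \<psi>)
  have "forces \<psi> e Y" if "Y \<in> below X" "forces \<phi> e Y" for Y
    by (rule ImplI.IH) (use that ImplI.prems forces_below below_condition in blast)+
  then show ?case by simp
next
  case (ImplE \<Gamma> \<phi> \<psi>)
  then show ?case using below_refl by (metis forces.simps(7))
next
  case (AllI \<Gamma> \<phi>)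
  have "forces \<phi> (case_nat a e) X" if "a \<in> elements" for a
    by (rule AllI.IH) (use AllI.prems that in \<open>auto simp: forces_lift case_nat_elements\<close>)
  then show ?case by simp
next
  case (AllE \<Gamma> \<phi> t)
  then have "forces (Forall \<phi>) e X" by blast
  then show ?case using tval_elements[of e t] AllE.prems(2) by (simp add: forces_inst)
next
  case (ExI \<Gamma> t \<phi>)
  then have "forces (inst t \<phi>) e Z" if "Z \<in> below X" for Z
    using that forces_below by blast
  then show ?case
    using tval_elements[of e t] ExI.prems(2) below_refl below_condition below_trans
    by (simp add: forces_inst dense_def) blast
next
  case (ExE \<Gamma> \<phi> \<chi>)
  have "dense X (\<lambda>Z. \<exists>a\<in>elements. forces \<phi> (case_nat a e) Z)"
    using ExE.IH(1)[OF ExE.prems] by simp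
  then show ?case
  proof (rule forces_dense[OF dense_mono])
    fix Z assume Z: "Z \<in> below X" "\<exists>a\<in>elements. forces \<phi> (case_nat a e) Z"
    then obtain a where a: "a \<in> elements" "forces \<phi> (case_nat a e) Z" by blast
    have "forces (lift \<chi>) (case_nat a e) Z"
    proof (rule ExE.IH(2)[OF below_condition[OF Z(1)]])
      show "case_nat a e \<in> envs"
        by (rule case_nat_elements[OF a(1) ExE.prems(2)])
      fix \<gamma> assume "\<gamma> \<in> insert \<phi> (lift ` \<Gamma>)"
      then show "forces \<gamma> (case_nat a e) Z"
        using a(2) forces_below[OF ExE.prems(3) Z(1)] by (auto simp: forces_lift)
    qed
    then show "forces \<chi> e Z" by (simp add: forces_lift)
  qed
next
  case (EqI \<Gamma> t)
  have "holds (t \<^bold>= t) e X" by (simp add: holds_def always_def)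
  then show ?case by (simp add: holds_dense)
next
  case (EqE \<Gamma> s t \<phi>)
  have "dense X (holds (s \<^bold>= t) e)" "forces (inst s \<phi>) e X"
    using EqE.IH(1)[OF EqE.prems] EqE.IH(2)[OF EqE.prems] by simp_all
  then show ?case
  proof (elim forces_dense[OF dense_mono])
    fix Z assume Z: "forces (inst s \<phi>) e X" "Z \<in> below X" "holds (s \<^bold>= t) e Z"
    \<comment> \<open>The two terms have the same value at every index that survives in Z.\<close>
    have "forces \<phi> (case_nat (\<lambda>m. tval (slice e m) s) e) Z \<longleftrightarrow>
        forces \<phi> (case_nat (\<lambda>m. tval (slice e m) t) e) Z"
      by (rule forces_env_cong) (use Z(3) in \<open>auto simp: holds_def always_def\<close>)
    then show "forces (inst t \<phi>) e Z"
      using forces_below[OF Z(1,2)] by (simp add: forces_inst)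
  qed
qed

lemma forces_closure:
  assumes "\<And>e. e \<in> envs \<Longrightarrow> forces \<phi> e X" "e \<in> envs"
  shows "forces (closure \<phi>) e X"
proof -
  have "forces ((Forall ^^ n) \<phi>) e X" if "e \<in> envs" for n e
    using that
  proof (induction n arbitrary: e)
    case 0
    then show ?case using assms(1) by simp
  next
    case (Suc n)
    then show ?case by (auto intro: case_nat_elements)
  qed
  then show ?thesis using assms(2) by (simp add: closure_def)
qed

section \<open>Forcing and truth for bounded formulas\<close>

lemma certifiable_uniform:
  assumes "certifiable \<phi>"
  shows "\<exists>k. \<forall>m e R. (\<forall>i\<in>fv \<phi>. blen (e i) \<le> (m + 2) ^ j) \<longrightarrow> sat R e \<phi> \<longrightarrow>
    (\<exists>D. finite D \<and> card D \<le> (m + 2) ^ k \<and> (\<forall>R'. agree D R R' \<longrightarrow> sat R' e \<phi>))"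
proof -
  obtain k where k: "\<And>l e R. 2 \<le> l \<Longrightarrow> \<forall>i\<in>fv \<phi>. blen (e i) \<le> l \<Longrightarrow> sat R e \<phi> \<Longrightarrow>
     (\<exists>D. finite D \<and> card D \<le> l ^ k \<and> (\<forall>R'. agree D R R' \<longrightarrow> sat R' e \<phi>))"
    using assms unfolding certifiable_def by blast
  show ?thesis
  proof (rule exI[of _ "Suc j * k"], intro allI impI)
    fix m e R assume e: "\<forall>i\<in>fv \<phi>. blen (e i) \<le> (m + 2) ^ j" and "sat R e \<phi>"
    have *: "2 \<le> (m + 2) ^ Suc j" "(m + 2) ^ j \<le> (m + 2) ^ Suc j"
      using self_le_power[of "m + 2" "Suc j"] by (linarith, intro power_increasing) auto
    then have "\<forall>i\<in>fv \<phi>. blen (e i) \<le> (m + 2) ^ Suc j"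
      using e order_trans by blast
    with k[OF *(1) _ \<open>sat R e \<phi>\<close>]
    show "\<exists>D. finite D \<and> card D \<le> (m + 2) ^ (Suc j * k) \<and> (\<forall>R'. agree D R R' \<longrightarrow> sat R' e \<phi>)"
      unfolding power_mult by blast
  qed
qed

lemma certified_sat:
  assumes "certifiable \<phi>" "e \<in> envs"
  shows "certified (\<lambda>m R. sat R (slice e m) \<phi>)"
proof -
  obtain j where j: "\<And>m. \<forall>i\<in>fv \<phi>. blen (slice e m i) \<le> (m + 2) ^ j"
    using elements_bounded[OF finite_fv, of \<phi> e] assms(2)
    unfolding slice_apply envs_def by blast
  obtain k where k: "\<And>m e R. \<lbrakk>\<forall>i\<in>fv \<phi>. blen (e i) \<le> (m + 2) ^ j; sat R e \<phi>\<rbrakk> \<Longrightarrow>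
    \<exists>D. finite D \<and> card D \<le> (m + 2) ^ k \<and> (\<forall>R'. agree D R R' \<longrightarrow> sat R' e \<phi>)"
    using certifiable_uniform[OF assms(1), of j] by blast
  show ?thesis
    unfolding certified_def
  proof (rule exI[of _ k], intro allI ballI impI)
    fix m R assume "sat R (slice e m) \<phi>"
    from k[OF j this]
    show "\<exists>D. finite D \<and> card D \<le> (m + 2) ^ k \<and>
        (\<forall>R'\<in>linear_orders m. agree D R R' \<longrightarrow> sat R' (slice e m) \<phi>)"
      by blast
  qed
qed

lemma certified_sat_case_nat:
  assumes "certifiable \<phi>" "e \<in> envs" "a \<in> elements"
  shows "certified (\<lambda>m R. sat R (case_nat (a m) (slice e m)) \<phi>)"
  using certified_sat[OF assms(1), of "case_nat a e"] case_nat_elements[OF assms(3,2)] by simp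

definition truthful :: "fm \<Rightarrow> bool" where
  "truthful \<phi> \<longleftrightarrow> (\<forall>X e. condition X \<longrightarrow> e \<in> envs \<longrightarrow>
    (forces \<phi> e X \<longleftrightarrow> dense X (holds \<phi> e)))"

lemma truthfulI:
  assumes "\<And>X e. \<lbrakk>condition X; e \<in> envs; forces \<phi> e X\<rbrakk> \<Longrightarrow> dense X (holds \<phi> e)"
    and "\<And>X e. \<lbrakk>condition X; e \<in> envs; dense X (holds \<phi> e)\<rbrakk> \<Longrightarrow> forces \<phi> e X"
  shows "truthful \<phi>"
  using assms unfolding truthful_def by blast

lemma truthfulD:
  "truthful \<phi> \<Longrightarrow> condition X \<Longrightarrow> e \<in> envs \<Longrightarrow>
    forces \<phi> e X \<longleftrightarrow> dense X (holds \<phi> e)"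
  unfolding truthful_def by blast

lemma dense_holds_Conj: "dense X (holds (\<phi> \<^bold>\<and> \<psi>) e) \<longleftrightarrow> dense X (holds \<phi> e) \<and> dense X (holds \<psi> e)"
proof
  assume *: "dense X (holds (\<phi> \<^bold>\<and> \<psi>) e)"
  show "dense X (holds \<phi> e) \<and> dense X (holds \<psi> e)"
    by (intro conjI; rule dense_mono[OF *]) (auto simp: holds_def always_def)
next
  assume "dense X (holds \<phi> e) \<and> dense X (holds \<psi> e)"
  then show "dense X (holds (\<phi> \<^bold>\<and> \<psi>) e)"
    using dense_always_conj[of X "\<lambda>m R. sat R (slice e m) \<phi>" "\<lambda>m R. sat R (slice e m) \<psi>"]
    by (simp add: holds_def[abs_def])
qed

text \<open>Asks for certificates of truth and of falsity. Formulas in \<open>Delta_b_0\<close> have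
  both; for a formula in \<open>Sigma_b_1\<close> only certificates of truth are at hand.\<close>

lemma decide:
  assumes "certifiable \<phi>" "certifiable (\<^bold>\<not> \<phi>)" "condition X" "e \<in> envs"
  shows "\<exists>Y\<in>below X. holds \<phi> e Y \<or> holds (\<^bold>\<not> \<phi>) e Y"
  unfolding holds_def
  by (rule refine_disj[OF assms(3) certified_sat[OF assms(1,4)] certified_sat[OF assms(2,4)]])
    (auto simp: ex_in_conv)

text \<open>Every condition has an extension that decides \<phi>; if the negation is forced, the
  decision cannot be positive, since truth throughout a condition would force \<phi>.\<close>

lemma truthful_Neg:
  assumes "truthful \<phi>" "certifiable \<phi>" "certifiable (\<^bold>\<not> \<phi>)"
  shows "truthful (\<^bold>\<not> \<phi>)"
proof (rule truthfulI)
  fix X e assume e: "e \<in> envs" and X: "forces (\<^bold>\<not> \<phi>) e X"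
  have no: "\<not> holds \<phi> e Y" if "Y \<in> below X" for Y
    using X that truthfulD[OF assms(1) below_condition[OF that], of e] e holds_dense by auto
  show "dense X (holds (\<^bold>\<not> \<phi>) e)"
    unfolding dense_def
  proof
    fix Y assume Y: "Y \<in> below X"
    obtain Z where Z: "Z \<in> below Y" "holds \<phi> e Z \<or> holds (\<^bold>\<not> \<phi>) e Z"
      using decide[OF assms(2,3) below_condition[OF Y] e] by blast
    with no[OF below_trans[OF Z(1) Y]] have "holds (\<^bold>\<not> \<phi>) e Z" by simp
    then show "\<exists>Z\<in>below Y. holds (\<^bold>\<not> \<phi>) e Z" using Z(1) by (rule bexI)
  qed
next
  fix X e assume e: "e \<in> envs" and X: "dense X (holds (\<^bold>\<not> \<phi>) e)"
  have False if Y: "Y \<in> below X" "forces \<phi> e Y" for Y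
  proof -
    have Yc: "condition Y" using Y(1) below_condition by blast
    then have "dense Y (holds \<phi> e)"
      using truthfulD[OF assms(1)] e Y(2) by blast
    with dense_below[OF X Y(1)] have "dense Y (holds (\<phi> \<^bold>\<and> \<^bold>\<not> \<phi>) e)"
      by (simp add: dense_holds_Conj)
    then obtain Z where "Z \<in> below Y" "holds (\<phi> \<^bold>\<and> \<^bold>\<not> \<phi>) e Z"
      using dense_witness[OF Yc] by blast
    then show False
      using condition_nonempty[OF below_condition] by (fastforce simp: holds_def always_def)
  qed
  then show "forces (\<^bold>\<not> \<phi>) e X" by auto
qed

lemma truthful_Conj: "truthful \<phi> \<Longrightarrow> truthful \<psi> \<Longrightarrow> truthful (\<phi> \<^bold>\<and> \<psi>)"
  unfolding truthful_def by (simp add: dense_holds_Conj)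

text \<open>Truth of the disjunction may come from different disjuncts at different indices and in
  different orders; \<open>refine_disj\<close> settles on one of them.\<close>

lemma truthful_Disj:
  assumes "truthful \<phi>" "truthful \<psi>" "certifiable \<phi>" "certifiable \<psi>"
  shows "truthful (\<phi> \<^bold>\<or> \<psi>)"
proof (rule truthfulI)
  fix X e assume e: "e \<in> envs" and X: "forces (\<phi> \<^bold>\<or> \<psi>) e X"
  show "dense X (holds (\<phi> \<^bold>\<or> \<psi>) e)"
    unfolding dense_def
  proof
    fix Y assume "Y \<in> below X"
    then obtain Z where Z: "Z \<in> below Y" "forces \<phi> e Z \<or> forces \<psi> e Z"
      using X by (auto simp: dense_def)
    then have "dense Z (holds \<phi> e) \<or> dense Z (holds \<psi> e)"
      using truthfulD assms(1,2) e below_condition by blast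
    then obtain W where "W \<in> below Z" "holds \<phi> e W \<or> holds \<psi> e W"
      using dense_witness[OF below_condition[OF Z(1)]] by blast
    moreover have "holds (\<phi> \<^bold>\<or> \<psi>) e W" if "holds \<phi> e W \<or> holds \<psi> e W" for W
      using that by (auto simp: holds_def always_def)
    ultimately show "\<exists>W\<in>below Y. holds (\<phi> \<^bold>\<or> \<psi>) e W"
      using below_trans[OF _ Z(1)] by blast
  qed
next
  fix X e assume e: "e \<in> envs" and X: "dense X (holds (\<phi> \<^bold>\<or> \<psi>) e)"
  have "\<exists>W\<in>below Y. forces \<phi> e W \<or> forces \<psi> e W" if Y: "Y \<in> below X" for Y
  proof -
    obtain Z where Z: "Z \<in> below Y" "holds (\<phi> \<^bold>\<or> \<psi>) e Z"
      using denseD[OF X Y] by blast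
    have "\<exists>W\<in>below Z. holds \<phi> e W \<or> holds \<psi> e W"
      unfolding holds_def
      by (rule refine_disj[OF below_condition[OF Z(1)] certified_sat[OF assms(3) e]
            certified_sat[OF assms(4) e]])
        (use Z(2) in \<open>auto simp: holds_def always_def\<close>)
    then obtain W where W: "W \<in> below Z" "holds \<phi> e W \<or> holds \<psi> e W" by blast
    then have "dense W (holds \<phi> e) \<or> dense W (holds \<psi> e)"
      using holds_dense by blast
    then have "forces \<phi> e W \<or> forces \<psi> e W"
      using truthfulD[OF assms(1) below_condition[OF W(1)], of e]
        truthfulD[OF assms(2) below_condition[OF W(1)], of e] e by blast
    then show ?thesis using below_trans[OF W(1) Z(1)] by blast
  qed
  then show "forces (\<phi> \<^bold>\<or> \<psi>) e X" by (simp add: dense_def)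
qed

lemma truthful_Impl:
  assumes "truthful \<phi>" "truthful \<psi>" "certifiable \<phi>" "certifiable (\<^bold>\<not> \<phi>)"
  shows "truthful (\<phi> \<^bold>\<longrightarrow> \<psi>)"
proof (rule truthfulI)
  fix X e assume e: "e \<in> envs" and X: "forces (\<phi> \<^bold>\<longrightarrow> \<psi>) e X"
  show "dense X (holds (\<phi> \<^bold>\<longrightarrow> \<psi>) e)"
    unfolding dense_def
  proof
    fix Y assume Y: "Y \<in> below X"
    then obtain Z where Z: "Z \<in> below Y" "holds \<phi> e Z \<or> holds (\<^bold>\<not> \<phi>) e Z"
      using decide[OF assms(3,4) below_condition e] by blast
    show "\<exists>W\<in>below Y. holds (\<phi> \<^bold>\<longrightarrow> \<psi>) e W"
    proof (cases "holds \<phi> e Z")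
      case True
      then have "forces \<phi> e Z"
        using truthfulD[OF assms(1) below_condition[OF Z(1)], of e] e holds_dense by blast
      then have "forces \<psi> e Z"
        using X below_trans[OF Z(1) Y] by simp
      then obtain W where "W \<in> below Z" "holds \<psi> e W"
        using truthfulD[OF assms(2) below_condition[OF Z(1)], of e] e
          dense_witness[OF below_condition[OF Z(1)]] by blast
      moreover from this have "holds (\<phi> \<^bold>\<longrightarrow> \<psi>) e W"
        by (auto simp: holds_def always_def)
      ultimately show ?thesis
        using below_trans[OF _ Z(1)] by blast
    next
      case False
      then have "holds (\<phi> \<^bold>\<longrightarrow> \<psi>) e Z"
        using Z(2) by (auto simp: holds_def always_def)
      then show ?thesis
        using Z(1) by blast
    qed
  qed
next
  fix X e assume e: "e \<in> envs" and X: "dense X (holds (\<phi> \<^bold>\<longrightarrow> \<psi>) e)"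
  have "forces \<psi> e Y" if Y: "Y \<in> below X" "forces \<phi> e Y" for Y
  proof -
    have Yc: "condition Y" using Y(1) below_condition by blast
    then have "dense Y (holds \<phi> e)"
      using truthfulD[OF assms(1)] e Y(2) by blast
    with dense_below[OF X Y(1)] have "dense Y (holds (\<phi> \<^bold>\<and> (\<phi> \<^bold>\<longrightarrow> \<psi>)) e)"
      by (simp add: dense_holds_Conj)
    then have "dense Y (holds \<psi> e)"
      by (rule dense_mono) (auto simp: holds_def always_def)
    then show ?thesis
      using truthfulD[OF assms(2) Yc] e by blast
  qed
  then show "forces (\<phi> \<^bold>\<longrightarrow> \<psi>) e X" by simp
qed

lemma truthful_ExLe:
  assumes "truthful \<phi>" "certifiable \<phi>"
  shows "truthful (ExLe t \<phi>)"
proof (rule truthfulI)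
  let ?b = "Var 0 \<^bold>\<le> lift_tm t"
  fix X e assume e: "e \<in> envs" and X: "forces (ExLe t \<phi>) e X"
  show "dense X (holds (ExLe t \<phi>) e)"
    unfolding dense_def
  proof
    fix Y assume "Y \<in> below X"
    then obtain Z a where Z: "Z \<in> below Y" and a: "a \<in> elements"
      "dense Z (holds ?b (case_nat a e))" "forces \<phi> (case_nat a e) Z"
      using X by (auto simp: ExLe_def dense_def)
    have "dense Z (holds \<phi> (case_nat a e))"
      using truthfulD[OF assms(1) below_condition[OF Z], of "case_nat a e"] a
        case_nat_elements[OF a(1) e] by blast
    with a(2) have "dense Z (holds (?b \<^bold>\<and> \<phi>) (case_nat a e))"
      by (simp add: dense_holds_Conj)
    then obtain W where "W \<in> below Z" "holds (?b \<^bold>\<and> \<phi>) (case_nat a e) W"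
      using dense_witness[OF below_condition[OF Z]] by blast
    then have "W \<in> below Y" "holds (ExLe t \<phi>) e W"
      using below_trans[OF _ Z] by (auto simp: holds_def always_def sat_ExLe)
    then show "\<exists>W\<in>below Y. holds (ExLe t \<phi>) e W" by blast
  qed
next
  let ?b = "Var 0 \<^bold>\<le> lift_tm t"
  fix X e assume e: "e \<in> envs" and X: "dense X (holds (ExLe t \<phi>) e)"
  have "\<exists>W\<in>below Y. \<exists>a\<in>elements. forces ?b (case_nat a e) W \<and> forces \<phi> (case_nat a e) W"
    if Y: "Y \<in> below X" for Y
  proof -
    obtain Z where Z: "Z \<in> below Y" "holds (ExLe t \<phi>) e Z"
      using denseD[OF X Y] by blast
    \<comment> \<open>The bound is imposed at discarded indices too, so that the chosen sequence is
      an element.\<close>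
    have "\<exists>x\<le>tval (slice e m) t. Z m \<noteq> {} \<longrightarrow> (\<exists>R\<in>Z m. sat R (case_nat x (slice e m)) \<phi>)" for m
    proof (cases "Z m = {}")
      case False
      then obtain R where R: "R \<in> Z m" by blast
      then have "sat R (slice e m) (ExLe t \<phi>)"
        using Z(2) by (simp add: holds_def always_def)
      then show ?thesis using R by (auto simp: sat_ExLe)
    qed auto
    then obtain a where a: "\<And>m. a m \<le> tval (slice e m) t"
      "\<And>m. Z m \<noteq> {} \<Longrightarrow> \<exists>R\<in>Z m. sat R (case_nat (a m) (slice e m)) \<phi>"
      by metis
    have ae: "a \<in> elements"
      by (rule elements_le[OF tval_elements[OF e] a(1)])
    have "\<exists>W\<in>below Z. always W (\<lambda>m R. sat R (case_nat (a m) (slice e m)) \<phi>)"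
      by (rule refine[OF below_condition[OF Z(1)] certified_sat_case_nat[OF assms(2) e ae]],
          rule infinite_super[OF _ condition_infinite[OF below_condition[OF Z(1)]]])
        (use a(2) in blast)
    then obtain W where W: "W \<in> below Z" "holds \<phi> (case_nat a e) W"
      by (auto simp: holds_def)
    have "holds ?b (case_nat a e) W"
      using a(1) by (simp add: holds_def always_def)
    then have "forces ?b (case_nat a e) W"
      by (simp add: holds_dense)
    moreover have "forces \<phi> (case_nat a e) W"
      using truthfulD[OF assms(1) below_condition[OF W(1)], of "case_nat a e"]
        case_nat_elements[OF ae e] holds_dense[OF W(2)] by blast
    ultimately show ?thesis
      using ae W(1) Z(1) below_trans by blast
  qed
  then show "forces (ExLe t \<phi>) e X"
    by (simp add: ExLe_def dense_def)
qed

text \<open>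
  Induction along a chain of length b m: since each X m is a set of total orders of a finite set,
  there is a largest x m such that P m (x m) holds in some member of X m. If x m were smaller
  than b m, the step could be applied below a condition that makes P m (x m) true.
\<close>

lemma refine_induct:
  assumes X: "condition X"
    and start: "\<And>m. X m \<noteq> {} \<Longrightarrow> \<exists>R\<in>X m. P m 0 R"
    and cert: "\<And>x. (\<And>m. x m \<le> b m) \<Longrightarrow> certified (\<lambda>m. P m (x m))"
    and step: "\<And>Y x. \<lbrakk>Y \<in> below X; \<And>m. x m \<le> b m; \<And>m. Y m \<noteq> {} \<Longrightarrow> x m < b m;
        always Y (\<lambda>m. P m (x m))\<rbrakk> \<Longrightarrow> \<exists>Z\<in>below Y. always Z (\<lambda>m. P m (Suc (x m)))"
  shows "\<exists>Y\<in>below X. always Y (\<lambda>m. P m (b m))"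
proof -
  have "\<exists>x\<le>b m. X m \<noteq> {} \<longrightarrow> (\<exists>R\<in>X m. P m x R) \<and> (\<forall>y\<le>b m. (\<exists>R\<in>X m. P m y R) \<longrightarrow> y \<le> x)" for m
  proof (cases "X m = {}")
    case False
    let ?A = "{x. x \<le> b m \<and> (\<exists>R\<in>X m. P m x R)}"
    have "0 \<in> ?A" using start[OF False] by simp
    then have "Max ?A \<in> ?A" by (intro Max_in) auto
    then show ?thesis by (intro exI[of _ "Max ?A"]) (auto intro!: Max_ge)
  qed auto
  then obtain x where x: "\<And>m. x m \<le> b m" "\<And>m. X m \<noteq> {} \<Longrightarrow> \<exists>R\<in>X m. P m (x m) R"
    "\<And>m y R. y \<le> b m \<Longrightarrow> R \<in> X m \<Longrightarrow> P m y R \<Longrightarrow> y \<le> x m"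
    by (metis emptyE)
  have "infinite {m. \<exists>R\<in>X m. P m (x m) R}"
    by (rule infinite_super[OF _ condition_infinite[OF X]]) (use x(2) in blast)
  then obtain Y where Y: "Y \<in> below X" "always Y (\<lambda>m. P m (x m))"
    using refine[OF X cert[OF x(1)]] by blast
  have Yc: "condition Y" using Y(1) below_condition by blast
  show ?thesis
  proof (cases "infinite {m. Y m \<noteq> {} \<and> x m = b m}")
    case True
    then obtain Z where Z: "Z \<in> below Y" "\<And>m. Z m \<noteq> {} \<Longrightarrow> x m = b m"
      using refine_indices[OF Yc, of "\<lambda>m. x m = b m"] by blast
    then have "always Z (\<lambda>m. P m (b m))"
      using always_below[OF Y(2) Z(1)] unfolding always_def by (metis emptyE)
    then show ?thesis using Z(1) Y(1) below_trans by blast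
  next
    case False
    have "{m. Y m \<noteq> {}} \<subseteq> {m. Y m \<noteq> {} \<and> x m = b m} \<union> {m. Y m \<noteq> {} \<and> x m < b m}"
      using x(1) by (auto simp: le_less)
    then have "infinite {m. Y m \<noteq> {} \<and> x m < b m}"
      using False condition_infinite[OF Yc] finite_subset by blast
    then obtain Z where Z: "Z \<in> below Y" "\<And>m. Z m \<noteq> {} \<Longrightarrow> x m < b m"
      using refine_indices[OF Yc, of "\<lambda>m. x m < b m"] by blast
    then obtain W where W: "W \<in> below Z" "always W (\<lambda>m. P m (Suc (x m)))"
      using step[OF below_trans[OF Z(1) Y(1)] x(1) Z(2) always_below[OF Y(2) Z(1)]] by blast
    obtain m R where R: "R \<in> W m"
      using condition_nonempty[OF below_condition[OF W(1)]] by blast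
    have "R \<in> X m" using R W(1) Z(1) Y(1) below_subset by blast
    moreover have "x m < b m" using R Z(2) below_nonempty[OF W(1)] by blast
    moreover have "P m (Suc (x m)) R" using W(2) R by (simp add: always_def)
    ultimately show ?thesis using x(3)[of "Suc (x m)" m R] by simp
  qed
qed

text \<open>Provides the certificates that \<open>refine_induct\<close> asks for in
  \<open>truthful_AllLe_Len\<close>: polynomially many instances are certified by the union of their
  certificates.\<close>

lemma certified_initial_segment:
  assumes "certifiable \<phi>" "e \<in> envs" "\<And>m. x m \<le> Suc (blen (tval (slice e m) t))"
  shows "certified (\<lambda>m R. \<forall>y<x m. sat R (case_nat y (slice e m)) \<phi>)"
proof -
  obtain c where c: "\<And>m. blen (tval (slice e m) t) \<le> (m + 2) ^ c"
    using tval_elements[OF assms(2), of t] unfolding elements_def by blast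
  \<comment> \<open>The zero sequence is a placeholder that shifts the environment: variable 0 is
    taken out of the set, and its values y are bounded separately through c.\<close>
  have "case_nat (\<lambda>m. 0) e i \<in> elements" if "i \<in> fv \<phi> - {0}" for i
    using that assms(2) by (auto simp: envs_def split: nat.split)
  then obtain j where "\<forall>m. \<forall>i\<in>fv \<phi> - {0}. blen (case_nat (\<lambda>m. 0) e i m) \<le> (m + 2) ^ j"
    using elements_bounded[of "fv \<phi> - {0}" "case_nat (\<lambda>m. 0) e"] by auto
  then have "\<And>m i. i \<in> fv \<phi> - {0} \<Longrightarrow> blen (case_nat (\<lambda>m. 0) e i m) \<le> (m + 2) ^ j"
    by blast
  then have j: "blen (slice e m i) \<le> (m + 2) ^ j" if "Suc i \<in> fv \<phi>" for m i
    using that by (fastforce simp: slice_apply)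
  obtain k where k: "\<And>m e R. \<lbrakk>\<forall>i\<in>fv \<phi>. blen (e i) \<le> (m + 2) ^ (c + j); sat R e \<phi>\<rbrakk> \<Longrightarrow>
    \<exists>D. finite D \<and> card D \<le> (m + 2) ^ k \<and> (\<forall>R'. agree D R R' \<longrightarrow> sat R' e \<phi>)"
    using certifiable_uniform[OF assms(1), of "c + j"] by blast
  have *: "\<exists>D. finite D \<and> card D \<le> (m + 2) ^ (Suc c + k) \<and>
      (\<forall>R'. agree D R R' \<longrightarrow> (\<forall>y<x m. sat R' (case_nat y (slice e m)) \<phi>))"
    if R: "\<forall>y<x m. sat R (case_nat y (slice e m)) \<phi>" for m R
  proof -
    have le: "(m + 2) ^ c \<le> (m + 2) ^ (c + j)" "(m + 2) ^ j \<le> (m + 2) ^ (c + j)"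
      by (auto intro: power_increasing)
    have "\<exists>D. finite D \<and> card D \<le> (m + 2) ^ k \<and>
        (\<forall>R'. agree D R R' \<longrightarrow> sat R' (case_nat y (slice e m)) \<phi>)" if y: "y < x m" for y
    proof (rule k)
      show "sat R (case_nat y (slice e m)) \<phi>" using R y by blast
      have "blen y \<le> (m + 2) ^ (c + j)"
        using y assms(3)[of m] c[of m] le(1) blen_le[of y] by linarith
      then show "\<forall>i\<in>fv \<phi>. blen (case_nat y (slice e m) i) \<le> (m + 2) ^ (c + j)"
        using j[of _ m] le(2) by (intro blen_case_nat_le)
    qed
    then have D: "\<exists>D. finite D \<and> card D \<le> x m * (m + 2) ^ k \<and>
        (\<forall>R'. agree D R R' \<longrightarrow> (\<forall>y<x m. sat R' (case_nat y (slice e m)) \<phi>))"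
      by (rule certificates_union)
    have "1 \<le> (m + 2) ^ c" by simp
    then have "x m \<le> (m + 2) ^ c * 2"
      using assms(3)[of m] c[of m] by linarith
    also have "\<dots> \<le> (m + 2) ^ c * (m + 2)" by (rule mult_le_mono2) simp
    finally have "x m * (m + 2) ^ k \<le> (m + 2) ^ (Suc c + k)"
      unfolding power_add power_Suc2 by (rule mult_le_mono1)
    with D show ?thesis by (meson order_trans)
  qed
  show ?thesis
    unfolding certified_def
  proof (rule exI[of _ "Suc c + k"], intro allI ballI impI)
    fix m R assume "\<forall>y<x m. sat R (case_nat y (slice e m)) \<phi>"
    from *[OF this] show "\<exists>D. finite D \<and> card D \<le> (m + 2) ^ (Suc c + k) \<and>
        (\<forall>R'\<in>linear_orders m. agree D R R' \<longrightarrow> (\<forall>y<x m. sat R' (case_nat y (slice e m)) \<phi>))"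
      by (elim exE conjE) (intro exI conjI ballI impI, assumption+, drule spec, erule mp)
  qed
qed

text \<open>Forcing makes one instance after another true, but their number grows with m, so
  finitely many refinements do not reach all of them. \<open>refine_induct\<close> on the length of
  a true initial segment does.\<close>

lemma truthful_AllLe_Len:
  assumes "truthful \<phi>" "certifiable \<phi>"
  shows "truthful (AllLe (Len t) \<phi>)"
proof (rule truthfulI)
  let ?b = "Var 0 \<^bold>\<le> lift_tm (Len t)"
  fix X e assume e: "e \<in> envs" and X: "forces (AllLe (Len t) \<phi>) e X"
  define b where "b m = blen (tval (slice e m) t)" for m
  have "\<exists>Z\<in>below Y. holds (AllLe (Len t) \<phi>) e Z" if Y: "Y \<in> below X" for Y
  proof -
    have "\<exists>Z\<in>below Y. always Z (\<lambda>m R. \<forall>y<Suc (b m). sat R (case_nat y (slice e m)) \<phi>)"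
    proof (rule refine_induct[where P = "\<lambda>m x R. \<forall>y<x. sat R (case_nat y (slice e m)) \<phi>"])
      show "condition Y" by (rule below_condition[OF Y])
      show "\<exists>R\<in>Y m. \<forall>y<0. sat R (case_nat y (slice e m)) \<phi>" if "Y m \<noteq> {}" for m
        using that by auto
      show "certified (\<lambda>m R. \<forall>y<x m. sat R (case_nat y (slice e m)) \<phi>)"
        if "\<And>m. x m \<le> Suc (b m)" for x
        by (rule certified_initial_segment[OF assms(2) e that[unfolded b_def]])
    next
      fix Z x assume Z: "Z \<in> below Y" "\<And>m. Z m \<noteq> {} \<Longrightarrow> x m < Suc (b m)"
        "always Z (\<lambda>m R. \<forall>y<x m. sat R (case_nat y (slice e m)) \<phi>)"
      \<comment> \<open>The minimum respects the quantifier bound also at discarded indices; at the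
        surviving ones it is x m.\<close>
      define a where "a m = min (x m) (b m)" for m
      have ae: "a \<in> elements"
        using tval_elements[of e "Len t", OF e] by (rule elements_le) (simp add: a_def b_def)
      have "holds ?b (case_nat a e) Z"
        by (simp add: holds_def always_def a_def b_def)
      then have "forces ?b (case_nat a e) Z"
        by (simp add: holds_dense)
      then have "forces \<phi> (case_nat a e) Z"
        using X below_trans[OF Z(1) Y] ae by (simp add: AllLe_def)
      then obtain W where W: "W \<in> below Z" "holds \<phi> (case_nat a e) W"
        using truthfulD[OF assms(1) below_condition[OF Z(1)], of "case_nat a e"]
          case_nat_elements[OF ae e] dense_witness[OF below_condition[OF Z(1)]] by blast
      have "always W (\<lambda>m R. \<forall>y<Suc (x m). sat R (case_nat y (slice e m)) \<phi>)"
        unfolding always_def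
      proof (intro allI ballI impI)
        fix m R y assume R: "R \<in> W m" "y < Suc (x m)"
        have "a m = x m"
          using Z(2)[of m] R(1) below_nonempty[OF W(1)] by (fastforce simp: a_def)
        moreover have "sat R (case_nat (a m) (slice e m)) \<phi>"
          using W(2) R(1) by (simp add: holds_def always_def)
        moreover have "\<forall>y<x m. sat R (case_nat y (slice e m)) \<phi>"
          using Z(3) R(1) below_subset[OF W(1)] unfolding always_def by blast
        ultimately show "sat R (case_nat y (slice e m)) \<phi>"
          using R(2) by (cases "y = x m") simp_all
      qed
      then show "\<exists>W\<in>below Z. always W (\<lambda>m R. \<forall>y<Suc (x m). sat R (case_nat y (slice e m)) \<phi>)"
        using W(1) by blast
    qed
    then show ?thesis
      by (simp add: holds_def sat_AllLe b_def less_Suc_eq_le)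
  qed
  then show "dense X (holds (AllLe (Len t) \<phi>) e)" by (simp add: dense_def)
next
  let ?b = "Var 0 \<^bold>\<le> lift_tm (Len t)"
  fix X e assume e: "e \<in> envs" and X: "dense X (holds (AllLe (Len t) \<phi>) e)"
  have "forces \<phi> (case_nat a e) Y"
    if a: "a \<in> elements" "Y \<in> below X" "dense Y (holds ?b (case_nat a e))" for a Y
  proof -
    have "dense Y (\<lambda>Z. always Z (\<lambda>m R. sat R (slice e m) (AllLe (Len t) \<phi>)
        \<and> sat R (slice (case_nat a e) m) ?b))"
      using dense_below[OF X a(2)] a(3) unfolding holds_def[abs_def] by (rule dense_always_conj)
    then have "dense Y (holds \<phi> (case_nat a e))"
      by (rule dense_mono) (auto simp: holds_def always_def sat_AllLe)
    then show ?thesis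
      using truthfulD[OF assms(1) below_condition[OF a(2)], of "case_nat a e"]
        case_nat_elements[OF a(1) e] by blast
  qed
  then show "forces (AllLe (Len t) \<phi>) e X" by (simp add: AllLe_def)
qed

lemma Delta_b_0_truthful: "\<phi> \<in> Delta_b_0 \<Longrightarrow> truthful \<phi>"
proof (induction rule: Delta_b_0.induct)
  case (8 \<phi> t)
  then show ?case by (simp add: truthful_AllLe_Len Delta_b_0_certifiable)
next
  case (9 \<phi> t)
  then show ?case by (simp add: truthful_ExLe Delta_b_0_certifiable)
qed (simp_all add: truthful_def[of "_ \<^bold>= _"] truthful_def[of "_ \<^bold>\<le> _"] truthful_def[of "_ \<^bold>\<lhd> _"]
    truthful_Neg truthful_Conj truthful_Disj truthful_Impl Delta_b_0_certifiable)

lemma Sigma_b_1_truthful: "\<phi> \<in> Sigma_b_1 \<Longrightarrow> truthful \<phi>"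
  by (induction rule: Sigma_b_1.induct)
    (simp_all add: Delta_b_0_truthful truthful_Conj truthful_Disj truthful_AllLe_Len truthful_ExLe
      Sigma_b_1_certifiable)

lemma forces_if_holds:
  assumes "\<phi> \<in> Sigma_b_1" "condition X" "e \<in> envs" "holds \<phi> e X"
  shows "forces \<phi> e X"
  using truthfulD[OF Sigma_b_1_truthful[OF assms(1)] assms(2), of e] assms(3) holds_dense[OF assms(4)]
  by blast

lemma forces_imp_holds:
  assumes "\<phi> \<in> Sigma_b_1" "condition X" "e \<in> envs" "forces \<phi> e X"
  shows "\<exists>Y\<in>below X. holds \<phi> e Y"
  using truthfulD[OF Sigma_b_1_truthful[OF assms(1)] assms(2), of e] assms(3,4)
    dense_witness[OF assms(2)] by blast

section \<open>Induction and BASIC\<close>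

text \<open>Common core of both schemes: s m is a chain that ends in a m after b m steps. Its length
  may be exponential in a polynomial, since selecting a maximal possible position costs the same for
  every length; hence IND is no harder than PIND. The bound by a m makes every selection from the
  chains an element.\<close>

lemma forces_by_induction:
  assumes \<phi>: "\<phi> \<in> Sigma_b_1" and X: "condition X" and e: "e \<in> envs"
    and s: "\<And>m. s m (b m) = a m" "\<And>m x. s m x \<le> a m" and a: "a \<in> elements"
    and start: "forces \<phi> (case_nat (\<lambda>m. s m 0) e) X"
    and step: "\<And>Y c d. \<lbrakk>Y \<in> below X; c \<in> elements; d \<in> elements;
        \<And>m. Y m \<noteq> {} \<Longrightarrow> \<exists>x<b m. c m = s m x \<and> d m = s m (Suc x);
        forces \<phi> (case_nat c e) Y\<rbrakk> \<Longrightarrow> forces \<phi> (case_nat d e) Y"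
  shows "forces \<phi> (case_nat a e) X"
proof (rule forces_dense, unfold dense_def, rule ballI)
  fix Y assume Y: "Y \<in> below X"
  have se: "(\<lambda>m. s m (x m)) \<in> elements" for x
    by (rule elements_le[OF a s(2)])
  obtain Z where Z: "Z \<in> below Y" "holds \<phi> (case_nat (\<lambda>m. s m 0) e) Z"
    using forces_imp_holds[OF \<phi> below_condition[OF Y] case_nat_elements[OF se e]
        forces_below[OF start Y]] by blast
  have "\<exists>W\<in>below Z. always W (\<lambda>m R. sat R (case_nat (s m (b m)) (slice e m)) \<phi>)"
  proof (rule refine_induct[where P = "\<lambda>m x R. sat R (case_nat (s m x) (slice e m)) \<phi>"])
    show "condition Z" by (rule below_condition[OF Z(1)])
    show "\<exists>R\<in>Z m. sat R (case_nat (s m 0) (slice e m)) \<phi>" if "Z m \<noteq> {}" for m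
      using that Z(2) by (auto simp: holds_def always_def)
    show "certified (\<lambda>m R. sat R (case_nat (s m (x m)) (slice e m)) \<phi>)" for x
      by (rule certified_sat_case_nat[OF Sigma_b_1_certifiable[OF \<phi>] e se])
  next
    fix V x assume V: "V \<in> below Z" "\<And>m. V m \<noteq> {} \<Longrightarrow> x m < b m"
      "always V (\<lambda>m R. sat R (case_nat (s m (x m)) (slice e m)) \<phi>)"
    have Vc: "condition V" by (rule below_condition[OF V(1)])
    have VX: "V \<in> below X" using V(1) Z(1) Y below_trans by blast
    have *: "\<exists>y<b m. s m (x m) = s m y \<and> s m (Suc (x m)) = s m (Suc y)" if "V m \<noteq> {}" for m
      using V(2)[OF that] by blast
    have VF: "forces \<phi> (case_nat (\<lambda>m. s m (x m)) e) V"
      by (rule forces_if_holds[OF \<phi> Vc case_nat_elements[OF se e]])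
        (use V(3) in \<open>simp add: holds_def\<close>)
    have "forces \<phi> (case_nat (\<lambda>m. s m (Suc (x m))) e) V"
      by (rule step[OF VX se se _ VF]) (rule *)
    from forces_imp_holds[OF \<phi> Vc case_nat_elements[OF se e] this]
    show "\<exists>W\<in>below V. always W (\<lambda>m R. sat R (case_nat (s m (Suc (x m))) (slice e m)) \<phi>)"
      by (simp add: holds_def)
  qed
  then obtain W where W: "W \<in> below Z" "holds \<phi> (case_nat a e) W"
    by (auto simp: holds_def s(1))
  have "forces \<phi> (case_nat a e) W"
    by (rule forces_if_holds[OF \<phi> below_condition[OF W(1)] case_nat_elements[OF a e] W(2)])
  then show "\<exists>Z\<in>below Y. forces \<phi> (case_nat a e) Z"
    using below_trans[OF W(1) Z(1)] by blast
qed

lemma subst_env_upd0: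
  "subst_env (Var(0 := t)) (case_nat a e) = case_nat (\<lambda>m. tval (case_nat (a m) (slice e m)) t) e"
  by (intro ext) (auto simp: subst_env_def slice_apply split: nat.split)

lemma forces_IND:
  assumes \<phi>: "\<phi> \<in> Sigma_b_1" and X: "condition X" and "e \<in> envs"
  shows "forces (IND \<phi>) e X"
  unfolding IND_def
proof (rule forces_closure[OF _ assms(3)])
  fix e :: "nat \<Rightarrow> nat \<Rightarrow> nat" assume e: "e \<in> envs"
  have "forces \<phi> (case_nat a e) Y"
    if Y: "Y \<in> below X" and a: "a \<in> elements" and zero: "forces \<phi> (case_nat (\<lambda>m. 0) e) Y"
      and suc: "\<And>c Z. \<lbrakk>c \<in> elements; Z \<in> below Y; forces \<phi> (case_nat c e) Z\<rbrakk> \<Longrightarrow>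
        forces \<phi> (case_nat (\<lambda>m. Suc (c m)) e) Z" for Y a
  \<comment> \<open>The chain counts up to a m and then stays there, so that it is bounded for every
    x.\<close>
  proof (rule forces_by_induction[OF \<phi> below_condition[OF Y] e,
        where s = "\<lambda>m x. min x (a m)" and b = a])
    fix Z c d
    assume Z: "Z \<in> below Y" "c \<in> elements" "d \<in> elements"
      "\<And>m. Z m \<noteq> {} \<Longrightarrow> \<exists>x<a m. c m = min x (a m) \<and> d m = min (Suc x) (a m)"
      "forces \<phi> (case_nat c e) Z"
    have "forces \<phi> (case_nat (\<lambda>m. Suc (c m)) e) Z \<longleftrightarrow> forces \<phi> (case_nat d e) Z"
      by (rule forces_env_cong) (use Z(4) in \<open>fastforce\<close>)
    then show "forces \<phi> (case_nat d e) Z" using suc[OF Z(2,1,5)] by blast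
  qed (use a zero in simp_all)
  then show "forces (inst \<^bold>0 \<phi> \<^bold>\<and> Forall (\<phi> \<^bold>\<longrightarrow> subst (Var(0 := Var 0 \<^bold>+ \<^bold>1)) \<phi>) \<^bold>\<longrightarrow> Forall \<phi>) e X"
    by (simp add: forces_inst forces_subst subst_env_upd0)
qed

lemma forces_PIND:
  assumes \<phi>: "\<phi> \<in> Sigma_b_1" and X: "condition X" and "e \<in> envs"
  shows "forces (PIND \<phi>) e X"
  unfolding PIND_def
proof (rule forces_closure[OF _ assms(3)])
  fix e :: "nat \<Rightarrow> nat \<Rightarrow> nat" assume e: "e \<in> envs"
  have "forces \<phi> (case_nat a e) Y"
    if Y: "Y \<in> below X" and a: "a \<in> elements" and zero: "forces \<phi> (case_nat (\<lambda>m. 0) e) Y"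
      and half: "\<And>c Z. \<lbrakk>c \<in> elements; Z \<in> below Y; forces \<phi> (case_nat (\<lambda>m. c m div 2) e) Z\<rbrakk> \<Longrightarrow>
        forces \<phi> (case_nat c e) Z" for Y a
  \<comment> \<open>The chain consists of the binary prefixes of a m: at position x all but the x
    leading bits are cut off, and each prefix is half of the next, rounded down.\<close>
  proof (rule forces_by_induction[OF \<phi> below_condition[OF Y] e,
        where s = "\<lambda>m x. a m div 2 ^ (blen (a m) - x)" and b = "\<lambda>m. blen (a m)"])
    fix Z c d
    assume Z: "Z \<in> below Y" "c \<in> elements" "d \<in> elements"
      "\<And>m. Z m \<noteq> {} \<Longrightarrow> \<exists>x<blen (a m). c m = a m div 2 ^ (blen (a m) - x) \<and>
        d m = a m div 2 ^ (blen (a m) - Suc x)"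
      "forces \<phi> (case_nat c e) Z"
    have "d m div 2 = c m" if m: "Z m \<noteq> {}" for m
    proof -
      obtain x where x: "x < blen (a m)" "c m = a m div 2 ^ (blen (a m) - x)"
        "d m = a m div 2 ^ (blen (a m) - Suc x)"
        using Z(4)[OF m] by blast
      have *: "blen (a m) - x = Suc (blen (a m) - Suc x)" using x(1) by simp
      show ?thesis unfolding x(2,3) * power_Suc2 div_mult2_eq ..
    qed
    then have "forces \<phi> (case_nat (\<lambda>m. d m div 2) e) Z \<longleftrightarrow> forces \<phi> (case_nat c e) Z"
      by (intro forces_env_cong) simp
    then show "forces \<phi> (case_nat d e) Z" using half[OF Z(3,1)] Z(5) by blast
  qed (use a zero in \<open>simp_all add: less_exp_blen\<close>)
  then show "forces (inst \<^bold>0 \<phi> \<^bold>\<and> Forall (subst (Var(0 := Half (Var 0))) \<phi> \<^bold>\<longrightarrow> \<phi>) \<^bold>\<longrightarrow> Forall \<phi>) e X"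
    by (simp add: forces_inst forces_subst subst_env_upd0)
qed

lemma forces_valid:
  assumes "\<phi> \<in> Delta_b_0" "\<And>R e. sat R e \<phi>" "condition X" "e \<in> envs"
  shows "forces \<phi> e X"
  by (rule forces_if_holds[OF Sigma_b_1.intros(1)[OF assms(1)] assms(3,4)])
    (simp add: holds_def always_def assms(2))

lemma blen_double: "0 < x \<Longrightarrow> blen (x + x) = Suc (blen x)"
  by (simp add: blen_half[of "2 * x"] flip: mult_2)

lemma blen_Suc_double: "blen (Suc (x + x)) = Suc (blen x)"
  by (simp add: blen_half[of "Suc (2 * x)"] flip: mult_2)

lemma forces_BASIC:
  assumes "\<beta> \<in> BASIC" "condition X" "e \<in> envs"
  shows "forces \<beta> e X"
proof -
  define valid where "valid \<phi> \<longleftrightarrow> \<phi> \<in> Delta_b_0 \<and> (\<forall>R e. sat R e \<phi>)" for \<phi>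
  have *: "forces \<beta> e X" if "\<forall>\<phi>\<in>S. valid \<phi>" "\<beta> \<in> closure ` S" for S
    using that(2)
  proof
    fix \<phi> assume "\<beta> = closure \<phi>" "\<phi> \<in> S"
    then show ?thesis
      using that(1) forces_closure[OF forces_valid[OF _ _ assms(2)] assms(3), of \<phi>]
      by (simp add: valid_def)
  qed
  show ?thesis
  proof (rule *[OF _ assms(1)[unfolded BASIC_def Let_def]], unfold ball_simps,
      intro conjI TrueI, unfold valid_def)
  qed (simp_all add: Delta_b_0.intros linorder_linear blen_double blen_Suc_double blen_mono
      power_add add_mult_distrib add_mult_distrib2, auto intro: blen_half)
qed

section \<open>The pigeonhole principle\<close>

text \<open>
  E - D measures how much of a certificate is still undetermined. If two different values y1, y2
  are possible given R on D, put certificates for both into D. By uniqueness of values, a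
  certificate for a value other than yi is incompatible with the one for yi, so by
  amalgamation the two share a point outside D; hence every remaining certificate gets shorter.
\<close>

lemma decision_tree:
  assumes R: "R \<in> linear_orders m"
    and uniq: "\<And>S y y'. \<lbrakk>S \<in> linear_orders m; agree D0 R S; \<Phi> y S; \<Phi> y' S\<rbrakk> \<Longrightarrow> y = y'"
    and "finite D" "D0 \<subseteq> D"
    and "\<And>S y. \<lbrakk>S \<in> linear_orders m; agree D R S; \<Phi> y S\<rbrakk> \<Longrightarrow>
      \<exists>E. finite E \<and> card (E - D) \<le> j \<and> (\<forall>S'\<in>linear_orders m. agree E S S' \<longrightarrow> \<Phi> y S')"
  shows "\<exists>D' z. finite D' \<and> D \<subseteq> D' \<and> card D' \<le> card D + j * Suc j \<and>
    (\<forall>S y. S \<in> linear_orders m \<longrightarrow> agree D' R S \<longrightarrow> \<Phi> y S \<longrightarrow> y = z)"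
  using assms(3-5)
proof (induction j arbitrary: D)
  case (0 D)
  have *: "\<Phi> y R" if "S \<in> linear_orders m" "agree D R S" "\<Phi> y S" for S y
  proof -
    obtain E where E: "finite E" "card (E - D) \<le> 0"
      "\<forall>S'\<in>linear_orders m. agree E S S' \<longrightarrow> \<Phi> y S'"
      using "0.prems"(3)[OF \<open>S \<in> linear_orders m\<close> \<open>agree D R S\<close> \<open>\<Phi> y S\<close>] by blast
    then have "E \<subseteq> D" by simp
    then have "agree E S R" using \<open>agree D R S\<close> agree_subset agree_sym by blast
    then show ?thesis using E(3) R by blast
  qed
  \<comment> \<open>By \<open>*\<close> every possible value is already taken in R; if R gives no
    value, then none is possible and any z will do.\<close>
  have "\<exists>z. \<forall>S y. S \<in> linear_orders m \<longrightarrow> agree D R S \<longrightarrow> \<Phi> y S \<longrightarrow> y = z"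
    using * uniq[OF R agree_refl] by (cases "\<exists>z. \<Phi> z R") blast+
  then show ?case using "0.prems"(1) by auto
next
  case (Suc j D)
  show ?case
  proof (cases "\<exists>z. \<forall>S y. S \<in> linear_orders m \<longrightarrow> agree D R S \<longrightarrow> \<Phi> y S \<longrightarrow> y = z")
    case True
    then obtain z where "\<forall>S y. S \<in> linear_orders m \<longrightarrow> agree D R S \<longrightarrow> \<Phi> y S \<longrightarrow> y = z" by blast
    then show ?thesis using Suc.prems(1) by (intro exI[of _ D] exI[of _ z]) simp
  next
    case False
    then obtain S1 y1 where S1: "S1 \<in> linear_orders m" "agree D R S1" "\<Phi> y1 S1" by metis
    obtain S2 y2 where S2: "S2 \<in> linear_orders m" "agree D R S2" "\<Phi> y2 S2" "y2 \<noteq> y1"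
      using False by metis
    obtain E1 where E1: "finite E1" "card (E1 - D) \<le> Suc j"
      "\<forall>S'\<in>linear_orders m. agree E1 S1 S' \<longrightarrow> \<Phi> y1 S'"
      using Suc.prems(3)[OF S1] by blast
    obtain E2 where E2: "finite E2" "card (E2 - D) \<le> Suc j"
      "\<forall>S'\<in>linear_orders m. agree E2 S2 S' \<longrightarrow> \<Phi> y2 S'"
      using Suc.prems(3)[OF S2(1-3)] by blast
    have meet: "(E - D) \<inter> (E' - D) \<noteq> {}"
      if S: "S \<in> linear_orders m" "agree D R S" and E: "\<forall>T\<in>linear_orders m. agree E S T \<longrightarrow> \<Phi> y T"
        and S': "S' \<in> linear_orders m" "agree D R S'"
        and E': "\<forall>T\<in>linear_orders m. agree E' S' T \<longrightarrow> \<Phi> y' T"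
        and "y \<noteq> y'" for S S' E E' y y'
    proof
      assume "(E - D) \<inter> (E' - D) = {}"
      \<comment> \<open>Once D is added to both certificates, they overlap exactly in D, where S and
        S' both agree with R.\<close>
      then have "(E \<union> D) \<inter> (E' \<union> D) = D" by blast
      moreover have "agree D S S'" using S(2) S'(2) agree_trans agree_sym by blast
      ultimately obtain T where T: "T \<in> linear_orders m" "agree (E \<union> D) S T" "agree (E' \<union> D) S' T"
        using linear_orders_amalgamate[OF S(1) S'(1), of "E \<union> D" "E' \<union> D"] by metis
      have "\<Phi> y T" using E T(1) agree_subset[OF T(2)] by blast
      moreover have "\<Phi> y' T" using E' T(1) agree_subset[OF T(3)] by blast
      moreover have "agree D0 R T"
        using agree_trans[OF S(2) agree_subset[OF T(2)]] agree_subset[OF _ Suc.prems(2)] by blast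
      ultimately show False using uniq[OF T(1)] \<open>y \<noteq> y'\<close> by blast
    qed
    let ?D = "D \<union> (E1 - D) \<union> (E2 - D)"
    have step: "\<exists>E. finite E \<and> card (E - ?D) \<le> j \<and>
        (\<forall>S'\<in>linear_orders m. agree E S S' \<longrightarrow> \<Phi> y S')"
      if S: "S \<in> linear_orders m" "agree ?D R S" "\<Phi> y S" for S y
    proof -
      have SD: "agree D R S" using agree_subset[OF S(2)] by blast
      obtain E where E: "finite E" "card (E - D) \<le> Suc j"
        "\<forall>S'\<in>linear_orders m. agree E S S' \<longrightarrow> \<Phi> y S'"
        using Suc.prems(3)[OF S(1) SD S(3)] by blast
      \<comment> \<open>The value y differs from y1 or from y2, so E meets at least one of the two
        added sets.\<close>
      have "(E - D) \<inter> (E1 - D) \<noteq> {} \<or> (E - D) \<inter> (E2 - D) \<noteq> {}"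
        using meet[OF S(1) SD E(3) S1(1,2) E1(3)] meet[OF S(1) SD E(3) S2(1,2) E2(3)] S2(4) by blast
      then have "E - ?D \<subset> E - D" by blast
      then have "card (E - ?D) < card (E - D)"
        using E(1) by (intro psubset_card_mono) auto
      then show ?thesis using E by (intro exI[of _ E]) simp
    qed
    obtain D' z where D': "finite D'" "?D \<subseteq> D'" "card D' \<le> card ?D + j * Suc j"
      "\<forall>S y. S \<in> linear_orders m \<longrightarrow> agree D' R S \<longrightarrow> \<Phi> y S \<longrightarrow> y = z"
      using Suc.IH[of ?D, OF _ _ step] Suc.prems(1,2) E1(1) E2(1) by blast
    have "card ?D \<le> card D + card (E1 - D) + card (E2 - D)"
      using card_Un_le[of "D \<union> (E1 - D)" "E2 - D"] card_Un_le[of D "E1 - D"] by linarith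
    \<comment> \<open>Two certificates of at most i new points at level i: the numbers 2 * i for i
      up to \<open>Suc j\<close> add up to the stated product.\<close>
    then have "card D' \<le> card D + Suc j * Suc (Suc j)"
      using D'(3) E1(2) E2(2) by simp
    then show ?thesis using D' by blast
  qed
qed

lemma certifiedI:
  assumes "\<And>m R. R \<in> linear_orders m \<Longrightarrow> P m R \<Longrightarrow>
    \<exists>D. finite D \<and> card D \<le> (m + 2) ^ k \<and> (\<forall>R'\<in>linear_orders m. agree D R R' \<longrightarrow> P m R')"
  shows "certified P"
  using assms unfolding certified_def by blast

lemma certified_conj:
  assumes "certified P" "certified Q"
  shows "certified (\<lambda>m R. P m R \<and> Q m R)"
proof -
  obtain j where j: "\<And>m R. R \<in> linear_orders m \<Longrightarrow> P m R \<Longrightarrow>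
      \<exists>D. finite D \<and> card D \<le> (m + 2) ^ j \<and> (\<forall>R'\<in>linear_orders m. agree D R R' \<longrightarrow> P m R')"
    using assms(1) unfolding certified_def by blast
  obtain k where k: "\<And>m R. R \<in> linear_orders m \<Longrightarrow> Q m R \<Longrightarrow>
      \<exists>D. finite D \<and> card D \<le> (m + 2) ^ k \<and> (\<forall>R'\<in>linear_orders m. agree D R R' \<longrightarrow> Q m R')"
    using assms(2) unfolding certified_def by blast
  show ?thesis
  proof (rule certifiedI[where k = "Suc (j + k)"])
    fix m R assume R: "R \<in> linear_orders m" "P m R \<and> Q m R"
    obtain D where D: "finite D" "card D \<le> (m + 2) ^ j"
      "\<forall>R'\<in>linear_orders m. agree D R R' \<longrightarrow> P m R'"
      using j R by blast
    obtain E where E: "finite E" "card E \<le> (m + 2) ^ k"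
      "\<forall>R'\<in>linear_orders m. agree E R R' \<longrightarrow> Q m R'"
      using k R by blast
    have "\<forall>R'\<in>linear_orders m. agree (D \<union> E) R R' \<longrightarrow> P m R' \<and> Q m R'"
      using D(3) E(3) agree_subset[of "D \<union> E" R] by blast
    then show "\<exists>D. finite D \<and> card D \<le> (m + 2) ^ Suc (j + k) \<and>
        (\<forall>R'\<in>linear_orders m. agree D R R' \<longrightarrow> P m R' \<and> Q m R')"
      using D E card_Un_poly[OF D(2) E(2)] by (intro exI[of _ "D \<union> E"]) simp
  qed
qed

text \<open>
  The pigeonhole principle is applied at a single index m, to the values that the decision trees
  of all x < u m take in one and the same total order R m.
\<close>

lemma pigeonhole_forcing:
  fixes Q :: "nat \<Rightarrow> nat \<Rightarrow> nat \<Rightarrow> nat rel \<Rightarrow> bool"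
  assumes X: "condition X"
    and uv: "\<And>m. X m \<noteq> {} \<Longrightarrow> v m < u m"
    and cert: "\<And>m x y R. \<lbrakk>x < u m; y < v m; Q m x y R\<rbrakk> \<Longrightarrow>
      \<exists>D. finite D \<and> card D \<le> (m + 2) ^ k \<and> (\<forall>R'. agree D R R' \<longrightarrow> Q m x y R')"
    and total: "\<And>Y x. \<lbrakk>Y \<in> below X; \<And>m. x m \<le> u m; \<And>m. Y m \<noteq> {} \<Longrightarrow> x m < u m\<rbrakk> \<Longrightarrow>
      \<exists>Z\<in>below Y. \<exists>y. always Z (\<lambda>m R. y m < v m \<and> Q m (x m) (y m) R)"
    and inj: "\<And>Y x x' y. \<lbrakk>Y \<in> below X; \<And>m. x m \<le> u m; \<And>m. x' m \<le> u m; \<And>m. y m \<le> v m;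
        always Y (\<lambda>m R. x m < u m \<and> x' m < u m \<and> y m < v m \<and> x m \<noteq> x' m \<and>
          Q m (x m) (y m) R \<and> Q m (x' m) (y m) R)\<rbrakk> \<Longrightarrow> False"
    and func: "\<And>Y x y y'. \<lbrakk>Y \<in> below X; \<And>m. x m \<le> u m; \<And>m. y m \<le> v m; \<And>m. y' m \<le> v m;
        always Y (\<lambda>m R. x m < u m \<and> y m < v m \<and> y' m < v m \<and> y m \<noteq> y' m \<and>
          Q m (x m) (y m) R \<and> Q m (x m) (y' m) R)\<rbrakk> \<Longrightarrow> False"
  shows False
proof -
  have certQ: "certified (\<lambda>m R. (x m < u m \<and> y m < v m) \<and> Q m (x m) (y m) R)" for x y
  proof (rule certifiedI[where k = k])
    fix m R assume *: "(x m < u m \<and> y m < v m) \<and> Q m (x m) (y m) R"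
    then obtain D where "finite D" "card D \<le> (m + 2) ^ k" "\<forall>R'. agree D R R' \<longrightarrow> Q m (x m) (y m) R'"
      using cert[of "x m" m "y m" R] by auto
    with * show "\<exists>D. finite D \<and> card D \<le> (m + 2) ^ k \<and>
        (\<forall>R'\<in>linear_orders m. agree D R R' \<longrightarrow> (x m < u m \<and> y m < v m) \<and> Q m (x m) (y m) R')"
      by (intro exI[of _ D]) simp
  qed
  define B1 where "B1 m x x' y R \<longleftrightarrow> x < u m \<and> x' < u m \<and> y < v m \<and> x \<noteq> x' \<and>
    Q m x y R \<and> Q m x' y R" for m x x' y R
  define B2 where "B2 m x y y' R \<longleftrightarrow> x < u m \<and> y < v m \<and> y' < v m \<and> y \<noteq> y' \<and>
    Q m x y R \<and> Q m x y' R" for m x y y' R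
  \<comment> \<open>A collision possible at infinitely many indices could be made true throughout a
    stronger condition, against \<open>inj\<close>; likewise a double value against
    \<open>func\<close> in \<open>fin2\<close>.\<close>
  have fin1: "finite {m. \<exists>R\<in>X m. \<exists>x x' y. B1 m x x' y R}"
  proof (rule ccontr)
    assume inf: "infinite {m. \<exists>R\<in>X m. \<exists>x x' y. B1 m x x' y R}"
    \<comment> \<open>Bounds are secured at every index, even where no collision is possible; the
      application derives membership in \<open>elements\<close> from them.\<close>
    have "\<forall>m. \<exists>x x' y. x \<le> u m \<and> x' \<le> u m \<and> y \<le> v m \<and>
        ((\<exists>R\<in>X m. \<exists>x x' y. B1 m x x' y R) \<longrightarrow> (\<exists>R\<in>X m. B1 m x x' y R))"
      unfolding B1_def by (meson le0 less_imp_le)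
    then obtain x x' y where xy: "\<And>m. x m \<le> u m" "\<And>m. x' m \<le> u m" "\<And>m. y m \<le> v m"
      "\<And>m. (\<exists>R\<in>X m. \<exists>x x' y. B1 m x x' y R) \<Longrightarrow> (\<exists>R\<in>X m. B1 m (x m) (x' m) (y m) R)"
      by metis
    have "certified (\<lambda>m R. x m \<noteq> x' m \<and> ((x m < u m \<and> y m < v m) \<and> Q m (x m) (y m) R) \<and>
        ((x' m < u m \<and> y m < v m) \<and> Q m (x' m) (y m) R))"
      by (intro certified_conj certQ) (simp add: certified_absolute)
    then have "certified (\<lambda>m. B1 m (x m) (x' m) (y m))"
      by (rule back_subst[of certified]) (auto simp: B1_def fun_eq_iff)
    moreover have "infinite {m. \<exists>R\<in>X m. B1 m (x m) (x' m) (y m) R}"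
      using inf by (rule infinite_super[rotated]) (use xy(4) in blast)
    ultimately obtain Y where Y: "Y \<in> below X" "always Y (\<lambda>m. B1 m (x m) (x' m) (y m))"
      using refine[OF X] by blast
    show False
      by (rule inj[OF Y(1) xy(1,2,3)]) (use Y(2) in \<open>simp add: B1_def[abs_def]\<close>)
  qed
  have fin2: "finite {m. \<exists>R\<in>X m. \<exists>x y y'. B2 m x y y' R}"
  proof (rule ccontr)
    assume inf: "infinite {m. \<exists>R\<in>X m. \<exists>x y y'. B2 m x y y' R}"
    have "\<forall>m. \<exists>x y y'. x \<le> u m \<and> y \<le> v m \<and> y' \<le> v m \<and>
        ((\<exists>R\<in>X m. \<exists>x y y'. B2 m x y y' R) \<longrightarrow> (\<exists>R\<in>X m. B2 m x y y' R))"
      unfolding B2_def by (meson le0 less_imp_le)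
    then obtain x y y' where xy: "\<And>m. x m \<le> u m" "\<And>m. y m \<le> v m" "\<And>m. y' m \<le> v m"
      "\<And>m. (\<exists>R\<in>X m. \<exists>x y y'. B2 m x y y' R) \<Longrightarrow> (\<exists>R\<in>X m. B2 m (x m) (y m) (y' m) R)"
      by metis
    have "certified (\<lambda>m R. y m \<noteq> y' m \<and> ((x m < u m \<and> y m < v m) \<and> Q m (x m) (y m) R) \<and>
        ((x m < u m \<and> y' m < v m) \<and> Q m (x m) (y' m) R))"
      by (intro certified_conj certQ) (simp add: certified_absolute)
    then have "certified (\<lambda>m. B2 m (x m) (y m) (y' m))"
      by (rule back_subst[of certified]) (auto simp: B2_def fun_eq_iff)
    moreover have "infinite {m. \<exists>R\<in>X m. B2 m (x m) (y m) (y' m) R}"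
      using inf by (rule infinite_super[rotated]) (use xy(4) in blast)
    ultimately obtain Y where Y: "Y \<in> below X" "always Y (\<lambda>m. B2 m (x m) (y m) (y' m))"
      using refine[OF X] by blast
    show False
      by (rule func[OF Y(1) xy(1,2,3)]) (use Y(2) in \<open>simp add: B2_def[abs_def]\<close>)
  qed
  define M where "M = {m. X m \<noteq> {} \<and> \<not> (\<exists>R\<in>X m. \<exists>x x' y. B1 m x x' y R) \<and>
    \<not> (\<exists>R\<in>X m. \<exists>x y y'. B2 m x y y' R)}"
  have sub: "{m. X m \<noteq> {}} \<subseteq> M \<union> ({m. \<exists>R\<in>X m. \<exists>x x' y. B1 m x x' y R} \<union>
      {m. \<exists>R\<in>X m. \<exists>x y y'. B2 m x y y' R})"
    unfolding M_def by blast
  have M: "infinite M"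
    using finite_subset[OF sub finite_UnI[OF _ finite_UnI[OF fin1 fin2]]] condition_infinite[OF X]
    by blast
  obtain j where j: "\<And>m. X m \<noteq> {} \<Longrightarrow> \<exists>D R. finite D \<and> card D \<le> (m + 2) ^ j \<and>
      R \<in> linear_orders m \<and> X m = cylinder m D R"
    using X unfolding condition_def by blast
  \<comment> \<open>j for the domain of X, \<open>Suc (k + k)\<close> for the points queried by a
    decision tree, and one more for adding the two.\<close>
  define K where "K = Suc (j + Suc (k + k))"
  \<comment> \<open>Only the values y and y' remain possible for x and x'. If y is not below v m,
    then x has no possible value at all; otherwise the two values coincide. Totality contradicts the
    former, and together with M also the latter.\<close>
  define F where "F m E R x x' y y' \<longleftrightarrow> finite E \<and> card E \<le> (m + 2) ^ Suc (K + K) \<and>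
      R \<in> linear_orders m \<and> cylinder m E R \<subseteq> X m \<and> x < u m \<and> x' < u m \<and>
      (y < v m \<longrightarrow> x \<noteq> x' \<and> y = y') \<and>
      (\<forall>S\<in>cylinder m E R. \<forall>z<v m. (Q m x z S \<longrightarrow> z = y) \<and> (Q m x' z S \<longrightarrow> z = y'))"
    for m E R x x' y y'
  have "\<exists>E R x x' y y'. F m E R x x' y y'" if "m \<in> M" for m
  proof -
    have m: "X m \<noteq> {}" "\<And>R x x' y. R \<in> X m \<Longrightarrow> \<not> B1 m x x' y R"
      "\<And>R x y y'. R \<in> X m \<Longrightarrow> \<not> B2 m x y y' R"
      using that unfolding M_def by blast+
    obtain D R where D: "finite D" "card D \<le> (m + 2) ^ j" "R \<in> linear_orders m"
      "X m = cylinder m D R"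
      using j[OF m(1)] by (elim exE conjE)
    let ?s = "(m + 2) ^ k"
    have "\<exists>E z. finite E \<and> D \<subseteq> E \<and> card E \<le> (m + 2) ^ K \<and>
        (\<forall>S\<in>cylinder m E R. \<forall>y<v m. Q m x y S \<longrightarrow> y = z)" if x: "x < u m" for x
    proof -
      have "\<exists>E z. finite E \<and> D \<subseteq> E \<and> card E \<le> card D + ?s * Suc ?s \<and>
          (\<forall>S y. S \<in> linear_orders m \<longrightarrow> agree E R S \<longrightarrow> y < v m \<and> Q m x y S \<longrightarrow> y = z)"
      proof (rule decision_tree[where D0 = D, OF D(3) _ D(1) order_refl])
        fix S y y'
        assume S: "S \<in> linear_orders m" "agree D R S" "y < v m \<and> Q m x y S" "y' < v m \<and> Q m x y' S"
        then have "S \<in> X m" using D(4) by (simp add: cylinder_def)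
        then show "y = y'" using m(3)[of S x y y'] S x unfolding B2_def by blast
      next
        fix S y assume S: "S \<in> linear_orders m" "agree D R S" "y < v m \<and> Q m x y S"
        then obtain E where E: "finite E" "card E \<le> ?s" "\<forall>R'. agree E S R' \<longrightarrow> Q m x y R'"
          using cert[OF x, of y S] by blast
        have "card (E - D) \<le> ?s"
          using E(2) card_mono[OF E(1), of "E - D"] by auto
        then show "\<exists>E. finite E \<and> card (E - D) \<le> ?s \<and>
            (\<forall>S'\<in>linear_orders m. agree E S S' \<longrightarrow> y < v m \<and> Q m x y S')"
          using E S(3) by blast
      qed
      then obtain E z where E: "finite E" "D \<subseteq> E" "card E \<le> card D + ?s * Suc ?s"
        "\<forall>S y. S \<in> linear_orders m \<longrightarrow> agree E R S \<longrightarrow> y < v m \<and> Q m x y S \<longrightarrow> y = z"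
        by blast
      have "?s * Suc ?s \<le> (m + 2) ^ Suc (k + k)"
      proof -
        have "Suc ?s \<le> (m + 2) * ?s"
        proof -
          have "1 \<le> ?s" by simp
          then have "Suc ?s \<le> 2 * ?s" by linarith
          also have "\<dots> \<le> (m + 2) * ?s" by (rule mult_le_mono1) simp
          finally show ?thesis .
        qed
        then have "?s * Suc ?s \<le> ?s * ((m + 2) * ?s)" by (rule mult_le_mono2)
        also have "\<dots> = (m + 2) ^ Suc (k + k)" by (simp only: power_add power_Suc mult_ac)
        finally show ?thesis .
      qed
      from poly_add[OF D(2) this] E(3) have "card E \<le> (m + 2) ^ K" unfolding K_def by linarith
      then show ?thesis using E(1,2,4) unfolding cylinder_def by blast
    qed
    then obtain E f where Ef: "\<And>x. x < u m \<Longrightarrow> finite (E x)" "\<And>x. x < u m \<Longrightarrow> D \<subseteq> E x"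
      "\<And>x. x < u m \<Longrightarrow> card (E x) \<le> (m + 2) ^ K"
      "\<And>x S y. x < u m \<Longrightarrow> S \<in> cylinder m (E x) R \<Longrightarrow> y < v m \<Longrightarrow> Q m x y S \<Longrightarrow> y = f x"
      by metis
    \<comment> \<open>Finite pigeonhole for f. When some f x is not below v m, the second argument
      is arbitrary.\<close>
    have "\<exists>x x'. x < u m \<and> x' < u m \<and> (f x < v m \<longrightarrow> x \<noteq> x' \<and> f x = f x')"
    proof (rule ccontr)
      assume *: "\<not> ?thesis"
      then have "f ` {..<u m} \<subseteq> {..<v m}" by blast
      moreover have "inj_on f {..<u m}"
        using * by (intro inj_onI) (metis lessThan_iff)
      ultimately have "card {..<u m} \<le> card {..<v m}"
        by (intro card_inj_on_le) auto
      then show False using uv[OF m(1)] by simp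
    qed
    then obtain x x' where x: "x < u m" "x' < u m" "f x < v m \<longrightarrow> x \<noteq> x' \<and> f x = f x'" by blast
    have sub: "cylinder m (E x \<union> E x') R \<subseteq> cylinder m A R" if "A \<subseteq> E x \<union> E x'" for A
      using that agree_subset unfolding cylinder_def by blast
    have "F m (E x \<union> E x') R x x' (f x) (f x')"
      unfolding F_def
    proof (intro conjI)
      show "cylinder m (E x \<union> E x') R \<subseteq> X m"
        unfolding D(4) by (rule sub) (use Ef(2)[OF x(1)] in blast)
      show "card (E x \<union> E x') \<le> (m + 2) ^ Suc (K + K)"
        by (rule card_Un_poly[OF Ef(3)[OF x(1)] Ef(3)[OF x(2)]])
      show "\<forall>S\<in>cylinder m (E x \<union> E x') R. \<forall>z<v m. (Q m x z S \<longrightarrow> z = f x) \<and> (Q m x' z S \<longrightarrow> z = f x')"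
        using sub[of "E x"] sub[of "E x'"] Ef(4)[OF x(1)] Ef(4)[OF x(2)] by blast
    qed (use D(3) x Ef(1) in auto)
    then show ?thesis by blast
  qed
  then obtain E R x x' y y' where F: "\<And>m. m \<in> M \<Longrightarrow> F m (E m) (R m) (x m) (x' m) (y m) (y' m)"
    by metis
  define Y where "Y m = (if m \<in> M then cylinder m (E m) (R m) else {})" for m
  have "condition Y"
    unfolding Y_def by (rule conditionI[OF M, where k = "Suc (K + K)"])
      (drule F, unfold F_def, elim conjE, intro conjI)
  moreover have "Y \<le> X"
    using F unfolding le_fun_def Y_def F_def by auto
  ultimately have Y: "Y \<in> below X" by (simp add: below_def)
  have YM: "m \<in> M" if "Y m \<noteq> {}" for m using that by (auto simp: Y_def split: if_splits)
  \<comment> \<open>The value 0 outside M keeps the sequence within the bound u at every index, as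
    \<open>total\<close> requires.\<close>
  define a where "a m = (if m \<in> M then x m else 0)" for m
  define a' where "a' m = (if m \<in> M then x' m else 0)" for m
  have au: "a m \<le> u m" "a' m \<le> u m" "m \<in> M \<Longrightarrow> a m < u m" "m \<in> M \<Longrightarrow> a' m < u m" for m
    using F[of m] unfolding a_def a'_def F_def by auto
  obtain Z z where Z: "Z \<in> below Y" "always Z (\<lambda>m R. z m < v m \<and> Q m (a m) (z m) R)"
    using total[OF Y au(1)] au(3) YM by blast
  obtain W z' where W: "W \<in> below Z" "always W (\<lambda>m R. z' m < v m \<and> Q m (a' m) (z' m) R)"
    using total[OF below_trans[OF Z(1) Y] au(2)] au(4) YM below_nonempty[OF Z(1)] by blast
  obtain m S where S: "S \<in> W m"
    using condition_nonempty[OF below_condition[OF W(1)]] by blast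
  then have SY: "S \<in> Z m" "S \<in> Y m" "S \<in> X m" using W(1) Z(1) Y below_subset by blast+
  then have m: "m \<in> M" using YM by blast
  have "z m < v m \<and> Q m (a m) (z m) S" "z' m < v m \<and> Q m (a' m) (z' m) S"
    using Z(2) W(2) S SY(1) unfolding always_def by blast+
  then have z: "z m < v m" "Q m (x m) (z m) S" "z' m < v m" "Q m (x' m) (z' m) S"
    using m by (simp_all add: a_def a'_def)
  have "S \<in> cylinder m (E m) (R m)" using SY(2) m by (simp add: Y_def)
  then have "z m = y m" "z' m = y' m" "x m < u m" "x' m < u m" "y m < v m \<longrightarrow> x m \<noteq> x' m \<and> y m = y' m"
    using F[OF m] z unfolding F_def by blast+
  \<comment> \<open>Totality has provided values below v m for both arguments; they must be the
    common value, a collision in S.\<close>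
  then have "B1 m (x m) (x' m) (z m) S" using z unfolding B1_def by auto
  then show False using m SY(3) unfolding M_def by blast
qed

section \<open>Quantifiers with strict bounds, and the forcing of PHP\<close>

lemma Less_Delta_b_0: "(s \<^bold>< t) \<in> Delta_b_0"
  by (intro Delta_b_0.intros)

lemma holds_Less_lift:
  "holds (Var 0 \<^bold>< lift_tm t) (case_nat a e) X \<longleftrightarrow> (\<forall>m. X m \<noteq> {} \<longrightarrow> a m < tval (slice e m) t)"
  by (auto simp: holds_def always_def less_le)

lemma forces_ExLessI:
  assumes "condition X" "e \<in> envs" "a \<in> elements" "\<And>m. X m \<noteq> {} \<Longrightarrow> a m < tval (slice e m) t"
    "forces \<phi> (case_nat a e) X"
  shows "forces (ExLess t \<phi>) e X"
proof -
  have "forces (Var 0 \<^bold>< lift_tm t) (case_nat a e) X"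
    by (rule forces_if_holds[OF Sigma_b_1.intros(1)[OF Less_Delta_b_0] assms(1)
          case_nat_elements[OF assms(3,2)]])
      (use assms(4) in \<open>simp add: holds_Less_lift\<close>)
  then have "forces (Var 0 \<^bold>< lift_tm t \<^bold>\<and> \<phi>) (case_nat a e) Y" if "Y \<in> below X" for Y
    using assms(5) forces_below[OF _ that] unfolding forces.simps(5)[of _ \<phi>] by blast
  then show ?thesis
    unfolding ExLess_def forces.simps(9) dense_def
    using assms(3) below_refl below_condition by blast
qed

lemma forces_ExLessE:
  assumes "condition X" "e \<in> envs" "forces (ExLess t \<phi>) e X"
  obtains Y a where "Y \<in> below X" "a \<in> elements" "\<And>m. Y m \<noteq> {} \<Longrightarrow> a m < tval (slice e m) t"
    "forces \<phi> (case_nat a e) Y"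
proof -
  have "dense X (\<lambda>Z. \<exists>a\<in>elements. forces (Var 0 \<^bold>< lift_tm t \<^bold>\<and> \<phi>) (case_nat a e) Z)"
    using assms(3) unfolding ExLess_def forces.simps(9) .
  from dense_witness[OF assms(1) this] obtain Z a where Z: "Z \<in> below X" and a: "a \<in> elements"
    "forces (Var 0 \<^bold>< lift_tm t) (case_nat a e) Z" "forces \<phi> (case_nat a e) Z"
    unfolding forces.simps(5)[of _ \<phi>] by blast
  obtain Y where Y: "Y \<in> below Z" "holds (Var 0 \<^bold>< lift_tm t) (case_nat a e) Y"
    using forces_imp_holds[OF Sigma_b_1.intros(1)[OF Less_Delta_b_0] below_condition[OF Z]
        case_nat_elements[OF a(1) assms(2)] a(2)] by blast
  show ?thesis
    by (rule that[OF below_trans[OF Y(1) Z] a(1) _ forces_below[OF a(3) Y(1)]])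
      (use Y(2) in \<open>simp add: holds_Less_lift\<close>)
qed

lemma forces_AllLessI:
  assumes "e \<in> envs" "\<And>a Y. \<lbrakk>a \<in> elements; Y \<in> below X; \<And>m. Y m \<noteq> {} \<Longrightarrow> a m < tval (slice e m) t\<rbrakk>
    \<Longrightarrow> forces \<phi> (case_nat a e) Y"
  shows "forces (AllLess t \<phi>) e X"
proof -
  have "forces \<phi> (case_nat a e) Y"
    if a: "a \<in> elements" and Y: "Y \<in> below X" "forces (Var 0 \<^bold>< lift_tm t) (case_nat a e) Y" for a Y
  proof (rule forces_dense, unfold dense_def, rule ballI)
    fix Z assume Z: "Z \<in> below Y"
    obtain W where W: "W \<in> below Z" "holds (Var 0 \<^bold>< lift_tm t) (case_nat a e) W"
      using forces_imp_holds[OF Sigma_b_1.intros(1)[OF Less_Delta_b_0] below_condition[OF Z]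
          case_nat_elements[OF a assms(1)] forces_below[OF Y(2) Z]] by blast
    have "forces \<phi> (case_nat a e) W"
      by (rule assms(2)[OF a below_trans[OF W(1) below_trans[OF Z Y(1)]]])
        (use W(2) in \<open>simp add: holds_Less_lift\<close>)
    then show "\<exists>W\<in>below Z. forces \<phi> (case_nat a e) W" using W(1) by blast
  qed
  then show ?thesis
    unfolding AllLess_def forces.simps(8,7) by blast
qed

lemma forces_AllLessD:
  assumes "condition X" "e \<in> envs" "forces (AllLess t \<phi>) e X" "a \<in> elements"
    "\<And>m. X m \<noteq> {} \<Longrightarrow> a m < tval (slice e m) t"
  shows "forces \<phi> (case_nat a e) X"
proof -
  have "forces (Var 0 \<^bold>< lift_tm t) (case_nat a e) X"
    by (rule forces_if_holds[OF Sigma_b_1.intros(1)[OF Less_Delta_b_0] assms(1)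
          case_nat_elements[OF assms(4,2)]])
      (use assms(5) in \<open>simp add: holds_Less_lift\<close>)
  then show ?thesis
    using assms(3,4) below_refl[OF assms(1)] unfolding AllLess_def forces.simps(8,7) by blast
qed

lemma forces_DisjI1: "forces \<phi> e X \<Longrightarrow> forces (\<phi> \<^bold>\<or> \<psi>) e X"
  unfolding forces.simps(6) dense_def using forces_below below_refl below_condition by blast

lemma forces_DisjI2: "forces \<psi> e X \<Longrightarrow> forces (\<phi> \<^bold>\<or> \<psi>) e X"
  unfolding forces.simps(6) dense_def using forces_below below_refl below_condition by blast

lemma forces_DisjE:
  assumes "condition X" "forces (\<phi> \<^bold>\<or> \<psi>) e X"
  obtains Y where "Y \<in> below X" "forces \<phi> e Y" | Y where "Y \<in> below X" "forces \<psi> e Y"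
  using dense_witness[OF assms(1) assms(2)[unfolded forces.simps(6)]] by blast

lemma forces_inst2:
  "forces (inst2 k \<phi> (Var i) (Var j)) e X \<longleftrightarrow>
    forces \<phi> (case_nat (e i) (case_nat (e j) (\<lambda>n. e (n + k)))) X"
proof -
  have "subst_env (\<lambda>n. if n = 0 then Var i else if n = 1 then Var j else Var (n - 2 + k)) e =
      case_nat (e i) (case_nat (e j) (\<lambda>n. e (n + k)))"
    by (intro ext) (auto simp: subst_env_def slice_apply split: nat.split)
  then show ?thesis by (simp add: inst2_def forces_subst)
qed

text \<open>If the disjunction is not forced densely, there is a condition below which none of the
  three disjuncts is ever forced. These three failures become the hypotheses \<open>total\<close>,
  \<open>inj\<close> and \<open>func\<close> of \<open>pigeonhole_forcing\<close>.\<close>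

lemma forces_PHP:
  assumes \<phi>: "\<phi> \<in> Sigma_b_1" and X: "condition X" and "e \<in> envs"
  shows "forces (PHP \<phi>) e X"
  unfolding PHP_def
proof (rule forces_closure[OF _ assms(3)])
  fix e assume e: "e \<in> envs"
  let ?A = "ExLess (Var 1) (AllLess (Var 1) (\<^bold>\<not> inst2 4 \<phi> (Var 1) (Var 0)))"
  let ?B = "ExLess (Var 1) (ExLess (Var 2) (ExLess (Var 2)
        (\<^bold>\<not> (Var 2 \<^bold>= Var 1) \<^bold>\<and> inst2 5 \<phi> (Var 2) (Var 0) \<^bold>\<and> inst2 5 \<phi> (Var 1) (Var 0))))"
  let ?C = "ExLess (Var 1) (ExLess (Var 1) (ExLess (Var 2)
        (\<^bold>\<not> (Var 1 \<^bold>= Var 0) \<^bold>\<and> inst2 5 \<phi> (Var 2) (Var 1) \<^bold>\<and> inst2 5 \<phi> (Var 2) (Var 0))))"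
  have "forces (?A \<^bold>\<or> ?B \<^bold>\<or> ?C) (case_nat v (case_nat u e)) Y"
    if u: "u \<in> elements" and v: "v \<in> elements" and Y: "Y \<in> below X"
      and vu: "forces (Var 0 \<^bold>< Var 1) (case_nat v (case_nat u e)) Y" for u v Y
  proof (rule forces_dense, unfold dense_def, rule ballI, rule ccontr)
    let ?e = "case_nat v (case_nat u e)"
    fix Z0 assume Z0: "Z0 \<in> below Y" and no: "\<not> (\<exists>W\<in>below Z0. forces (?A \<^bold>\<or> ?B \<^bold>\<or> ?C) ?e W)"
    have e2: "?e \<in> envs" by (intro case_nat_elements u v e)
    obtain Z where Z: "Z \<in> below Z0" "holds (Var 0 \<^bold>< Var 1) ?e Z"
      using forces_imp_holds[OF Sigma_b_1.intros(1)[OF Less_Delta_b_0] below_condition[OF Z0] e2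
          forces_below[OF vu Z0]] by blast
    have no: "\<not> forces ?A ?e W" "\<not> forces ?B ?e W" "\<not> forces ?C ?e W" if "W \<in> below Z" for W
      using no below_trans[OF that Z(1)] forces_DisjI1 forces_DisjI2 by blast+
    define Q where "Q m x y R \<longleftrightarrow> sat R (case_nat x (case_nat y (slice e m))) \<phi>" for m x y R
    have holds_Q: "holds \<phi> (case_nat x (case_nat y e)) W \<longleftrightarrow> always W (\<lambda>m R. Q m (x m) (y m) R)" for x y W
      by (simp add: holds_def Q_def)
    have forces_Q: "forces \<phi> (case_nat x (case_nat y e)) W"
      if "W \<in> below Z" "x \<in> elements" "y \<in> elements" "always W (\<lambda>m R. Q m (x m) (y m) R)" for x y W
      by (rule forces_if_holds[OF \<phi> below_condition[OF that(1)]])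
        (use that e in \<open>simp_all add: case_nat_elements holds_Q\<close>)
    have forces_neq: "forces (\<^bold>\<not> (Var i \<^bold>= Var j)) e' W"
      if "W \<in> below Z" "e' \<in> envs" "\<And>m. W m \<noteq> {} \<Longrightarrow> e' i m \<noteq> e' j m" for e' W i j
      by (rule forces_if_holds[OF Sigma_b_1.intros(1) below_condition[OF that(1)] that(2)])
        (use that(3) in \<open>auto intro: Delta_b_0.intros simp: holds_def always_def slice_apply\<close>)
    \<comment> \<open>The sum dominates every x < u m and every y < v m, so a single exponent bounds
      all arguments and parameters of Q.\<close>
    have "(\<lambda>m. u m + v m) \<in> elements"
      using tval_elements[of "case_nat u (case_nat v e)" "Var 0 \<^bold>+ Var 1"] u v e
      by (simp add: case_nat_elements)
    then have "case_nat (\<lambda>m. u m + v m) (case_nat (\<lambda>m. u m + v m) e) i \<in> elements" for i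
      using e unfolding envs_def by (simp split: nat.split)
    then obtain j where "\<forall>m. \<forall>i\<in>fv \<phi>.
        blen (case_nat (\<lambda>m. u m + v m) (case_nat (\<lambda>m. u m + v m) e) i m) \<le> (m + 2) ^ j"
      using elements_bounded[OF finite_fv] by metis
    then have j: "\<And>m i. i \<in> fv \<phi> \<Longrightarrow>
        blen (case_nat (\<lambda>m. u m + v m) (case_nat (\<lambda>m. u m + v m) e) i m) \<le> (m + 2) ^ j" by blast
    obtain k where k: "\<And>m e R. \<lbrakk>\<forall>i\<in>fv \<phi>. blen (e i) \<le> (m + 2) ^ j; sat R e \<phi>\<rbrakk> \<Longrightarrow>
      \<exists>D. finite D \<and> card D \<le> (m + 2) ^ k \<and> (\<forall>R'. agree D R R' \<longrightarrow> sat R' e \<phi>)"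
      using certifiable_uniform[OF Sigma_b_1_certifiable[OF \<phi>], of j] by blast
    show False
    proof (rule pigeonhole_forcing[where X = Z and u = u and v = v and Q = Q and k = k])
      show "condition Z" by (rule below_condition[OF Z(1)])
      show "v m < u m" if "Z m \<noteq> {}" for m
        using Z(2) that by (auto simp: holds_def always_def)
    next
      fix m x y R assume xy: "x < u m" "y < v m" "Q m x y R"
      have "\<forall>i\<in>fv \<phi>. blen (case_nat x (case_nat y (slice e m)) i) \<le> (m + 2) ^ j"
      proof
        fix i assume i: "i \<in> fv \<phi>"
        have "case_nat x (case_nat y (slice e m)) i \<le>
            case_nat (\<lambda>m. u m + v m) (case_nat (\<lambda>m. u m + v m) e) i m"
          using xy by (simp add: slice_apply split: nat.split)
        then show "blen (case_nat x (case_nat y (slice e m)) i) \<le> (m + 2) ^ j"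
          using order_trans[OF blen_mono j[OF i]] by blast
      qed
      from k[OF this xy(3)[unfolded Q_def]]
      show "\<exists>D. finite D \<and> card D \<le> (m + 2) ^ k \<and> (\<forall>R'. agree D R R' \<longrightarrow> Q m x y R')"
        unfolding Q_def .
    next
      fix Y x assume Y: "Y \<in> below Z" "\<And>m. x m \<le> u m" "\<And>m. Y m \<noteq> {} \<Longrightarrow> x m < u m"
      have x: "x \<in> elements" by (rule elements_le[OF u Y(2)])
      show "\<exists>W\<in>below Y. \<exists>y. always W (\<lambda>m R. y m < v m \<and> Q m (x m) (y m) R)"
      proof (rule ccontr)
        assume *: "\<not> ?thesis"
        have "forces (AllLess (Var 1) (\<^bold>\<not> inst2 4 \<phi> (Var 1) (Var 0))) (case_nat x ?e) Y"
        proof (rule forces_AllLessI)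
          fix y W assume y: "y \<in> elements" and W: "W \<in> below Y"
            "\<And>m. W m \<noteq> {} \<Longrightarrow> y m < tval (slice (case_nat x ?e) m) (Var 1)"
          \<comment> \<open>By \<open>*\<close> no extension of Y gives x a value below v; hence for
            each y the negated instance is forced, which would force the first disjunct.\<close>
          have False if V: "V \<in> below W" "forces \<phi> (case_nat x (case_nat y e)) V" for V
          proof -
            obtain V' where V': "V' \<in> below V" "holds \<phi> (case_nat x (case_nat y e)) V'"
              using forces_imp_holds[OF \<phi> below_condition[OF V(1)] _ V(2)] x y e
              by (auto simp: case_nat_elements)
            have VY: "V' \<in> below W" "V' \<in> below Y" using V'(1) V(1) W(1) below_trans by blast+
            have "always V' (\<lambda>m R. y m < v m \<and> Q m (x m) (y m) R)"
              using V'(2) W(2) below_nonempty[OF VY(1)] unfolding holds_Q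
              by (fastforce simp: always_def)
            then show False using * VY(2) by blast
          qed
          then show "forces (\<^bold>\<not> inst2 4 \<phi> (Var 1) (Var 0)) (case_nat y (case_nat x ?e)) W"
            by (auto simp: forces_inst2 numeral_eq_Suc)
        qed (intro case_nat_elements x e2)
        then have "forces ?A ?e Y"
          by (intro forces_ExLessI[OF below_condition[OF Y(1)] e2 x]) (use Y(3) in simp_all)
        then show False using no(1)[OF Y(1)] by blast
      qed
    next
      fix Y x x' y
      assume Y: "Y \<in> below Z" "\<And>m. x m \<le> u m" "\<And>m. x' m \<le> u m" "\<And>m. y m \<le> v m"
        and *: "always Y (\<lambda>m R. x m < u m \<and> x' m < u m \<and> y m < v m \<and> x m \<noteq> x' m \<and>
          Q m (x m) (y m) R \<and> Q m (x' m) (y m) R)"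
      have el: "x \<in> elements" "x' \<in> elements" "y \<in> elements"
        using elements_le[OF u Y(2)] elements_le[OF u Y(3)] elements_le[OF v Y(4)] by blast+
      have lt: "x m < u m" "x' m < u m" "y m < v m" "x m \<noteq> x' m" if "Y m \<noteq> {}" for m
        using * that unfolding always_def by blast+
      have Q: "always Y (\<lambda>m R. Q m (x m) (y m) R)" "always Y (\<lambda>m R. Q m (x' m) (y m) R)"
        using * by (auto simp: always_def)
      have "forces ?B ?e Y"
        by (intro forces_ExLessI[OF below_condition[OF Y(1)] _ el(1)]
            forces_ExLessI[OF below_condition[OF Y(1)] _ el(2)]
            forces_ExLessI[OF below_condition[OF Y(1)] _ el(3)] case_nat_elements el u v e)
          (use lt el e2 forces_Q[OF Y(1) el(1,3) Q(1)] forces_Q[OF Y(1) el(2,3) Q(2)]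
            forces_neq[OF Y(1), of "case_nat y (case_nat x' (case_nat x ?e))" 2 1]
            in \<open>simp_all add: forces_inst2 numeral_eq_Suc case_nat_elements del: forces.simps(4)\<close>)
      then show False using no(2)[OF Y(1)] by blast
    next
      fix Y x y y'
      assume Y: "Y \<in> below Z" "\<And>m. x m \<le> u m" "\<And>m. y m \<le> v m" "\<And>m. y' m \<le> v m"
        and *: "always Y (\<lambda>m R. x m < u m \<and> y m < v m \<and> y' m < v m \<and> y m \<noteq> y' m \<and>
          Q m (x m) (y m) R \<and> Q m (x m) (y' m) R)"
      have el: "x \<in> elements" "y \<in> elements" "y' \<in> elements"
        using elements_le[OF u Y(2)] elements_le[OF v Y(3)] elements_le[OF v Y(4)] by blast+
      have lt: "x m < u m" "y m < v m" "y' m < v m" "y m \<noteq> y' m" if "Y m \<noteq> {}" for m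
        using * that unfolding always_def by blast+
      have Q: "always Y (\<lambda>m R. Q m (x m) (y m) R)" "always Y (\<lambda>m R. Q m (x m) (y' m) R)"
        using * by (auto simp: always_def)
      have "forces ?C ?e Y"
        by (intro forces_ExLessI[OF below_condition[OF Y(1)] _ el(1)]
            forces_ExLessI[OF below_condition[OF Y(1)] _ el(2)]
            forces_ExLessI[OF below_condition[OF Y(1)] _ el(3)] case_nat_elements el u v e)
          (use lt el e2 forces_Q[OF Y(1) el(1,2) Q(1)] forces_Q[OF Y(1) el(1,3) Q(2)]
            forces_neq[OF Y(1), of "case_nat y' (case_nat y (case_nat x ?e))" 1 0]
            in \<open>simp_all add: forces_inst2 numeral_eq_Suc case_nat_elements del: forces.simps(4)\<close>)
      then show False using no(3)[OF Y(1)] by blast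
    qed
  qed
  then show "forces (Forall (Forall (Var 0 \<^bold>< Var 1 \<^bold>\<longrightarrow> ?A \<^bold>\<or> ?B \<^bold>\<or> ?C))) e X"
    unfolding forces.simps(7,8) by blast
qed

section \<open>The minimum principle fails\<close>

text \<open>With h about half of m, one factor 2 ^ h beats the polynomial of degree k by induction,
  and the other beats the remaining linear factor.\<close>

lemma poly_less_exp: "\<exists>N. \<forall>m\<ge>N. c * (m + 2) ^ k < (2 :: nat) ^ m"
proof (induction k arbitrary: c)
  case 0
  have "c < 2 ^ m" if "m \<ge> c" for m
    using less_exp[of m] that by linarith
  then show ?case by auto
next
  case (Suc k)
  obtain N where N: "\<And>m. m \<ge> N \<Longrightarrow> c * 2 ^ Suc k * (m + 2) ^ k < (2 :: nat) ^ m"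
    using Suc.IH[of "c * 2 ^ Suc k"] by blast
  \<comment> \<open>The threshold gives h \<ge> N for the induction hypothesis and h \<ge> 2 for h +
    2 \<le> 2 ^ h.\<close>
  have "c * (m + 2) ^ Suc k < 2 ^ m" if m: "m \<ge> 2 * N + 4" for m
  proof -
    define h where "h = m div 2"
    have h: "N \<le> h" "2 \<le> h" "m + 2 \<le> 2 * (h + 2)" "2 * h \<le> m" using m unfolding h_def by auto
    have sq: "h + 2 \<le> 2 ^ h"
      using h(2)
    proof (induction h rule: dec_induct)
      case (step n)
      then show ?case by simp
    qed simp
    have "c * (m + 2) ^ Suc k \<le> c * (2 * (h + 2)) ^ Suc k"
      using h(3) by (intro mult_le_mono2 power_mono) auto
    also have "\<dots> = (c * 2 ^ Suc k * (h + 2) ^ k) * (h + 2)"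
      by (simp only: power_mult_distrib power_Suc mult_ac)
    also have "\<dots> < 2 ^ h * (h + 2)"
      using N[OF h(1)] by (intro mult_strict_right_mono) auto
    also have "\<dots> \<le> 2 ^ h * 2 ^ h" using sq by (rule mult_le_mono2)
    also have "\<dots> \<le> 2 ^ m"
      unfolding power_add[symmetric] using h(4) by (intro power_increasing) auto
    finally show ?thesis .
  qed
  then show ?case by blast
qed

text \<open>Only comparisons with b change, so a condition whose domain avoids b cannot prevent b
  from being the least point.\<close>

lemma move_to_bottom:
  assumes R: "R \<in> linear_orders m" and b: "b < 2 ^ m"
  defines "R' \<equiv> {(i, j) \<in> R. i \<noteq> b \<and> j \<noteq> b} \<union> {b} \<times> ({..<2 ^ m} - {b})"
  shows "R' \<in> linear_orders m" "b \<notin> D \<Longrightarrow> agree D R R'"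
proof -
  have R: "R \<subseteq> {..<2 ^ m} \<times> {..<2 ^ m}" "trans R" "irrefl R" "total_on {..<2 ^ m} R"
    using R by (auto simp: linear_orders_def)
  have "R' \<subseteq> {..<2 ^ m} \<times> {..<2 ^ m}" using R(1) b unfolding R'_def by auto
  moreover have "trans R'"
    using R(1,2) unfolding R'_def trans_def by blast
  moreover have "irrefl R'" using R(3) unfolding R'_def irrefl_def by blast
  moreover have "total_on {..<2 ^ m} R'" using R(4) unfolding R'_def total_on_def by blast
  ultimately show "R' \<in> linear_orders m" by (simp add: linear_orders_def)
  show "agree D R R'" if "b \<notin> D" using that unfolding R'_def agree_def by auto
qed

lemma exp_elements: "(\<lambda>m. 2 ^ m) \<in> elements"
  unfolding elements_def by (simp add: exI[of _ 1])

text \<open>A proposed least element a is beaten at each large index by a point b outside the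
  polynomially small domain; the sequence of these points is an element below 2 ^ m that refutes the
  universal statement.\<close>

lemma not_forces_least:
  assumes X: "condition X" and e: "e \<in> envs" and e0: "e 0 = (\<lambda>m. 2 ^ m)"
  shows "\<not> forces (ExLess (Var 0) (AllLess (Var 1) (Var 1 \<^bold>= Var 0 \<^bold>\<or> Var 1 \<^bold>\<lhd> Var 0))) e X"
proof
  let ?\<phi> = "Var 1 \<^bold>= Var 0 \<^bold>\<or> Var 1 \<^bold>\<lhd> Var 0"
  assume *: "forces (ExLess (Var 0) (AllLess (Var 1) ?\<phi>)) e X"
  obtain Y a where Y: "Y \<in> below X" and a: "a \<in> elements" "\<And>m. Y m \<noteq> {} \<Longrightarrow> a m < 2 ^ m"
    and f: "forces (AllLess (Var 1) ?\<phi>) (case_nat a e) Y"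
    using forces_ExLessE[OF X e *] by (auto simp: slice_apply e0)
  have Yc: "condition Y" by (rule below_condition[OF Y])
  then obtain k where k: "\<And>m. Y m \<noteq> {} \<Longrightarrow> \<exists>D R. finite D \<and> card D \<le> (m + 2) ^ k \<and>
      R \<in> linear_orders m \<and> Y m = cylinder m D R"
    unfolding condition_def by blast
  \<comment> \<open>The factor 2 leaves room for the point a m in addition to the domain.\<close>
  obtain N where N: "\<And>m. m \<ge> N \<Longrightarrow> 2 * (m + 2) ^ k < (2 :: nat) ^ m"
    using poly_less_exp by blast
  define M where "M = {m. Y m \<noteq> {}} - {..<N}"
  have M: "infinite M"
    unfolding M_def using condition_infinite[OF Yc] by (simp add: Diff_infinite_finite)
  \<comment> \<open>The exponent is k for the old domain, 1 for the two new points, and one more for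
    their union.\<close>
  define F where "F m E R b \<longleftrightarrow> finite E \<and> card E \<le> (m + 2) ^ Suc (k + 1) \<and> R \<in> linear_orders m \<and>
    cylinder m E R \<subseteq> Y m \<and> b < 2 ^ m \<and> (\<forall>S\<in>cylinder m E R. a m \<noteq> b \<and> (a m, b) \<notin> S)" for m E R b
  have "\<exists>E R b. F m E R b" if "m \<in> M" for m
  proof -
    have m: "Y m \<noteq> {}" "N \<le> m" using that unfolding M_def by auto
    obtain D R where D: "finite D" "card D \<le> (m + 2) ^ k" "R \<in> linear_orders m"
      "Y m = cylinder m D R"
      using k[OF m(1)] by (elim exE conjE)
    have "card (insert (a m) D) \<le> Suc (card D)" by (rule card_insert_le_m1) auto
    also have "\<dots> \<le> 2 * (m + 2) ^ k"
    proof -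
      have "1 \<le> (m + 2) ^ k" by simp
      then show ?thesis using D(2) by linarith
    qed
    also have "\<dots> < card {..<(2 :: nat) ^ m}" using N[OF m(2)] by simp
    finally have "\<not> {..<(2 :: nat) ^ m} \<subseteq> insert (a m) D"
      using card_mono[of "insert (a m) D" "{..<(2 :: nat) ^ m}"] D(1) by auto
    then obtain b where b: "b < 2 ^ m" "b \<noteq> a m" "b \<notin> D" by auto
    define R' where "R' = {(i, j) \<in> R. i \<noteq> b \<and> j \<noteq> b} \<union> {b} \<times> ({..<2 ^ m} - {b})"
    have R': "R' \<in> linear_orders m" "agree D R R'" "(b, a m) \<in> R'"
      using move_to_bottom[OF D(3) b(1), folded R'_def] b a(2)[OF m(1)] by (auto simp: R'_def)
    \<comment> \<open>Both points enter the domain, so that b lies below a m in every order of the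
      cylinder.\<close>
    let ?E = "D \<union> {a m, b}"
    have "F m ?E R' b"
      unfolding F_def
    proof (intro conjI ballI)
      show "card ?E \<le> (m + 2) ^ Suc (k + 1)"
        by (rule card_Un_poly[OF D(2)]) (simp add: card_insert_if)
      show "cylinder m ?E R' \<subseteq> Y m"
        unfolding D(4) cylinder_def using agree_trans[OF R'(2)] agree_subset by blast
      fix S assume "S \<in> cylinder m ?E R'"
      then have S: "S \<in> linear_orders m" "(b, a m) \<in> S"
        using R'(3) unfolding cylinder_def agree_def by auto
      then show "(a m, b) \<notin> S"
        unfolding linear_orders_def irrefl_def trans_def by blast
    qed (use D(1) R' b in auto)
    then show ?thesis by blast
  qed
  then obtain E R b where F: "\<And>m. m \<in> M \<Longrightarrow> F m (E m) (R m) (b m)"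
    by metis
  define Z where "Z m = (if m \<in> M then cylinder m (E m) (R m) else {})" for m
  have Zc: "condition Z"
    unfolding Z_def by (rule conditionI[OF M, where k = "Suc (k + 1)"])
      (drule F, unfold F_def, elim conjE, intro conjI)
  have Z: "Z \<in> below Y"
    unfolding below_def le_fun_def Z_def using F Zc by (simp add: F_def Z_def[abs_def])
  \<comment> \<open>The default 0 is below 2 ^ m, which makes c an element.\<close>
  define c where "c m = (if m \<in> M then b m else 0)" for m
  have c: "c \<in> elements"
    by (rule elements_le[OF exp_elements]) (use F in \<open>auto simp: c_def F_def less_imp_le\<close>)
  have ZM: "m \<in> M" if "Z m \<noteq> {}" for m using that by (auto simp: Z_def split: if_splits)
  have ae: "case_nat a e \<in> envs" by (rule case_nat_elements[OF a(1) e])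
  have "forces ?\<phi> (case_nat c (case_nat a e)) Z"
  proof (rule forces_AllLessD[OF Zc ae forces_below[OF f Z] c])
    fix m assume "Z m \<noteq> {}"
    then show "c m < tval (slice (case_nat a e) m) (Var 1)"
      using ZM[of m] F[of m] by (simp add: c_def F_def slice_apply e0)
  qed
  moreover have "?\<phi> \<in> Sigma_b_1" by (intro Sigma_b_1.intros(1) Delta_b_0.intros)
  ultimately obtain W where W: "W \<in> below Z" "holds ?\<phi> (case_nat c (case_nat a e)) W"
    using forces_imp_holds[OF _ Zc case_nat_elements[OF c ae]] by blast
  obtain m S where S: "S \<in> W m"
    using condition_nonempty[OF below_condition[OF W(1)]] by blast
  then have SZ: "S \<in> Z m" using below_subset[OF W(1)] by blast
  then have m: "m \<in> M" using ZM by blast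
  have "a m = c m \<or> (a m, c m) \<in> S"
    using W(2) S by (auto simp: holds_def always_def)
  moreover have "a m \<noteq> b m \<and> (a m, b m) \<notin> S"
    using F[OF m] SZ m unfolding F_def Z_def by auto
  ultimately show False using m by (simp add: c_def)
qed

section \<open>Refuting the whole disjunction\<close>

lemma not_forces_Disj:
  assumes "\<And>Y. condition Y \<Longrightarrow> \<not> forces \<phi> e Y" "\<And>Y. condition Y \<Longrightarrow> \<not> forces \<psi> e Y" "condition X"
  shows "\<not> forces (\<phi> \<^bold>\<or> \<psi>) e X"
  using assms forces_DisjE below_condition by metis

lemma not_forces_ExLess:
  assumes "\<And>Y a. \<lbrakk>Y \<in> below X; condition Y; a \<in> elements; \<And>m. Y m \<noteq> {} \<Longrightarrow> a m < tval (slice e m) t\<rbrakk> \<Longrightarrow>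
      \<not> forces \<phi> (case_nat a e) Y"
    and "condition X" "e \<in> envs"
  shows "\<not> forces (ExLess t \<phi>) e X"
proof
  assume "forces (ExLess t \<phi>) e X"
  then show False
    by (rule forces_ExLessE[OF assms(2,3)]) (use assms(1) below_condition in blast)
qed

lemma not_forces_if_unsat:
  assumes "\<phi> \<in> Delta_b_0" "condition X" "e \<in> envs"
    "\<And>m R. R \<in> linear_orders m \<Longrightarrow> X m \<noteq> {} \<Longrightarrow> \<not> sat R (slice e m) \<phi>"
  shows "\<not> forces \<phi> e X"
proof
  assume "forces \<phi> e X"
  then obtain Z where Z: "Z \<in> below X" "holds \<phi> e Z"
    using forces_imp_holds[OF Sigma_b_1.intros(1)[OF assms(1)] assms(2,3)] by blast
  obtain m R where R: "R \<in> Z m"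
    using condition_nonempty[OF below_condition[OF Z(1)]] by blast
  have "R \<in> linear_orders m" by (rule condition_linear_orders[OF below_condition[OF Z(1)] R])
  moreover have "sat R (slice e m) \<phi>" using Z(2) R by (simp add: holds_def always_def)
  ultimately show False using assms(4) below_nonempty[OF Z(1)] R by blast
qed

lemma not_forces_MIN_Prec:
  assumes X: "condition X" and e: "e \<in> envs" and e0: "e 0 = (\<lambda>m. 2 ^ m)"
  shows "\<not> forces MIN_Prec e X"
proof -
  have LO: "(x, x) \<notin> R" "(x, y) \<in> R \<Longrightarrow> (y, x) \<notin> R" "(x, y) \<in> R \<Longrightarrow> (y, z) \<in> R \<Longrightarrow> (x, z) \<in> R"
    "x < 2 ^ m \<Longrightarrow> y < 2 ^ m \<Longrightarrow> x \<noteq> y \<Longrightarrow> (x, y) \<in> R \<or> (y, x) \<in> R"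
    if "R \<in> linear_orders m" for m R x y z
    using that unfolding linear_orders_def trans_def irrefl_def total_on_def by blast+
  show ?thesis
    unfolding MIN_Prec_def
  proof (intro not_forces_Disj X)
    fix Y assume Y: "condition Y"
    show "\<not> forces (ExLess (Var 0) (Var 0 \<^bold>\<lhd> Var 0)) e Y"
      by (intro not_forces_ExLess not_forces_if_unsat case_nat_elements Delta_b_0.intros Y e)
        (simp_all add: LO)
    show "\<not> forces (ExLess (Var 0) (ExLess (Var 1)
        (\<^bold>\<not> (Var 1 \<^bold>= Var 0) \<^bold>\<and> Var 1 \<^bold>\<lhd> Var 0 \<^bold>\<and> Var 0 \<^bold>\<lhd> Var 1))) e Y"
      by (intro not_forces_ExLess not_forces_if_unsat case_nat_elements Delta_b_0.intros Y e)
        (use LO(2) in \<open>auto\<close>)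
    show "\<not> forces (ExLess (Var 0) (ExLess (Var 1)
        (\<^bold>\<not> (Var 1 \<^bold>= Var 0) \<^bold>\<and> \<^bold>\<not> (Var 1 \<^bold>\<lhd> Var 0) \<^bold>\<and> \<^bold>\<not> (Var 0 \<^bold>\<lhd> Var 1)))) e Y"
      \<comment> \<open>The orders are total only below 2 ^ m, so the quantifier bounds enter
        here.\<close>
      by (intro not_forces_ExLess not_forces_if_unsat case_nat_elements Delta_b_0.intros Y e)
        (simp_all add: slice_apply e0, metis LO(4) below_nonempty)
    show "\<not> forces (ExLess (Var 0) (ExLess (Var 1) (ExLess (Var 2)
        (Var 2 \<^bold>\<lhd> Var 1 \<^bold>\<and> Var 1 \<^bold>\<lhd> Var 0 \<^bold>\<and> \<^bold>\<not> (Var 2 \<^bold>\<lhd> Var 0))))) e Y"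
      by (intro not_forces_ExLess not_forces_if_unsat case_nat_elements Delta_b_0.intros Y e)
        (use LO(3) in \<open>auto\<close>)
    show "\<not> forces (ExLess (Var 0) (AllLess (Var 1) (Var 1 \<^bold>= Var 0 \<^bold>\<or> Var 1 \<^bold>\<lhd> Var 0))) e Y"
      by (rule not_forces_least[OF Y e e0])
  qed
qed

section \<open>The theory is forced, the principle is not\<close>

lemma ex_condition: "\<exists>X. condition X"
proof -
  have "{(i, j). i < j \<and> j < 2 ^ m} \<in> linear_orders m" for m
    by (auto simp: linear_orders_def trans_def irrefl_def total_on_def)
  then have "condition (\<lambda>m. if m \<in> UNIV then cylinder m {} {(i, j). i < j \<and> j < 2 ^ m} else {})"
    by (intro conditionI[where k = 0]) auto
  then show ?thesis by blast
qed

lemma forces_theory: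
  assumes "\<phi> \<in> T12 \<union> PHP ` Delta_b_1" "condition X" "e \<in> envs"
  shows "forces \<phi> e X"
  using assms forces_BASIC forces_IND forces_PIND forces_PHP
  unfolding T12_def S12_def Delta_b_1_def by blast

theorem theorem2p2:
  "\<not> (T12 \<union> PHP ` Delta_b_1 \<turnstile> Forall MIN_Prec) \<and>
   \<not> (T12 \<union> PHP ` Delta_b_1 \<turnstile> Forall (\<^bold>0 \<^bold>< Var 0 \<^bold>\<longrightarrow> MIN_Prec))"
proof -
  obtain X where X: "condition X" using ex_condition by blast
  \<comment> \<open>Any environment would do for sentences; what matters is that e' interprets n as
    the sequence 2 ^ m.\<close>
  define e where "e i = (\<lambda>m. 2 ^ m :: nat)" for i :: nat
  define e' where "e' = case_nat (\<lambda>m. 2 ^ m) e"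
  have e: "e \<in> envs" by (simp add: e_def envs_def exp_elements)
  have e': "e' \<in> envs" unfolding e'_def by (rule case_nat_elements[OF exp_elements e])
  have no: "\<not> forces MIN_Prec e' X"
    by (rule not_forces_MIN_Prec[OF X e']) (simp add: e'_def)
  have forced: "forces \<phi> e X" if "T12 \<union> PHP ` Delta_b_1 \<turnstile> \<phi>" for \<phi>
    using soundness[OF that X e] forces_theory X e by blast
  \<comment> \<open>Since 2 ^ m is positive at every index, the same n refutes the version
    restricted to n > 0.\<close>
  have pos: "forces (\<^bold>0 \<^bold>< Var 0) e' X"
    by (rule forces_if_holds[OF Sigma_b_1.intros(1)[OF Less_Delta_b_0] X e'])
      (simp add: holds_def always_def e'_def)
  show ?thesis
  proof (intro conjI notI)
    assume "T12 \<union> PHP ` Delta_b_1 \<turnstile> Forall MIN_Prec"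
    from forced[OF this] show False
      using no exp_elements unfolding forces.simps(8) e'_def by blast
  next
    assume "T12 \<union> PHP ` Delta_b_1 \<turnstile> Forall (\<^bold>0 \<^bold>< Var 0 \<^bold>\<longrightarrow> MIN_Prec)"
    from forced[OF this] show False
      using no pos exp_elements below_refl[OF X] unfolding forces.simps(8,7) e'_def by blast
  qed
qed

end
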